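(* Let $(M^n,g)$ be a Riemannian manifold and let $T_1M^n$ be its unit tangent bundle with the Sasaki metric. Let $\xi$ be a smooth (local) unit vector field on $M^n$. Then $\xi$ generates a totally geodesic submanifold $\xi(M^n)\subset T_1M^n$ if and only if $$Hess_\xi(X,Y)+A_\xi\, Hm_\xi(X,Y)-\langle A_\xi X,A_\xi Y\rangle\,\xi=0$$ for all (local) vector fields $X,Y$ on $M^n$.
   Context: $\langle\cdot,\cdot\rangle=g$, $\nabla$ is the Levi-Civita connection of $g$, and $R(X,Y)Z=\nabla_X\nabla_YZ-\nabla_Y\nabla_XZ-\nabla_{[X,Y]}Z$. Sasaki metric: at $Q=(q,\xi)\in TM$, each $X\in T_qM$ has a horizontal lift $X^h$ and a vertical lift $X^v$ in $T_QTM$ (with respect to $\nabla$); the Sasaki metric on $TM$ is determined by $\langle\langle X^h,Y^h\rangle\rangle=\langle X,Y\rangle$, $\langle\langle X^h,Y^v\rangle\rangle=0$, $\langle\langle X^v,Y^v\rangle\rangle=\langle X,Y\rangle$. The unit tangent bundle $T_1M$ carries the induced metric. A unit vector field $\xi$ (possibly only locally defined) is viewed as the imbedding $q\mapsto(q,\xi(q))$ into $T_1M$, and $\xi(M)$ denotes its image (for a local field, the image of its domain). For a unit vector field $\xi$ put $A_\xi X=-\nabla_X\xi$ (so $A_\xi$ takes values in $\xi^\perp$), $(\nabla_XA_\xi)Y=-(\nabla_X\nabla_Y\xi-\nabla_{\nabla_XY}\xi)$, $$Hess_\xi(X,Y)=\tfrac12\big[(\nabla_YA_\xi)X+(\nabla_XA_\xi)Y\big],\qquad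 Hm_\xi(X,Y)=\tfrac12\big[R(\xi,A_\xi X)Y+R(\xi,A_\xi Y)X\big].$$ *)

theory Defs
  imports "HOL-Analysis.Analysis" "HOL-Library.Function_Algebras"
begin

section \<open>Pointwise vector space structure on functions\<close>

text \<open>Tangent vectors and vector fields below are functions; they are added and scaled pointwise.\<close>

instantiation "fun" :: (type, real_vector) real_vector
begin

definition scaleR_fun :: "real \<Rightarrow> ('a \<Rightarrow> 'b) \<Rightarrow> 'a \<Rightarrow> 'b"
  where "scaleR_fun r f = (\<lambda>x. r *\<^sub>R f x)"

instance
  by standard (simp_all add: scaleR_fun_def fun_eq_iff scaleR_add_right scaleR_add_left)

end


section \<open>Smooth manifolds\<close>

text \<open>\<open>C\<^sup>k\<close> and \<open>C\<^sup>\<infinity>\<close> maps on an open subset of a Euclidean space, via directional derivatives.\<close>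

primrec Ck_on :: "nat \<Rightarrow> 'e::euclidean_space set \<Rightarrow> ('e \<Rightarrow> 'b::real_normed_vector) \<Rightarrow> bool" where
  "Ck_on 0 S f \<longleftrightarrow> continuous_on S f"
| "Ck_on (Suc k) S f \<longleftrightarrow>
     (\<forall>x\<in>S. f differentiable (at x)) \<and> (\<forall>v. Ck_on k S (\<lambda>x. frechet_derivative f (at x) v))"

definition smooth_on :: "'e::euclidean_space set \<Rightarrow> ('e \<Rightarrow> 'b::real_normed_vector) \<Rightarrow> bool"
  where "smooth_on S f \<longleftrightarrow> (\<forall>k. Ck_on k S f)"

text \<open>A chart is a pair of its domain and its coordinate map; the values of the coordinate map
  outside the domain are irrelevant. The dimension of the manifold is \<open>DIM('e)\<close>.\<close>

type_synonym ('a, 'e) chart = "'a set \<times> ('a \<Rightarrow> 'e)"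

definition chart_inv :: "('a, 'e) chart \<Rightarrow> 'e \<Rightarrow> 'a"
  where "chart_inv c = inv_into (fst c) (snd c)"

definition transition :: "('a, 'e) chart \<Rightarrow> ('a, 'e) chart \<Rightarrow> 'e \<Rightarrow> 'e"
  where "transition c d = snd d \<circ> chart_inv c"

definition atlas_carrier :: "('a, 'e) chart set \<Rightarrow> 'a set"
  where "atlas_carrier A = (\<Union>c\<in>A. fst c)"

text \<open>The topology for which all charts are homeomorphisms onto open sets.\<close>

definition atlas_topology :: "('a, 'e::euclidean_space) chart set \<Rightarrow> 'a topology"
  where "atlas_topology A =
    topology (\<lambda>S. S \<subseteq> atlas_carrier A \<and> (\<forall>c\<in>A. open (snd c ` (fst c \<inter> S))))"

lemma openin_atlas_topology:
  fixes A :: "('a, 'e::euclidean_space) chart set"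
  assumes "\<And>c. c \<in> A \<Longrightarrow> inj_on (snd c) (fst c)"
  shows "openin (atlas_topology A) S \<longleftrightarrow>
    S \<subseteq> atlas_carrier A \<and> (\<forall>c\<in>A. open (snd c ` (fst c \<inter> S)))"
proof -
  let ?P = "\<lambda>S. S \<subseteq> atlas_carrier A \<and> (\<forall>c\<in>A. open (snd c ` (fst c \<inter> S)))"
  have "?P (S \<inter> T)" if "?P S" "?P T" for S T
  proof -
    have "snd c ` (fst c \<inter> (S \<inter> T)) = snd c ` (fst c \<inter> S) \<inter> snd c ` (fst c \<inter> T)" if "c \<in> A" for c
      using assms[OF that] by (auto simp: inj_on_def)
    then show ?thesis using that by auto
  qed
  moreover have "?P (\<Union>\<K>)" if "\<forall>K\<in>\<K>. ?P K" for \<K>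
  proof -
    have "snd c ` (fst c \<inter> \<Union>\<K>) = (\<Union>K\<in>\<K>. snd c ` (fst c \<inter> K))" for c :: "('a, 'e) chart"
      by auto
    moreover have "open (\<Union>K\<in>\<K>. snd c ` (fst c \<inter> K))" if "c \<in> A" for c
      using \<open>\<forall>K\<in>\<K>. ?P K\<close> that by (intro open_UN) blast
    ultimately show ?thesis using that by (simp add: Sup_le_iff)
  qed
  ultimately have "istopology ?P"
    unfolding istopology_def by blast
  then show ?thesis
    by (simp add: atlas_topology_def topology_inverse')
qed

definition smooth_manifold :: "('a, 'e::euclidean_space) chart set \<Rightarrow> bool"
  where "smooth_manifold A \<longleftrightarrow>
    (\<forall>c\<in>A. inj_on (snd c) (fst c) \<and> open (snd c ` fst c)) \<and>
    (\<forall>c\<in>A. \<forall>d\<in>A. open (snd c ` (fst c \<inter> fst d)) \<and>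
       smooth_on (snd c ` (fst c \<inter> fst d)) (transition c d)) \<and>
    Hausdorff_space (atlas_topology A) \<and> second_countable (atlas_topology A)"


section \<open>Tangent vectors and vector fields\<close>

text \<open>A tangent vector at \<open>p\<close> is the family of its components in all charts around \<open>p\<close>, which
  transforms by the Jacobians of the transition maps. Components for charts not containing \<open>p\<close>
  are set to \<open>0\<close>, so that equality of tangent vectors is equality of functions.\<close>

type_synonym ('a, 'e) tvec = "('a, 'e) chart \<Rightarrow> 'e"

definition tangent_space :: "('a, 'e::euclidean_space) chart set \<Rightarrow> 'a \<Rightarrow> ('a, 'e) tvec set"
  where "tangent_space A p = {v.
    (\<forall>c\<in>A. \<forall>d\<in>A. p \<in> fst c \<inter> fst d \<longrightarrow>
       v d = frechet_derivative (transition c d) (at (snd c p)) (v c)) \<and>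
    (\<forall>c. \<not> (c \<in> A \<and> p \<in> fst c) \<longrightarrow> v c = 0)}"

text \<open>The tangent vector at \<open>p\<close> with components \<open>u\<close> in the chart \<open>c\<close>.\<close>

definition coord_vector ::
    "('a, 'e::euclidean_space) chart set \<Rightarrow> ('a, 'e) chart \<Rightarrow> 'a \<Rightarrow> 'e \<Rightarrow> ('a, 'e) tvec"
  where "coord_vector A c p u = (\<lambda>d.
    if d \<in> A \<and> p \<in> fst d then frechet_derivative (transition c d) (at (snd c p)) u else 0)"

text \<open>The differential of a map at \<open>p\<close>. The choice of the chart \<open>c\<close> around \<open>p\<close> is immaterial for
  smooth maps, by the chain rule.\<close>

definition pushforward ::
    "('a, 'e::euclidean_space) chart set \<Rightarrow> ('b, 'f::euclidean_space) chart set \<Rightarrow> ('a \<Rightarrow> 'b) \<Rightarrow>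
     'a \<Rightarrow> ('a, 'e) tvec \<Rightarrow> ('b, 'f) tvec"
  where "pushforward A B f p v =
    (let c = (SOME c. c \<in> A \<and> p \<in> fst c) in
     (\<lambda>d. if d \<in> B \<and> f p \<in> fst d
         then frechet_derivative (snd d \<circ> f \<circ> chart_inv c) (at (snd c p)) (v c) else 0))"

type_synonym ('a, 'e) vfield = "'a \<Rightarrow> ('a, 'e) tvec"

text \<open>Local vector fields on an open set \<open>V\<close>; their values outside \<open>V\<close> are irrelevant.\<close>

definition smooth_vector_field ::
    "('a, 'e::euclidean_space) chart set \<Rightarrow> 'a set \<Rightarrow> ('a, 'e) vfield \<Rightarrow> bool"
  where "smooth_vector_field A V X \<longleftrightarrow>
    (\<forall>p\<in>V. X p \<in> tangent_space A p) \<and>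
    (\<forall>c\<in>A. smooth_on (snd c ` (fst c \<inter> V)) (\<lambda>x. X (chart_inv c x) c))"

definition lie_bracket ::
    "('a, 'e::euclidean_space) chart set \<Rightarrow> ('a, 'e) vfield \<Rightarrow> ('a, 'e) vfield \<Rightarrow> ('a, 'e) vfield"
  where "lie_bracket A X Y = (\<lambda>p c. if c \<in> A \<and> p \<in> fst c
    then frechet_derivative (\<lambda>x. Y (chart_inv c x) c) (at (snd c p)) (X p c)
       - frechet_derivative (\<lambda>x. X (chart_inv c x) c) (at (snd c p)) (Y p c)
    else 0)"


section \<open>Riemannian metrics and the Levi-Civita connection\<close>

type_synonym ('a, 'e) metric = "'a \<Rightarrow> ('a, 'e) tvec \<Rightarrow> ('a, 'e) tvec \<Rightarrow> real"

definition metric_coord ::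
    "('a, 'e::euclidean_space) chart set \<Rightarrow> ('a, 'e) metric \<Rightarrow> ('a, 'e) chart \<Rightarrow> 'e \<Rightarrow> 'e \<Rightarrow> 'e \<Rightarrow> real"
  where "metric_coord A g c x u v =
    g (chart_inv c x) (coord_vector A c (chart_inv c x) u) (coord_vector A c (chart_inv c x) v)"

definition riemannian_metric :: "('a, 'e::euclidean_space) chart set \<Rightarrow> ('a, 'e) metric \<Rightarrow> bool"
  where "riemannian_metric A g \<longleftrightarrow>
    (\<forall>p\<in>atlas_carrier A.
      (\<forall>u\<in>tangent_space A p. \<forall>v\<in>tangent_space A p. g p u v = g p v u) \<and>
      (\<forall>u\<in>tangent_space A p. \<forall>v\<in>tangent_space A p. \<forall>w\<in>tangent_space A p.
         g p (u + v) w = g p u w + g p v w) \<and>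
      (\<forall>r. \<forall>u\<in>tangent_space A p. \<forall>v\<in>tangent_space A p. g p (r *\<^sub>R u) v = r * g p u v) \<and>
      (\<forall>u\<in>tangent_space A p. u \<noteq> 0 \<longrightarrow> g p u u > 0)) \<and>
    (\<forall>c\<in>A. \<forall>u v. smooth_on (snd c ` fst c) (\<lambda>x. metric_coord A g c x u v))"

text \<open>The Christoffel symbols of the Levi-Civita connection in a chart, as a bilinear map
  \<open>\<Gamma>(u, v) = (\<Gamma>\<^sup>k\<^sub>i\<^sub>j u\<^sup>i v\<^sup>j)\<^sub>k\<close>:
  \<open>2 g(\<Gamma>(u, v), z) = \<partial>\<^sub>u g(v, z) + \<partial>\<^sub>v g(u, z) - \<partial>\<^sub>z g(u, v)\<close> for constant \<open>u, v, z\<close>.\<close>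

definition christoffel ::
    "('a, 'e::euclidean_space) chart set \<Rightarrow> ('a, 'e) metric \<Rightarrow> ('a, 'e) chart \<Rightarrow> 'e \<Rightarrow> 'e \<Rightarrow> 'e \<Rightarrow> 'e"
  where "christoffel A g c x u v = (THE w. \<forall>z.
    2 * metric_coord A g c x w z =
      frechet_derivative (\<lambda>y. metric_coord A g c y v z) (at x) u
    + frechet_derivative (\<lambda>y. metric_coord A g c y u z) (at x) v
    - frechet_derivative (\<lambda>y. metric_coord A g c y u v) (at x) z)"

text \<open>The covariant derivative \<open>\<nabla>\<^sub>X Y\<close>.\<close>

definition nabla ::
    "('a, 'e::euclidean_space) chart set \<Rightarrow> ('a, 'e) metric \<Rightarrow>
     ('a, 'e) vfield \<Rightarrow> ('a, 'e) vfield \<Rightarrow> ('a, 'e) vfield"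
  where "nabla A g X Y = (\<lambda>p c. if c \<in> A \<and> p \<in> fst c
    then frechet_derivative (\<lambda>x. Y (chart_inv c x) c) (at (snd c p)) (X p c)
       + christoffel A g c (snd c p) (X p c) (Y p c)
    else 0)"

definition curvature ::
    "('a, 'e::euclidean_space) chart set \<Rightarrow> ('a, 'e) metric \<Rightarrow>
     ('a, 'e) vfield \<Rightarrow> ('a, 'e) vfield \<Rightarrow> ('a, 'e) vfield \<Rightarrow> ('a, 'e) vfield"
  where "curvature A g X Y Z =
    nabla A g X (nabla A g Y Z) - nabla A g Y (nabla A g X Z) - nabla A g (lie_bracket A X Y) Z"


section \<open>Submanifolds\<close>

text \<open>The charts, modelled on \<open>'k\<close>, of a subset \<open>N\<close> of a manifold: diffeomorphisms from relatively
  open subsets of \<open>N\<close> onto open subsets of \<open>'k\<close>. Smoothness of a map on a subset of a manifold means,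
  as usual, that it locally extends to a smooth map on an open set. If these charts
  cover \<open>N\<close>, then \<open>N\<close> is an embedded submanifold of dimension \<open>DIM('k)\<close> and they form its
  (maximal) atlas.\<close>

definition submanifold_atlas ::
    "('b, 'f::euclidean_space) chart set \<Rightarrow> 'b set \<Rightarrow> ('b, 'k::euclidean_space) chart set"
  where "submanifold_atlas B N = {(W, \<psi>).
    openin (subtopology (atlas_topology B) N) W \<and> inj_on \<psi> W \<and> open (\<psi> ` W) \<and>
    (\<forall>d\<in>B. open (\<psi> ` (W \<inter> fst d)) \<and>
       smooth_on (\<psi> ` (W \<inter> fst d)) (snd d \<circ> chart_inv (W, \<psi>))) \<and>
    (\<forall>d\<in>B. \<forall>p\<in>W \<inter> fst d. \<exists>S h. open S \<and> snd d p \<in> S \<and> smooth_on S h \<and>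
       (\<forall>q\<in>W \<inter> fst d. snd d q \<in> S \<longrightarrow> h (snd d q) = \<psi> q))}"

definition embedded_submanifold ::
    "'k::euclidean_space itself \<Rightarrow> ('b, 'f::euclidean_space) chart set \<Rightarrow> 'b set \<Rightarrow> bool"
  where "embedded_submanifold K B N \<longleftrightarrow>
    N \<subseteq> atlas_carrier B \<and> atlas_carrier (submanifold_atlas B N :: ('b, 'k) chart set) = N"

text \<open>The tangent space of \<open>N\<close> at \<open>p\<close>, as a subspace of the tangent space of the ambient manifold.\<close>

definition submanifold_tangent ::
    "'k::euclidean_space itself \<Rightarrow> ('b, 'f::euclidean_space) chart set \<Rightarrow> 'b set \<Rightarrow> 'b \<Rightarrow> ('b, 'f) tvec set"
  where "submanifold_tangent K B N p =
    (let C = (submanifold_atlas B N :: ('b, 'k) chart set)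
     in pushforward C B (\<lambda>q. q) p ` tangent_space C p)"

definition induced_metric ::
    "('b, 'f::euclidean_space) chart set \<Rightarrow> ('b, 'f) metric \<Rightarrow>
     ('b, 'k::euclidean_space) chart set \<Rightarrow> ('b, 'k) metric"
  where "induced_metric B G C =
    (\<lambda>q u v. G q (pushforward C B (\<lambda>q. q) q u) (pushforward C B (\<lambda>q. q) q v))"

text \<open>A submanifold is totally geodesic if its second fundamental form vanishes, that is, if
  \<open>\<nabla>\<^sub>X Y\<close> is tangent to \<open>N\<close> along \<open>N\<close> for all local vector fields \<open>X, Y\<close> of the ambient manifold
  (with Levi-Civita connection \<open>\<nabla>\<close>) that are tangent to \<open>N\<close> along \<open>N\<close>.\<close>

definition totally_geodesic_submanifold ::
    "'k::euclidean_space itself \<Rightarrow> ('b, 'f::euclidean_space) chart set \<Rightarrow> ('b, 'f) metric \<Rightarrow> 'b set \<Rightarrow> bool"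
  where "totally_geodesic_submanifold K B h N \<longleftrightarrow>
    embedded_submanifold K B N \<and>
    (\<forall>S X Y. openin (atlas_topology B) S \<and>
        smooth_vector_field B S X \<and> smooth_vector_field B S Y \<and>
        (\<forall>p\<in>N \<inter> S. X p \<in> submanifold_tangent K B N p \<and> Y p \<in> submanifold_tangent K B N p) \<longrightarrow>
      (\<forall>p\<in>N \<inter> S. nabla B h X Y p \<in> submanifold_tangent K B N p))"


section \<open>The tangent bundle and the Sasaki metric\<close>

definition tangent_chart ::
    "('a, 'e::euclidean_space) chart set \<Rightarrow> ('a, 'e) chart \<Rightarrow> ('a \<times> ('a, 'e) tvec, 'e \<times> 'e) chart"
  where "tangent_chart A c =
    ({(p, v). p \<in> fst c \<and> v \<in> tangent_space A p}, \<lambda>(p, v). (snd c p, v c))"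

definition tangent_atlas ::
    "('a, 'e::euclidean_space) chart set \<Rightarrow> ('a \<times> ('a, 'e) tvec, 'e \<times> 'e) chart set"
  where "tangent_atlas A = tangent_chart A ` A"

text \<open>In the chart induced by \<open>c\<close>, the lifts of \<open>X\<close> to \<open>(q, \<xi>)\<close> have components
  \<open>X\<^sup>h = (X, - \<Gamma>(X, \<xi>))\<close> and \<open>X\<^sup>v = (0, X)\<close>. The map \<open>tangent_chart A\<close> is injective on the charts of
  a manifold, so a chart of the tangent bundle determines the chart \<open>c\<close> it is induced by.\<close>

lemma inj_on_tangent_chart:
  assumes "smooth_manifold A"
  shows "inj_on (tangent_chart A) A"
proof (rule inj_onI)
  fix c d assume cd: "c \<in> A" "d \<in> A" and eq: "tangent_chart A c = tangent_chart A d"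
  have zero: "0 \<in> tangent_space A p" for p
  proof -
    have "frechet_derivative (transition c d) (at (snd c p)) 0 = 0"
      if "c \<in> A" "d \<in> A" "p \<in> fst c \<inter> fst d" for c d
    proof -
      have "smooth_on (snd c ` (fst c \<inter> fst d)) (transition c d)"
        using assms that unfolding smooth_manifold_def by blast
      then have "Ck_on (Suc 0) (snd c ` (fst c \<inter> fst d)) (transition c d)"
        unfolding smooth_on_def by blast
      then have "transition c d differentiable (at (snd c p))"
        using that by auto
      then show ?thesis
        using linear_0[OF linear_frechet_derivative] by blast
    qed
    then show ?thesis by (simp add: tangent_space_def)
  qed
  have dom: "fst c = fst ` fst (tangent_chart A c)" for c
    using zero by (force simp: tangent_chart_def)
  have map: "snd c = (\<lambda>p. fst (snd (tangent_chart A c) (p, 0)))" for c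
    by (simp add: tangent_chart_def)
  show "c = d"
    using dom[of c] dom[of d] map[of c] map[of d] eq by (metis prod.expand)
qed

definition horizontal_lift ::
    "('a, 'e::euclidean_space) chart set \<Rightarrow> ('a, 'e) metric \<Rightarrow> 'a \<times> ('a, 'e) tvec \<Rightarrow>
     ('a, 'e) tvec \<Rightarrow> ('a \<times> ('a, 'e) tvec, 'e \<times> 'e) tvec"
  where "horizontal_lift A g Q X = (\<lambda>C. if C \<in> tangent_atlas A \<and> Q \<in> fst C
    then let c = the_inv_into A (tangent_chart A) C
         in (X c, - christoffel A g c (snd c (fst Q)) (X c) (snd Q c))
    else 0)"

definition vertical_lift ::
    "('a, 'e::euclidean_space) chart set \<Rightarrow> 'a \<times> ('a, 'e) tvec \<Rightarrow>
     ('a, 'e) tvec \<Rightarrow> ('a \<times> ('a, 'e) tvec, 'e \<times> 'e) tvec"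
  where "vertical_lift A Q X = (\<lambda>C. if C \<in> tangent_atlas A \<and> Q \<in> fst C
    then let c = the_inv_into A (tangent_chart A) C in (0, X c)
    else 0)"

text \<open>Since \<open>T\<^sub>Q TM\<close> is the direct sum of the horizontal and the vertical lifts, these conditions
  determine \<open>G\<close> on tangent vectors.\<close>

definition sasaki_metric ::
    "('a, 'e::euclidean_space) chart set \<Rightarrow> ('a, 'e) metric \<Rightarrow>
     ('a \<times> ('a, 'e) tvec, 'e \<times> 'e) metric \<Rightarrow> bool"
  where "sasaki_metric A g G \<longleftrightarrow>
    riemannian_metric (tangent_atlas A) G \<and>
    (\<forall>Q\<in>atlas_carrier (tangent_atlas A).
      \<forall>X\<in>tangent_space A (fst Q). \<forall>Y\<in>tangent_space A (fst Q).
        G Q (horizontal_lift A g Q X) (horizontal_lift A g Q Y) = g (fst Q) X Y \<and>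
        G Q (horizontal_lift A g Q X) (vertical_lift A Q Y) = 0 \<and>
        G Q (vertical_lift A Q X) (vertical_lift A Q Y) = g (fst Q) X Y)"

definition unit_tangent_bundle ::
    "('a, 'e::euclidean_space) chart set \<Rightarrow> ('a, 'e) metric \<Rightarrow> ('a \<times> ('a, 'e) tvec) set"
  where "unit_tangent_bundle A g = {(p, v). p \<in> atlas_carrier A \<and> v \<in> tangent_space A p \<and> g p v v = 1}"

text \<open>The model space \<open>'f\<close> of the unit tangent bundle has to satisfy \<open>DIM('f) = 2 * DIM('e) - 1\<close>.\<close>

definition unit_tangent_atlas ::
    "('a, 'e::euclidean_space) chart set \<Rightarrow> ('a, 'e) metric \<Rightarrow>
     ('a \<times> ('a, 'e) tvec, 'f::euclidean_space) chart set"
  where "unit_tangent_atlas A g = submanifold_atlas (tangent_atlas A) (unit_tangent_bundle A g)"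


section \<open>Unit vector fields\<close>

definition unit_vector_field ::
    "('a, 'e::euclidean_space) chart set \<Rightarrow> ('a, 'e) metric \<Rightarrow> 'a set \<Rightarrow> ('a, 'e) vfield \<Rightarrow> bool"
  where "unit_vector_field A g V \<xi> \<longleftrightarrow>
    smooth_vector_field A V \<xi> \<and> (\<forall>p\<in>V. g p (\<xi> p) (\<xi> p) = 1)"

definition A_op ::
    "('a, 'e::euclidean_space) chart set \<Rightarrow> ('a, 'e) metric \<Rightarrow> ('a, 'e) vfield \<Rightarrow>
     ('a, 'e) vfield \<Rightarrow> ('a, 'e) vfield"
  where "A_op A g \<xi> X = - nabla A g X \<xi>"

text \<open>\<open>nabla_A_op A g \<xi> X Y\<close> is \<open>(\<nabla>\<^sub>X A\<^sub>\<xi>) Y\<close>.\<close>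

definition nabla_A_op ::
    "('a, 'e::euclidean_space) chart set \<Rightarrow> ('a, 'e) metric \<Rightarrow> ('a, 'e) vfield \<Rightarrow>
     ('a, 'e) vfield \<Rightarrow> ('a, 'e) vfield \<Rightarrow> ('a, 'e) vfield"
  where "nabla_A_op A g \<xi> X Y =
    - (nabla A g X (nabla A g Y \<xi>) - nabla A g (nabla A g X Y) \<xi>)"

definition Hess ::
    "('a, 'e::euclidean_space) chart set \<Rightarrow> ('a, 'e) metric \<Rightarrow> ('a, 'e) vfield \<Rightarrow>
     ('a, 'e) vfield \<Rightarrow> ('a, 'e) vfield \<Rightarrow> ('a, 'e) vfield"
  where "Hess A g \<xi> X Y = (1/2) *\<^sub>R (nabla_A_op A g \<xi> Y X + nabla_A_op A g \<xi> X Y)"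

definition Hm ::
    "('a, 'e::euclidean_space) chart set \<Rightarrow> ('a, 'e) metric \<Rightarrow> ('a, 'e) vfield \<Rightarrow>
     ('a, 'e) vfield \<Rightarrow> ('a, 'e) vfield \<Rightarrow> ('a, 'e) vfield"
  where "Hm A g \<xi> X Y =
    (1/2) *\<^sub>R (curvature A g \<xi> (A_op A g \<xi> X) Y + curvature A g \<xi> (A_op A g \<xi> Y) X)"

end

theory Submission
  imports Defs
begin

text \<open>In the chart of \<open>TM\<close> induced by a chart of \<open>M\<close> let \<open>K(a, b) = b + \<Gamma>(a, u)\<close> be the vertical part of the
  vector \<open>(a, b)\<close> at \<open>(x, u)\<close>. The Sasaki metric is \<open>g(a, a') + g(K w, K w')\<close> for \<open>w = (a, b)\<close> and
  \<open>w' = (a', b')\<close>, and the Koszul formula together with the pair symmetry of the curvature gives its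
  connection. Differentiating the coordinate fields of the section \<open>x \<mapsto> (x, \<xi>(x))\<close> in \<open>TM\<close>, one finds a vector with
  horizontal part \<open>\<nabla>\<^sub>X Y - Hm\<^sub>\<xi>(X, Y)\<close> and vertical part
  \<open>(\<nabla>\<^sub>X \<nabla>\<^sub>Y \<xi> + \<nabla>\<^sub>Y \<nabla>\<^sub>X \<xi>) / 2\<close>. By the Gauss formula the derivative in \<open>T\<^sub>1M\<close> is the projection
  of this vector along the unit normal \<open>\<xi>\<^sup>v\<close>; since the vectors \<open>Z\<^sup>h + (\<nabla>\<^sub>Z \<xi>)\<^sup>v\<close> are the tangent
  vectors of \<open>\<xi>(M)\<close>, it is tangent to \<open>\<xi>(M)\<close> if and only if \<open>Hess\<^sub>\<xi>(X, Y) + A\<^sub>\<xi> Hm\<^sub>\<xi>(X, Y)\<close> is a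
  multiple of \<open>\<xi>\<close>. Pairing with \<open>\<xi>\<close> and differentiating \<open>g(\<nabla>\<^sub>Y \<xi>, \<xi>) = 0\<close> identifies the factor as
  \<open>g(A\<^sub>\<xi> X, A\<^sub>\<xi> Y)\<close>.\<close>

section \<open>Calculus of smooth maps\<close>

text \<open>Both sides of the equivalence quantify over fields, but over different ones: local
  fields on M, and local fields of the unit tangent bundle tangent to the image. Both reduce to one
  pointwise statement, the vanishing of \<open>tg_defect\<close> on all pairs of coordinate vectors.
  On M this is tensoriality. On the unit tangent bundle, derivatives of the components of Y
  contribute only vectors tangent to the image; conversely, smooth fields attaining every pair of
  coordinate vectors have to be constructed (\<open>ext_field\<close>).

  The obstacle is that the unit tangent bundle is only a subset of TM whose atlas consists of all
  admissible charts. They have no formula, and that they cover the bundle needs proof. Hence its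
  connection is never computed in such a chart: the inclusion into a chart of TM is an immersion
  pulling back the Sasaki metric, so the products of the image of the derivative with all tangent
  vectors are known, the tangent space is the orthogonal complement of the normal, and this
  identifies the vector.\<close>

abbreviation der :: "('a::real_normed_vector \<Rightarrow> 'b::real_normed_vector) \<Rightarrow> 'a \<Rightarrow> 'a \<Rightarrow> 'b"
  where "der f x \<equiv> frechet_derivative f (at x)"

lemma der_eqI: "(f has_derivative f') (at x) \<Longrightarrow> der f x = f'"
  using frechet_derivative_at by metis

text \<open>\<open>frechet_derivative\<close> is a choice among the derivatives at \<open>x\<close>,
  and maps that agree near \<open>x\<close> have the same ones. So the chosen maps agree even at
  points where no derivative exists.\<close>

lemma der_cong:
  assumes "open S" "x \<in> S" "\<And>y. y \<in> S \<Longrightarrow> f y = g y"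
  shows "der f x = der g x"
proof -
  have "(f has_derivative f') (at x) \<longleftrightarrow> (g has_derivative f') (at x)" for f'
    using assms has_derivative_transform_within_open[of f f' x UNIV S g]
      has_derivative_transform_within_open[of g f' x UNIV S f] by auto
  then show ?thesis unfolding frechet_derivative_def by simp
qed

lemma differentiable_cong_open:
  assumes "open S" "x \<in> S" "\<And>y. y \<in> S \<Longrightarrow> f y = g y"
  shows "f differentiable at x \<longleftrightarrow> g differentiable at x"
  unfolding differentiable_def
  using assms has_derivative_transform_within_open[of f _ x UNIV S g]
      has_derivative_transform_within_open[of g _ x UNIV S f] by (metis (no_types))

lemma der_linear_combination:
  assumes "f differentiable at x"
  shows "der f x v = (\<Sum>b\<in>Basis. (v \<bullet> b) *\<^sub>R der f x (b::'a::euclidean_space))"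
proof -
  have "der f x v = der f x (\<Sum>b\<in>Basis. (v \<bullet> b) *\<^sub>R b)" by (simp add: euclidean_representation)
  also have "\<dots> = (\<Sum>b\<in>Basis. (v \<bullet> b) *\<^sub>R der f x b)"
    using linear_frechet_derivative[OF assms] by (simp add: linear_sum linear_scale)
  finally show ?thesis .
qed

lemma der_compose:
  assumes "g differentiable at x" "f differentiable at (g x)"
  shows "der (\<lambda>x. f (g x)) x v = der f (g x) (der g x v)"
  using frechet_derivative_compose[OF assms] by (simp add: o_def fun_eq_iff)

lemma der_bounded_linear:
  assumes "bounded_linear L" "f differentiable at x"
  shows "der (\<lambda>x. L (f x)) x v = L (der f x v)"
  using der_eqI[OF bounded_linear.has_derivative[OF assms(1)
    assms(2)[unfolded frechet_derivative_works]]] by simp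

lemma der_add:
  assumes "f differentiable at x" "g differentiable at x"
  shows "der (\<lambda>x. f x + g x) x v = der f x v + der g x v"
  using der_eqI[OF has_derivative_add[OF assms[unfolded frechet_derivative_works]]] by simp

lemma der_minus:
  assumes "f differentiable at x"
  shows "der (\<lambda>x. - f x) x v = - der f x v"
  using der_eqI[OF has_derivative_minus[OF assms[unfolded frechet_derivative_works]]] by simp

lemma der_sum:
  assumes "\<And>i. i \<in> I \<Longrightarrow> f i differentiable at x"
  shows "der (\<lambda>x. \<Sum>i\<in>I. f i x) x v = (\<Sum>i\<in>I. der (f i) x v)"
  using der_eqI[OF has_derivative_sum[of I f "\<lambda>i. der (f i) x"]] assms
  by (simp add: frechet_derivative_works)

lemma der_bilinear:
  assumes "bounded_bilinear pr" "f differentiable at x" "g differentiable at x"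
  shows "der (\<lambda>x. pr (f x) (g x)) x v = pr (f x) (der g x v) + pr (der f x v) (g x)"
  using der_eqI[OF bounded_bilinear.FDERIV[OF assms(1) assms(2,3)[unfolded frechet_derivative_works]]]
  by simp

lemma der_Pair:
  assumes "f differentiable at x" "g differentiable at x"
  shows "der (\<lambda>x. (f x, g x)) x v = (der f x v, der g x v)"
  using der_eqI[OF has_derivative_Pair[OF assms[unfolded frechet_derivative_works]]] by simp

section \<open>Closure properties of C^k maps\<close>

lemma Ck_on_subset: "Ck_on k S f \<Longrightarrow> T \<subseteq> S \<Longrightarrow> Ck_on k T f"
  by (induction k arbitrary: f) (auto intro: continuous_on_subset)

lemma Ck_on_cong:
  assumes "open S" "\<And>y. y \<in> S \<Longrightarrow> f y = g y"
  shows "Ck_on k S f \<longleftrightarrow> Ck_on k S g"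
  using assms(2)
proof (induction k arbitrary: f g)
  case 0 then show ?case by (auto cong: continuous_on_cong)
next
  case (Suc k)
  have "Ck_on k S (\<lambda>x. der f x v) \<longleftrightarrow> Ck_on k S (\<lambda>x. der g x v)" for v
    by (rule Suc.IH) (use der_cong[OF assms(1)] Suc.prems in metis)
  moreover have "f differentiable at x \<longleftrightarrow> g differentiable at x" if "x \<in> S" for x
    by (rule differentiable_cong_open[OF assms(1) that Suc.prems])
  ultimately show ?case by auto
qed

lemma Ck_on_Suc_imp: "Ck_on (Suc k) S f \<Longrightarrow> Ck_on k S f"
proof (induction k arbitrary: f)
  case 0
  then show ?case
    by (auto intro!: continuous_at_imp_continuous_on differentiable_imp_continuous_within)
next
  case (Suc k)
  then show ?case by (metis Ck_on.simps(2))
qed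

lemma Ck_on_local:
  assumes "\<And>x. x \<in> S \<Longrightarrow> \<exists>T. open T \<and> x \<in> T \<and> Ck_on k T f"
  shows "Ck_on k S f"
  using assms
proof (induction k arbitrary: f)
  case 0
  have "continuous (at x) f" if "x \<in> S" for x
    using 0[OF that] by (auto simp: continuous_on_eq_continuous_at)
  then show ?case by (simp add: continuous_at_imp_continuous_on)
next
  case (Suc k)
  have "Ck_on k S (\<lambda>x. der f x v)" for v
    by (rule Suc.IH) (use Suc.prems in force)
  then show ?case using Suc.prems by auto
qed

lemma Ck_on_const: "Ck_on k S (\<lambda>x. c)"
  by (induction k arbitrary: c) auto

lemma Ck_on_bounded_linear:
  assumes "bounded_linear L" "open S" "Ck_on k S f"
  shows "Ck_on k S (\<lambda>x. L (f x))"
  using assms(3)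
proof (induction k arbitrary: f)
  case 0
  then show ?case using assms(1) by (auto intro: bounded_linear.continuous_on)
next
  case (Suc k)
  have d: "f differentiable at x" if "x \<in> S" for x using Suc that by auto
  have "(\<lambda>x. L (f x)) differentiable at x" if "x \<in> S" for x
    using bounded_linear.has_derivative[OF assms(1) d[OF that, unfolded frechet_derivative_works]]
    by (auto simp: differentiable_def)
  moreover have "Ck_on k S (\<lambda>x. der (\<lambda>x. L (f x)) x v)" for v
    using Suc.IH[of "\<lambda>x. der f x v"] Suc.prems
    by (subst Ck_on_cong[OF assms(2)]) (auto simp: der_bounded_linear[OF assms(1) d])
  ultimately show ?case by auto
qed

lemma Ck_on_add:
  assumes "open S" "Ck_on k S f" "Ck_on k S g"
  shows "Ck_on k S (\<lambda>x. f x + g x)"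
  using assms(2,3)
proof (induction k arbitrary: f g)
  case 0 then show ?case by (auto intro: continuous_on_add)
next
  case (Suc k)
  have d: "f differentiable at x" "g differentiable at x" if "x \<in> S" for x using Suc that by auto
  have "Ck_on k S (\<lambda>x. der (\<lambda>x. f x + g x) x v)" for v
    using Suc.IH[of "\<lambda>x. der f x v" "\<lambda>x. der g x v"] Suc.prems
    by (subst Ck_on_cong[OF assms(1)]) (auto simp: der_add[OF d])
  then show ?case using d by auto
qed

lemma Ck_on_sum:
  assumes "open S" "\<And>i. i \<in> I \<Longrightarrow> Ck_on k S (f i)"
  shows "Ck_on k S (\<lambda>x. \<Sum>i\<in>I. f i x)"
  using assms(2) by (induction I rule: infinite_finite_induct) (auto intro!: Ck_on_add assms(1) Ck_on_const)

lemma Ck_on_bilinear: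
  assumes "bounded_bilinear pr" "open S" "Ck_on k S f" "Ck_on k S g"
  shows "Ck_on k S (\<lambda>x. pr (f x) (g x))"
  using assms(3,4)
proof (induction k arbitrary: f g)
  case 0 then show ?case using bounded_bilinear.continuous_on[OF assms(1)] by auto
next
  case (Suc k)
  have d: "f differentiable at x" "g differentiable at x" if "x \<in> S" for x using Suc that by auto
  have "(\<lambda>x. pr (f x) (g x)) differentiable at x" if "x \<in> S" for x
    using bounded_bilinear.FDERIV[OF assms(1) d[OF that, unfolded frechet_derivative_works]]
    by (auto simp: differentiable_def)
  moreover have "Ck_on k S (\<lambda>x. der (\<lambda>x. pr (f x) (g x)) x v)" for v
  proof (subst Ck_on_cong[OF assms(2)])
    show "der (\<lambda>x. pr (f x) (g x)) x v = pr (f x) (der g x v) + pr (der f x v) (g x)" if "x \<in> S" for x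
      by (rule der_bilinear[OF assms(1) d[OF that]])
    show "Ck_on k S (\<lambda>x. pr (f x) (der g x v) + pr (der f x v) (g x))"
      by (intro Ck_on_add assms(2) Suc.IH Ck_on_Suc_imp[OF Suc.prems(1)] Ck_on_Suc_imp[OF Suc.prems(2)])
        (use Suc.prems in simp_all)
  qed
  ultimately show ?case by auto
qed

lemma Ck_on_compose:
  fixes f :: "'b::euclidean_space \<Rightarrow> 'c::real_normed_vector"
  assumes "open S" "Ck_on k T f" "Ck_on k S g" "g ` S \<subseteq> T"
  shows "Ck_on k S (\<lambda>x. f (g x))"
  using assms(2,3)
proof (induction k arbitrary: f)
  case 0 then show ?case using continuous_on_compose2[of T f S g] assms(4) by simp
next
  case (Suc k)
  have d: "g differentiable at x" "f differentiable at (g x)" if "x \<in> S" for x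
    using Suc.prems that assms(4) by auto
  have "(\<lambda>x. f (g x)) differentiable at x" if "x \<in> S" for x
    using d[OF that] differentiable_chain_at[of g x f] by (simp add: o_def)
  moreover have "Ck_on k S (\<lambda>x. der (\<lambda>x. f (g x)) x v)" for v
  proof (subst Ck_on_cong[OF assms(1)])
    \<comment> \<open>The direction \<open>der g x v\<close> moves with \<open>x\<close>, while the
      induction hypothesis concerns derivatives of \<open>f\<close> in a fixed direction. Expanding
      the direction in the basis separates the two.\<close>
    show "der (\<lambda>x. f (g x)) x v = (\<Sum>b\<in>Basis. (der g x v \<bullet> b) *\<^sub>R der f (g x) b)" if "x \<in> S" for x
      by (rule trans[OF der_compose[OF d[OF that]] der_linear_combination[OF d(2)[OF that]]])
    show "Ck_on k S (\<lambda>x. \<Sum>b\<in>Basis. (der g x v \<bullet> b) *\<^sub>R der f (g x) b)"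
      using Suc.prems
      by (intro Ck_on_sum Ck_on_bilinear[OF bounded_bilinear_scaleR]
          Ck_on_bilinear[OF bounded_bilinear_inner] assms(1) Ck_on_const Suc.IH
          Ck_on_Suc_imp[OF Suc.prems(2)]) simp_all
  qed
  ultimately show ?case by auto
qed

text \<open>The derivative of 1/f is a product of derivatives of f with 1/f itself, so the induction
  on \<open>k\<close> runs with \<open>f\<close> fixed and its hypothesis supplies the factors 1/f.
  The square root below is treated in the same way.\<close>

lemma Ck_on_inverse:
  fixes f :: "'a::euclidean_space \<Rightarrow> real"
  assumes "open S" "Ck_on k S f" "\<And>x. x \<in> S \<Longrightarrow> f x \<noteq> 0"
  shows "Ck_on k S (\<lambda>x. inverse (f x))"
  using assms(2)
proof (induction k)
  case 0 then show ?case using assms(3) by (auto intro: continuous_on_inverse)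
next
  case (Suc k)
  have d: "f differentiable at x" if "x \<in> S" for x using Suc that by auto
  have h: "((\<lambda>x. inverse (f x)) has_derivative (\<lambda>h. - (inverse (f x) * der f x h * inverse (f x)))) (at x)"
    if "x \<in> S" for x
    using Deriv.has_derivative_inverse[OF assms(3)[OF that] d[OF that, unfolded frechet_derivative_works]] .
  have "Ck_on k S (\<lambda>x. der (\<lambda>x. inverse (f x)) x v)" for v
  proof (subst Ck_on_cong[OF assms(1)])
    show "der (\<lambda>x. inverse (f x)) x v = (-1) *\<^sub>R (inverse (f x) * der f x v * inverse (f x))" if "x \<in> S" for x
      using der_eqI[OF h[OF that]] by simp
    show "Ck_on k S (\<lambda>x. (-1) *\<^sub>R (inverse (f x) * der f x v * inverse (f x)))"
      using Suc.prems
      by (intro Ck_on_bounded_linear[OF bounded_linear_scaleR_right]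
          Ck_on_bilinear[OF bounded_bilinear_mult] assms(1) Suc.IH Ck_on_Suc_imp[OF Suc.prems]) simp_all
  qed
  then show ?case using h by (auto simp: differentiable_def)
qed

lemma Ck_on_sqrt:
  fixes f :: "'a::euclidean_space \<Rightarrow> real"
  assumes "open S" "Ck_on k S f" "\<And>x. x \<in> S \<Longrightarrow> f x > 0"
  shows "Ck_on k S (\<lambda>x. sqrt (f x))"
  using assms(2)
proof (induction k)
  case 0 then show ?case by (auto intro: continuous_on_real_sqrt)
next
  case (Suc k)
  have d: "f differentiable at x" if "x \<in> S" for x using Suc that by auto
  have h: "((\<lambda>x. sqrt (f x)) has_derivative (\<lambda>h. der f x h * (inverse (sqrt (f x)) / 2))) (at x)"
    if "x \<in> S" for x
    using DERIV_compose_FDERIV[OF DERIV_real_sqrt[OF assms(3)[OF that]]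
        d[OF that, unfolded frechet_derivative_works]] .
  have "Ck_on k S (\<lambda>x. der (\<lambda>x. sqrt (f x)) x v)" for v
  proof (subst Ck_on_cong[OF assms(1)])
    show "der (\<lambda>x. sqrt (f x)) x v = (1/2) *\<^sub>R (der f x v * inverse (sqrt (f x)))" if "x \<in> S" for x
      using der_eqI[OF h[OF that]] by simp
    show "Ck_on k S (\<lambda>x. (1/2) *\<^sub>R (der f x v * inverse (sqrt (f x))))"
      using Suc.prems
      by (intro Ck_on_bounded_linear[OF bounded_linear_scaleR_right]
          Ck_on_bilinear[OF bounded_bilinear_mult] assms(1) Ck_on_inverse Suc.IH
          Ck_on_Suc_imp[OF Suc.prems]) (use assms(3) in force)+
  qed
  then show ?case using h by (auto simp: differentiable_def)
qed

section \<open>Closure properties of smooth maps\<close>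

named_theorems smooth_intros

lemma smooth_on_subset: "smooth_on S f \<Longrightarrow> T \<subseteq> S \<Longrightarrow> smooth_on T f"
  unfolding smooth_on_def using Ck_on_subset by blast

lemma smooth_on_cong:
  assumes "open S" "\<And>y. y \<in> S \<Longrightarrow> f y = g y"
  shows "smooth_on S f \<longleftrightarrow> smooth_on S g"
  unfolding smooth_on_def using Ck_on_cong[of S f g] assms by blast

lemma smooth_on_eqI:
  "smooth_on S g \<Longrightarrow> open S \<Longrightarrow> (\<And>y. y \<in> S \<Longrightarrow> f y = g y) \<Longrightarrow> smooth_on S f"
  using smooth_on_cong[of S f g] by simp

lemma smooth_on_local:
  assumes "\<And>x. x \<in> S \<Longrightarrow> \<exists>T. open T \<and> x \<in> T \<and> smooth_on T f"
  shows "smooth_on S f"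
  unfolding smooth_on_def using Ck_on_local[of S _ f] assms unfolding smooth_on_def by blast

lemma smooth_on_differentiable: "smooth_on S f \<Longrightarrow> x \<in> S \<Longrightarrow> f differentiable at x"
  unfolding smooth_on_def by (metis Ck_on.simps(2))

lemma smooth_on_linear_der: "smooth_on S f \<Longrightarrow> x \<in> S \<Longrightarrow> linear (der f x)"
  using smooth_on_differentiable linear_frechet_derivative by blast

lemma smooth_on_continuous_on: "smooth_on S f \<Longrightarrow> continuous_on S f"
  unfolding smooth_on_def by (metis Ck_on.simps(1))

lemma open_preimage_Int: "smooth_on S f \<Longrightarrow> open S \<Longrightarrow> open T \<Longrightarrow> open (S \<inter> f -` T)"
  using continuous_open_preimage smooth_on_continuous_on by blast

lemma smooth_on_der [smooth_intros]: "smooth_on S f \<Longrightarrow> smooth_on S (\<lambda>x. der f x v)"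
  unfolding smooth_on_def by (metis Ck_on.simps(2))

lemma smooth_on_const [smooth_intros]: "smooth_on S (\<lambda>x. c)"
  by (simp add: smooth_on_def Ck_on_const)

lemma smooth_on_bounded_linear:
  "bounded_linear L \<Longrightarrow> open S \<Longrightarrow> smooth_on S f \<Longrightarrow> smooth_on S (\<lambda>x. L (f x))"
  by (simp add: smooth_on_def Ck_on_bounded_linear)

lemma smooth_on_ident [smooth_intros]: "smooth_on S (\<lambda>x. x)"
  unfolding smooth_on_def
proof
  fix k show "Ck_on k S (\<lambda>x. x)" by (cases k) (auto simp: Ck_on_const)
qed

lemma smooth_on_linear: "linear f \<Longrightarrow> smooth_on S f" for f :: "'a::euclidean_space \<Rightarrow> 'b::real_normed_vector"
  using smooth_on_subset[OF smooth_on_bounded_linear[OF linear_conv_bounded_linear[THEN iffD1] open_UNIV smooth_on_ident]]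
  by blast

lemma smooth_on_add [smooth_intros]:
  "open S \<Longrightarrow> smooth_on S f \<Longrightarrow> smooth_on S g \<Longrightarrow> smooth_on S (\<lambda>x. f x + g x)"
  by (simp add: smooth_on_def Ck_on_add)

lemma smooth_on_sum [smooth_intros]:
  "open S \<Longrightarrow> (\<And>i. i \<in> I \<Longrightarrow> smooth_on S (f i)) \<Longrightarrow> smooth_on S (\<lambda>x. \<Sum>i\<in>I. f i x)"
  by (simp add: smooth_on_def Ck_on_sum)

lemma smooth_on_bilinear:
  "bounded_bilinear pr \<Longrightarrow> open S \<Longrightarrow> smooth_on S f \<Longrightarrow> smooth_on S g
    \<Longrightarrow> smooth_on S (\<lambda>x. pr (f x) (g x))"
  by (simp add: smooth_on_def Ck_on_bilinear)

lemmas smooth_on_scaleR [smooth_intros] = smooth_on_bilinear[OF bounded_bilinear_scaleR]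
lemmas smooth_on_inner [smooth_intros] = smooth_on_bilinear[OF bounded_bilinear_inner]
lemmas smooth_on_mult [smooth_intros] = smooth_on_bilinear[OF bounded_bilinear_mult]
lemmas smooth_on_fst [smooth_intros] = smooth_on_bounded_linear[OF bounded_linear_fst]
lemmas smooth_on_snd [smooth_intros] = smooth_on_bounded_linear[OF bounded_linear_snd]
lemmas smooth_on_minus [smooth_intros] =
  smooth_on_bounded_linear[OF bounded_linear_minus[OF bounded_linear_ident]]

lemma smooth_on_projections: "open S \<Longrightarrow> smooth_on S fst" "open S \<Longrightarrow> smooth_on S snd"
  using smooth_on_fst[OF _ smooth_on_ident] smooth_on_snd[OF _ smooth_on_ident] by auto

lemma der_projections: "der fst z = fst" "der snd z = snd"
  by (rule der_eqI, rule bounded_linear_imp_has_derivative, rule bounded_linear_fst bounded_linear_snd)+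

lemma smooth_on_diff [smooth_intros]:
  "open S \<Longrightarrow> smooth_on S f \<Longrightarrow> smooth_on S g \<Longrightarrow> smooth_on S (\<lambda>x. f x - g x)"
  using smooth_on_add[of S f "\<lambda>x. - g x"] smooth_on_minus by auto

lemma smooth_on_Pair [smooth_intros]:
  assumes "open S" "smooth_on S f" "smooth_on S g"
  shows "smooth_on S (\<lambda>x. (f x, g x))"
  using smooth_on_add[OF assms(1) smooth_on_bounded_linear[OF bounded_linear_Pair[OF bounded_linear_ident bounded_linear_zero] assms(1,2)]
    smooth_on_bounded_linear[OF bounded_linear_Pair[OF bounded_linear_zero bounded_linear_ident] assms(1,3)]]
  by simp

lemma smooth_on_compose:
  fixes f :: "'b::euclidean_space \<Rightarrow> 'c::real_normed_vector"
  shows "open S \<Longrightarrow> smooth_on T f \<Longrightarrow> smooth_on S g \<Longrightarrow> g ` S \<subseteq> T \<Longrightarrow> smooth_on S (\<lambda>x. f (g x))"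
  using Ck_on_compose unfolding smooth_on_def by blast

lemma smooth_on_inverse [smooth_intros]:
  fixes f :: "'a::euclidean_space \<Rightarrow> real"
  shows "open S \<Longrightarrow> smooth_on S f \<Longrightarrow> (\<And>x. x \<in> S \<Longrightarrow> f x \<noteq> 0) \<Longrightarrow> smooth_on S (\<lambda>x. inverse (f x))"
  using Ck_on_inverse unfolding smooth_on_def by blast

lemma smooth_on_divide [smooth_intros]:
  fixes f g :: "'a::euclidean_space \<Rightarrow> real"
  shows "open S \<Longrightarrow> smooth_on S f \<Longrightarrow> smooth_on S g \<Longrightarrow> (\<And>x. x \<in> S \<Longrightarrow> g x \<noteq> 0)
    \<Longrightarrow> smooth_on S (\<lambda>x. f x / g x)"
  by (simp add: divide_inverse smooth_on_mult smooth_on_inverse)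

lemma smooth_on_sqrt [smooth_intros]:
  fixes f :: "'a::euclidean_space \<Rightarrow> real"
  shows "open S \<Longrightarrow> smooth_on S f \<Longrightarrow> (\<And>x. x \<in> S \<Longrightarrow> f x > 0) \<Longrightarrow> smooth_on S (\<lambda>x. sqrt (f x))"
  using Ck_on_sqrt unfolding smooth_on_def by blast

section \<open>Linear and bilinear maps depending smoothly on a parameter\<close>

lemma linear_Basis_expand:
  fixes L :: "'v::euclidean_space \<Rightarrow> 'c::real_vector"
  assumes "linear L" shows "L v = (\<Sum>b\<in>Basis. (v \<bullet> b) *\<^sub>R L b)"
proof -
  have "L v = L (\<Sum>b\<in>Basis. (v \<bullet> b) *\<^sub>R b)" by (simp add: euclidean_representation)
  then show ?thesis using assms by (simp add: linear_sum linear_scale)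
qed

text \<open>Smoothness for each fixed vector suffices, because a linear map is determined by its
  finitely many values on the basis. Metrics, Christoffel symbols and differentials of maps are all
  families of this kind, evaluated at moving arguments.\<close>

lemma smooth_on_linear_family:
  fixes L :: "'y::euclidean_space \<Rightarrow> 'v::euclidean_space \<Rightarrow> 'c::real_normed_vector"
  assumes "open S" "\<And>v. smooth_on O' (\<lambda>y. L y v)" "\<And>y. y \<in> O' \<Longrightarrow> linear (L y)"
    "smooth_on S p" "p ` S \<subseteq> O'" "smooth_on S f"
  shows "smooth_on S (\<lambda>x. L (p x) (f x))"
proof (subst smooth_on_cong[OF assms(1)])
  show "L (p x) (f x) = (\<Sum>b\<in>Basis. (f x \<bullet> b) *\<^sub>R L (p x) b)" if "x \<in> S" for x
    using that assms(5) by (intro linear_Basis_expand assms(3)) auto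
  show "smooth_on S (\<lambda>x. \<Sum>b\<in>Basis. (f x \<bullet> b) *\<^sub>R L (p x) b)"
    by (intro smooth_intros assms(1,6) smooth_on_compose[OF assms(1,2,4,5)])
qed

lemma smooth_on_bilinear_family:
  fixes M :: "'y::euclidean_space \<Rightarrow> 'v::euclidean_space \<Rightarrow> 'w::euclidean_space \<Rightarrow> 'c::real_normed_vector"
  assumes "open S" "\<And>u v. smooth_on O' (\<lambda>y. M y u v)"
    "\<And>y v. y \<in> O' \<Longrightarrow> linear (M y v)" "\<And>y v. y \<in> O' \<Longrightarrow> linear (\<lambda>u. M y u v)"
    "smooth_on S p" "p ` S \<subseteq> O'" "smooth_on S f" "smooth_on S g"
  shows "smooth_on S (\<lambda>x. M (p x) (f x) (g x))"
proof (subst smooth_on_cong[OF assms(1)])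
  show "M (p x) (f x) (g x) = (\<Sum>b\<in>Basis. (f x \<bullet> b) *\<^sub>R M (p x) b (g x))" if "x \<in> S" for x
    using linear_Basis_expand[of "\<lambda>u. M (p x) u (g x)" "f x"] assms(4)[of "p x" "g x"] that assms(6) by auto
  show "smooth_on S (\<lambda>x. \<Sum>b\<in>Basis. (f x \<bullet> b) *\<^sub>R M (p x) b (g x))"
    by (intro smooth_intros assms(1,7) smooth_on_linear_family[where L="\<lambda>y. M y _", OF assms(1,2,3,5,6,8)])
qed

text \<open>The product rule for a value L(p x)(f x): the parameter is differentiated with the
  vector frozen at \<open>f x\<close>, and linearity accounts for the motion of the vector.\<close>

lemma der_linear_family:
  fixes L :: "'y::euclidean_space \<Rightarrow> 'v::euclidean_space \<Rightarrow> 'c::real_normed_vector"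
  assumes O': "open O'" "\<And>v y. y \<in> O' \<Longrightarrow> (\<lambda>y. L y v) differentiable at y"
    "\<And>y. y \<in> O' \<Longrightarrow> linear (L y)"
    and S: "open S" "x \<in> S" "p ` S \<subseteq> O'"
    and d: "p differentiable at x" "f differentiable at x"
  shows "(\<lambda>x. L (p x) (f x)) differentiable at x"
    and "der (\<lambda>x. L (p x) (f x)) x v = der (\<lambda>y. L y (f x)) (p x) (der p x v) + L (p x) (der f x v)"
proof -
  have eq: "L (p y) w = (\<Sum>b\<in>Basis. (w \<bullet> b) *\<^sub>R L (p y) b)" if "y \<in> S" for y w
    using that S by (intro linear_Basis_expand O'(3)) auto
  have px: "p x \<in> O'" using S by auto
  have dL: "(\<lambda>x. L (p x) b) differentiable at x" for b
    using differentiable_chain_at[OF d(1) O'(2)[OF px, of b]] by (simp add: o_def)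
  have di: "(\<lambda>x. f x \<bullet> b) differentiable at x" for b
    using d(2) by (auto intro: differentiable_inner)
  have dp: "(\<lambda>x. (f x \<bullet> b) *\<^sub>R L (p x) b) differentiable at x" for b
    using di dL by (auto intro: differentiable_scaleR)
  have dsum: "(\<lambda>x. \<Sum>b\<in>Basis. (f x \<bullet> b) *\<^sub>R L (p x) b) differentiable at x"
    using dp by (auto intro: differentiable_sum)
  then show "(\<lambda>x. L (p x) (f x)) differentiable at x"
    using differentiable_cong_open[OF S(1,2), of "\<lambda>x. L (p x) (f x)", OF eq] by blast
  have der0: "der (\<lambda>y. L y w) (p x) u = (\<Sum>b\<in>Basis. (w \<bullet> b) *\<^sub>R der (\<lambda>y. L y b) (p x) u)" for w u
  proof -
    have "der (\<lambda>y. L y w) (p x) = der (\<lambda>y. \<Sum>b\<in>Basis. (w \<bullet> b) *\<^sub>R L y b) (p x)"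
      by (rule der_cong[OF O'(1) px]) (auto intro: linear_Basis_expand O'(3))
    then show ?thesis
      using O'(2)[OF px] by (simp add: der_sum der_bounded_linear[OF bounded_linear_scaleR_right])
  qed
  have "der (\<lambda>x. L (p x) (f x)) x v = der (\<lambda>x. \<Sum>b\<in>Basis. (f x \<bullet> b) *\<^sub>R L (p x) b) x v"
    by (rule arg_cong[where f="\<lambda>h. h v"], rule der_cong[OF S(1,2) eq])
  also have "\<dots> = (\<Sum>b\<in>Basis. (f x \<bullet> b) *\<^sub>R der (\<lambda>y. L y b) (p x) (der p x v) + (der f x v \<bullet> b) *\<^sub>R L (p x) b)"
  proof -
    have "der (\<lambda>x. (f x \<bullet> b) *\<^sub>R L (p x) b) x v
        = (f x \<bullet> b) *\<^sub>R der (\<lambda>y. L y b) (p x) (der p x v) + (der f x v \<bullet> b) *\<^sub>R L (p x) b" for b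
      using der_bilinear[OF bounded_bilinear_scaleR di dL] der_compose[OF d(1) O'(2)[OF px]]
        der_bounded_linear[OF bounded_linear_inner_left d(2)] by simp
    then show ?thesis using dp by (simp add: der_sum)
  qed
  also have "\<dots> = der (\<lambda>y. L y (f x)) (p x) (der p x v) + L (p x) (der f x v)"
    using der0[of "f x"] eq[OF S(2), of "der f x v"] by (simp add: sum.distrib)
  finally show "der (\<lambda>x. L (p x) (f x)) x v = der (\<lambda>y. L y (f x)) (p x) (der p x v) + L (p x) (der f x v)" .
qed

lemma der_bilinear_family:
  fixes M :: "'y::euclidean_space \<Rightarrow> 'v::euclidean_space \<Rightarrow> 'w::euclidean_space \<Rightarrow> 'c::real_normed_vector"
  assumes O': "open O'" "\<And>u v. smooth_on O' (\<lambda>y. M y u v)"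
    "\<And>y v. y \<in> O' \<Longrightarrow> linear (M y v)" "\<And>y v. y \<in> O' \<Longrightarrow> linear (\<lambda>u. M y u v)"
    and S: "open S" "x \<in> S" "p ` S \<subseteq> O'"
    and s: "smooth_on S p" "smooth_on S f" "smooth_on S g"
  shows "der (\<lambda>x. M (p x) (f x) (g x)) x v
    = der (\<lambda>y. M y (f x) (g x)) (p x) (der p x v) + M (p x) (der f x v) (g x) + M (p x) (f x) (der g x v)"
proof -
  have d: "p differentiable at x" "f differentiable at x" "g differentiable at x"
    using s S(2) by (auto intro: smooth_on_differentiable)
  have px: "p x \<in> O'" using S by auto
  have sM: "smooth_on S (\<lambda>x. M (p x) u (g x))" for u
    by (rule smooth_on_linear_family[where L="\<lambda>y. M y u", OF S(1) O'(2,3) s(1) S(3) s(3)])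
  have lin: "linear (\<lambda>u. M (p x) u (g x))" if "x \<in> S" for x
    using that S(3) by (intro O'(4)) auto
  \<comment> \<open>The linear rule is used twice. Here only the first argument is split off:
    \<open>p\<close> and \<open>g\<close> are absorbed into the family, which is indexed by the
    points of \<open>S\<close> with the identity as parameter map.\<close>
  have "der (\<lambda>x. M (p x) (f x) (g x)) x v =
      der (\<lambda>y. M (p y) (f x) (g y)) x (der (\<lambda>x. x) x v) + M (p x) (der f x v) (g x)"
    by (rule der_linear_family(2)[where L="\<lambda>y u. M (p y) u (g y)" and O'=S and S=S and p="\<lambda>x. x", OF S(1)])
      (use smooth_on_differentiable[OF sM] lin S d(2) in auto)
  moreover have "der (\<lambda>y. M (p y) (f x) (g y)) x v = der (\<lambda>y. M y (f x) (g x)) (p x) (der p x v) + M (p x) (f x) (der g x v)"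
    by (rule der_linear_family(2)[where L="\<lambda>y u. M y (f x) u", OF O'(1) _ O'(3) S d(1,3)])
       (auto intro: smooth_on_differentiable[OF O'(2)])
  ultimately show ?thesis by (simp add: algebra_simps)
qed

section \<open>Symmetry of second derivatives\<close>

lemma has_real_derivative_along_line:
  assumes "F differentiable at (y + s *\<^sub>R u)"
  shows "((\<lambda>s. F (y + s *\<^sub>R u)) has_real_derivative der F (y + s *\<^sub>R u) u) (at s)"
proof -
  have "((\<lambda>s. F (y + s *\<^sub>R u)) has_derivative (\<lambda>h. der F (y + s *\<^sub>R u) (h *\<^sub>R u))) (at s)"
    by (rule has_derivative_compose[where g=F and f="\<lambda>s. y + s *\<^sub>R u"])
      (use assms in \<open>auto intro!: derivative_eq_intros simp: frechet_derivative_works\<close>)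
  moreover have "der F (y + s *\<^sub>R u) (h *\<^sub>R u) = der F (y + s *\<^sub>R u) u * h" for h
    using linear_frechet_derivative[OF assms] by (simp add: linear_scale)
  ultimately show ?thesis by (simp add: has_field_derivative_def)
qed

text \<open>The mean value theorem is applied in the direction \<open>u\<close> to a difference of
  two translates of \<open>f\<close>, and then in the direction \<open>v\<close> to the resulting
  difference of first derivatives.\<close>

lemma second_difference_mvt:
  fixes f :: "'a::euclidean_space \<Rightarrow> real"
  assumes "smooth_on S f" "t > 0"
    and S: "\<And>\<sigma> \<tau>. 0 \<le> \<sigma> \<Longrightarrow> \<sigma> \<le> t \<Longrightarrow> 0 \<le> \<tau> \<Longrightarrow> \<tau> \<le> t \<Longrightarrow> x + \<sigma> *\<^sub>R u + \<tau> *\<^sub>R v \<in> S"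
  obtains \<sigma> \<tau> where "0 \<le> \<sigma>" "\<sigma> \<le> t" "0 \<le> \<tau>" "\<tau> \<le> t"
    "f (x + t *\<^sub>R u + t *\<^sub>R v) - f (x + t *\<^sub>R u) - f (x + t *\<^sub>R v) + f x
      = t * t * der (\<lambda>y. der f y u) (x + \<sigma> *\<^sub>R u + \<tau> *\<^sub>R v) v"
proof -
  have d1: "f differentiable at (x + \<sigma> *\<^sub>R u + \<tau> *\<^sub>R v)"
    and d2: "(\<lambda>y. der f y u) differentiable at (x + \<sigma> *\<^sub>R u + \<tau> *\<^sub>R v)"
    if "0 \<le> \<sigma>" "\<sigma> \<le> t" "0 \<le> \<tau>" "\<tau> \<le> t" for \<sigma> \<tau>
    using S[OF that] assms(1) smooth_on_der smooth_on_differentiable by blast+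
  define \<phi> where "\<phi> s = f (x + t *\<^sub>R v + s *\<^sub>R u) - f (x + s *\<^sub>R u)" for s
  have "\<exists>z. 0 < z \<and> z < t \<and> \<phi> t - \<phi> 0 = (t - 0) * (der f (x + t *\<^sub>R v + z *\<^sub>R u) u - der f (x + z *\<^sub>R u) u)"
  proof (rule MVT2[OF assms(2)])
    fix s assume s: "0 \<le> s" "s \<le> t"
    show "(\<phi> has_real_derivative der f (x + t *\<^sub>R v + s *\<^sub>R u) u - der f (x + s *\<^sub>R u) u) (at s)"
      unfolding \<phi>_def
      by (intro DERIV_diff has_real_derivative_along_line)
        (use d1[OF s, of t] d1[OF s, of 0] assms(2) in \<open>simp_all add: add_ac\<close>)
  qed
  then obtain \<sigma> where \<sigma>: "0 < \<sigma>" "\<sigma> < t"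
    "\<phi> t - \<phi> 0 = t * (der f (x + \<sigma> *\<^sub>R u + t *\<^sub>R v) u - der f (x + \<sigma> *\<^sub>R u + 0 *\<^sub>R v) u)"
    by (auto simp: add_ac)
  have "\<exists>z. 0 < z \<and> z < t \<and> der f (x + \<sigma> *\<^sub>R u + t *\<^sub>R v) u - der f (x + \<sigma> *\<^sub>R u + 0 *\<^sub>R v) u
      = (t - 0) * der (\<lambda>y. der f y u) (x + \<sigma> *\<^sub>R u + z *\<^sub>R v) v"
    by (rule MVT2[OF assms(2)], rule has_real_derivative_along_line) (use d2 \<sigma> in auto)
  then obtain \<tau> where \<tau>: "0 < \<tau>" "\<tau> < t"
    "der f (x + \<sigma> *\<^sub>R u + t *\<^sub>R v) u - der f (x + \<sigma> *\<^sub>R u + 0 *\<^sub>R v) u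
      = t * der (\<lambda>y. der f y u) (x + \<sigma> *\<^sub>R u + \<tau> *\<^sub>R v) v" by auto
  have "\<phi> t - \<phi> 0 = f (x + t *\<^sub>R u + t *\<^sub>R v) - f (x + t *\<^sub>R u) - f (x + t *\<^sub>R v) + f x"
    by (simp add: \<phi>_def add_ac)
  then show thesis using that[of \<sigma> \<tau>] \<sigma> \<tau> by simp
qed

text \<open>The second difference over a parallelogram is symmetric in \<open>u\<close> and
  \<open>v\<close>, so the two mixed derivatives take a common value, each at some point of it.
  Shrinking the parallelogram and continuity exclude a gap at \<open>x\<close>.\<close>

lemma der_der_commute_real:
  fixes f :: "'a::euclidean_space \<Rightarrow> real"
  assumes "open S" "smooth_on S f" "x \<in> S"
  shows "der (\<lambda>y. der f y u) x v = der (\<lambda>y. der f y v) x u"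
proof (rule ccontr)
  define g1 where "g1 = (\<lambda>y. der (\<lambda>y. der f y u) y v)"
  define g2 where "g2 = (\<lambda>y. der (\<lambda>y. der f y v) y u)"
  assume "der (\<lambda>y. der f y u) x v \<noteq> der (\<lambda>y. der f y v) x u"
  then have e: "\<bar>g1 x - g2 x\<bar> / 2 > 0" (is "?e > 0") by (simp add: g1_def g2_def)
  have "smooth_on S g1" "smooth_on S g2"
    unfolding g1_def g2_def by (intro smooth_on_der assms(2))+
  then have c: "continuous (at x) g1" "continuous (at x) g2"
    using smooth_on_continuous_on continuous_on_eq_continuous_at assms by blast+
  obtain d0 where d0: "d0 > 0" "ball x d0 \<subseteq> S" using assms openE by blast
  obtain d1 where d1: "d1 > 0" "\<And>y. dist y x < d1 \<Longrightarrow> dist (g1 y) (g1 x) < ?e"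
    using c(1) e unfolding continuous_at_eps_delta dist_norm by metis
  obtain d2 where d2: "d2 > 0" "\<And>y. dist y x < d2 \<Longrightarrow> dist (g2 y) (g2 x) < ?e"
    using c(2) e unfolding continuous_at_eps_delta dist_norm by metis
  define d where "d = min d0 (min d1 d2)"
  \<comment> \<open>The size keeps the parallelogram with sides \<open>t u\<close> and
    \<open>t v\<close> inside the ball of radius \<open>d\<close>; the summand 1 keeps the
    denominator positive when both vectors vanish.\<close>
  define t where "t = d / (2 * (norm u + norm v + 1))"
  have n: "norm u + norm v + 1 > 0" by (simp add: add_nonneg_pos)
  have "d > 0" using d0 d1 d2 by (simp add: d_def)
  then have t: "t > 0" using n by (simp add: t_def)
  have "t * (norm u + norm v) \<le> t * (norm u + norm v + 1)" using t by simp
  also have "\<dots> = d / 2" unfolding t_def using n by (metis less_irrefl mult.commute mult_divide_mult_cancel_left times_divide_eq_left)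
  also have "\<dots> < d" using \<open>d > 0\<close> by simp
  finally have td: "t * norm u + t * norm v < d" by (simp add: algebra_simps)
  have near: "dist (x + a *\<^sub>R u + b *\<^sub>R v) x < d" "dist (x + b *\<^sub>R v + a *\<^sub>R u) x < d"
    if "0 \<le> a" "a \<le> t" "0 \<le> b" "b \<le> t" for a b
  proof -
    have "norm (a *\<^sub>R u + b *\<^sub>R v) \<le> t * norm u + t * norm v"
      using that by (intro order_trans[OF norm_triangle_ineq]) (simp add: add_mono mult_right_mono)
    then show "dist (x + a *\<^sub>R u + b *\<^sub>R v) x < d" "dist (x + b *\<^sub>R v + a *\<^sub>R u) x < d"
      using td by (simp_all add: dist_norm add_ac)
  qed
  have inS: "x + a *\<^sub>R u + b *\<^sub>R v \<in> S" "x + b *\<^sub>R v + a *\<^sub>R u \<in> S"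
    if "0 \<le> a" "a \<le> t" "0 \<le> b" "b \<le> t" for a b
    using near[OF that] d0(2) by (auto simp: d_def dist_commute)
  obtain a b where ab: "0 \<le> a" "a \<le> t" "0 \<le> b" "b \<le> t"
    "f (x + t *\<^sub>R u + t *\<^sub>R v) - f (x + t *\<^sub>R u) - f (x + t *\<^sub>R v) + f x = t * t * g1 (x + a *\<^sub>R u + b *\<^sub>R v)"
    unfolding g1_def by (rule second_difference_mvt[OF assms(2) t inS(1)])
  obtain a' b' where ab': "0 \<le> a'" "a' \<le> t" "0 \<le> b'" "b' \<le> t"
    "f (x + t *\<^sub>R v + t *\<^sub>R u) - f (x + t *\<^sub>R v) - f (x + t *\<^sub>R u) + f x = t * t * g2 (x + a' *\<^sub>R v + b' *\<^sub>R u)"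
    unfolding g2_def by (rule second_difference_mvt[OF assms(2) t, of x v u]) (use inS in auto)
  have "t * t * g1 (x + a *\<^sub>R u + b *\<^sub>R v) = t * t * g2 (x + a' *\<^sub>R v + b' *\<^sub>R u)"
    using ab(5) ab'(5) add.commute[of "t *\<^sub>R u" "t *\<^sub>R v"] by (simp only: add.assoc)
  then have "g1 (x + a *\<^sub>R u + b *\<^sub>R v) = g2 (x + a' *\<^sub>R v + b' *\<^sub>R u)" using t by simp
  moreover have "dist (g1 (x + a *\<^sub>R u + b *\<^sub>R v)) (g1 x) < ?e"
    using near(1)[OF ab(1-4)] d1(2) by (simp add: d_def)
  moreover have "dist (g2 (x + a' *\<^sub>R v + b' *\<^sub>R u)) (g2 x) < ?e"
    using near(2)[of b' a'] ab' d2(2) by (simp add: d_def)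
  ultimately show False by (simp add: dist_real_def field_simps abs_if split: if_splits)
qed

lemma der_der_commute:
  fixes f :: "'a::euclidean_space \<Rightarrow> 'b::euclidean_space"
  assumes "open S" "smooth_on S f" "x \<in> S"
  shows "der (\<lambda>y. der f y u) x v = der (\<lambda>y. der f y v) x u"
proof (rule euclidean_eqI)
  fix b :: 'b assume "b \<in> Basis"
  have d: "f differentiable at y" if "y \<in> S" for y using assms(2) smooth_on_differentiable that by blast
  have "der (\<lambda>y. der f y u) x v \<bullet> b = der (\<lambda>y. der (\<lambda>y. f y \<bullet> b) y u) x v" for u v
  proof -
    have "der (\<lambda>y. der (\<lambda>y. f y \<bullet> b) y u) x = der (\<lambda>y. der f y u \<bullet> b) x"
      by (rule der_cong[OF assms(1,3)]) (simp add: der_bounded_linear[OF bounded_linear_inner_left d])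
    moreover have "der (\<lambda>y. der f y u \<bullet> b) x v = der (\<lambda>y. der f y u) x v \<bullet> b"
      by (rule der_bounded_linear[OF bounded_linear_inner_left
            smooth_on_differentiable[OF smooth_on_der[OF assms(2)] assms(3)]])
    ultimately show ?thesis by simp
  qed
  moreover have "smooth_on S (\<lambda>y. f y \<bullet> b)"
    by (intro smooth_intros assms)
  ultimately show "der (\<lambda>y. der f y u) x v \<bullet> b = der (\<lambda>y. der f y v) x u \<bullet> b"
    using der_der_commute_real[OF assms(1) _ assms(3)] by metis
qed

section \<open>Riemannian metrics in coordinates\<close>

text \<open>The Koszul formula for bare coefficients \<open>M\<close>, without an atlas. In this
  form it applies alike to charts of M, of TM and of the unit tangent bundle.\<close>

definition levi_civita ::
    "('e::euclidean_space \<Rightarrow> 'e \<Rightarrow> 'e \<Rightarrow> real) \<Rightarrow> 'e \<Rightarrow> 'e \<Rightarrow> 'e \<Rightarrow> 'e"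
  where "levi_civita M x u v = (THE w. \<forall>z.
    2 * M x w z = der (\<lambda>y. M y v z) x u + der (\<lambda>y. M y u z) x v - der (\<lambda>y. M y u v) x z)"

lemma christoffel_eq_levi_civita: "christoffel A g c = levi_civita (metric_coord A g c)"
  by (simp add: fun_eq_iff christoffel_def levi_civita_def)

locale coord_metric =
  fixes \<Omega> :: "'e::euclidean_space set" and M :: "'e \<Rightarrow> 'e \<Rightarrow> 'e \<Rightarrow> real"
  assumes open_dom: "open \<Omega>"
    and M_linear: "x \<in> \<Omega> \<Longrightarrow> linear (M x u)"
    and M_sym: "x \<in> \<Omega> \<Longrightarrow> M x u v = M x v u"
    and M_pos: "x \<in> \<Omega> \<Longrightarrow> u \<noteq> 0 \<Longrightarrow> M x u u > 0"
    and M_smooth: "smooth_on \<Omega> (\<lambda>x. M x u v)"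
begin

abbreviation "\<Gamma> \<equiv> levi_civita M"

lemma M_linear_left: "x \<in> \<Omega> \<Longrightarrow> linear (\<lambda>u. M x u v)"
  using M_linear[of x v] M_sym[of x _ v] by (metis (no_types, lifting) ext)

lemma M_arith:
  assumes "x \<in> \<Omega>"
  shows "M x (u + v) w = M x u w + M x v w" "M x w (u + v) = M x w u + M x w v"
    "M x (u - v) w = M x u w - M x v w" "M x w (u - v) = M x w u - M x w v"
    "M x (- u) w = - M x u w" "M x w (- u) = - M x w u"
    "M x (r *\<^sub>R u) w = r * M x u w" "M x w (r *\<^sub>R u) = r * M x w u"
    "M x 0 w = 0" "M x w 0 = 0"
proof -
  note l = M_linear[OF assms, of w] and r = M_linear_left[OF assms, of w]
  show "M x (u + v) w = M x u w + M x v w" by (rule linear_add[OF r])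
  show "M x w (u + v) = M x w u + M x w v" by (rule linear_add[OF l])
  show "M x (u - v) w = M x u w - M x v w" by (rule linear_diff[OF r])
  show "M x w (u - v) = M x w u - M x w v" by (rule linear_diff[OF l])
  show "M x (- u) w = - M x u w" by (rule linear_neg[OF r])
  show "M x w (- u) = - M x w u" by (rule linear_neg[OF l])
  show "M x (r *\<^sub>R u) w = r * M x u w" using linear_scale[OF r, of r u] by simp
  show "M x w (r *\<^sub>R u) = r * M x w u" using linear_scale[OF l, of r u] by simp
  show "M x 0 w = 0" by (rule linear_0[OF r])
  show "M x w 0 = 0" by (rule linear_0[OF l])
qed

lemma M_sum_left: "x \<in> \<Omega> \<Longrightarrow> M x (\<Sum>i\<in>I. f i) w = (\<Sum>i\<in>I. M x (f i) w)"
  using linear_sum[OF M_linear_left] by blast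

lemma M_eq_imp_eq:
  assumes "x \<in> \<Omega>" "\<And>z. M x w z = M x w' z"
  shows "w = w'"
proof (rule ccontr)
  assume "w \<noteq> w'"
  then have "M x (w - w') (w - w') > 0" using M_pos[OF assms(1)] by simp
  then show False using assms by (simp add: M_arith)
qed

lemma M_smooth_on [smooth_intros]:
  assumes "open S" "smooth_on S p" "p ` S \<subseteq> \<Omega>" "smooth_on S f" "smooth_on S h"
  shows "smooth_on S (\<lambda>x. M (p x) (f x) (h x))"
  by (rule smooth_on_bilinear_family[OF assms(1) M_smooth M_linear M_linear_left assms(2,3,4,5)])

lemma der_M:
  assumes "open S" "x \<in> S" "p ` S \<subseteq> \<Omega>" "smooth_on S p" "smooth_on S f" "smooth_on S h"
  shows "der (\<lambda>x. M (p x) (f x) (h x)) x v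
    = der (\<lambda>y. M y (f x) (h x)) (p x) (der p x v) + M (p x) (der f x v) (h x) + M (p x) (f x) (der h x v)"
  by (rule der_bilinear_family[OF open_dom M_smooth M_linear M_linear_left assms])

text \<open>Gram--Schmidt without normalization.\<close>

lemma orthogonal_frame:
  assumes "finite B" "B \<subseteq> Basis"
  shows "\<exists>E :: 'e \<Rightarrow> 'e \<Rightarrow> 'e. (\<forall>b\<in>B. smooth_on \<Omega> (E b)) \<and>
    (\<forall>x\<in>\<Omega>. (\<forall>b\<in>B. E b x \<noteq> 0) \<and> (\<forall>b\<in>B. \<forall>b'\<in>B. b \<noteq> b' \<longrightarrow> M x (E b x) (E b' x) = 0) \<and>
       span ((\<lambda>b. E b x) ` B) = span B)"
  using assms
proof (induction B rule: finite_induct)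
  case empty then show ?case by simp
next
  case (insert a B)
  from insert.prems have "B \<subseteq> Basis" by simp
  from insert.IH[OF this] obtain E :: "'e \<Rightarrow> 'e \<Rightarrow> 'e" where E0: "(\<forall>b\<in>B. smooth_on \<Omega> (E b)) \<and>
    (\<forall>x\<in>\<Omega>. (\<forall>b\<in>B. E b x \<noteq> 0) \<and> (\<forall>b\<in>B. \<forall>b'\<in>B. b \<noteq> b' \<longrightarrow> M x (E b x) (E b' x) = 0) \<and>
       span ((\<lambda>b. E b x) ` B) = span B)"
    by (elim exE)
  have E: "\<And>b. b \<in> B \<Longrightarrow> smooth_on \<Omega> (E b)"
    "\<And>x b. x \<in> \<Omega> \<Longrightarrow> b \<in> B \<Longrightarrow> E b x \<noteq> 0"
    "\<And>x b b'. x \<in> \<Omega> \<Longrightarrow> b \<in> B \<Longrightarrow> b' \<in> B \<Longrightarrow> b \<noteq> b' \<Longrightarrow> M x (E b x) (E b' x) = 0"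
    "\<And>x. x \<in> \<Omega> \<Longrightarrow> span ((\<lambda>b. E b x) ` B) = span B"
    using E0 by blast+
  define s where "s x = (\<Sum>b\<in>B. (M x a (E b x) / M x (E b x) (E b x)) *\<^sub>R E b x)" for x
  define E' where "E' = E(a := \<lambda>x. a - s x)"
  have E'B: "E' b = E b" if "b \<in> B" for b using that insert.hyps(2) by (auto simp: E'_def)
  have nz: "M x (E b x) (E b x) \<noteq> 0" if "x \<in> \<Omega>" "b \<in> B" for x b
    using M_pos[OF that(1) E(2)[OF that]] by simp
  have "smooth_on \<Omega> s"
    unfolding s_def by (intro smooth_intros open_dom E(1) nz) auto
  then have sm: "smooth_on \<Omega> (E' b)" if "b \<in> insert a B" for b
    using that E(1) E'B by (cases "b = a") (auto simp: E'_def intro!: smooth_intros open_dom)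
  have s_span: "s x \<in> span ((\<lambda>b. E b x) ` B)" for x
    unfolding s_def by (intro span_sum span_scale span_base) auto
  have a_notin: "a \<notin> span B"
    using independent_insert[of a B] insert.prems insert.hyps(2) independent_mono[OF independent_Basis, of "insert a B"]
    by auto
  \<comment> \<open>If \<open>a - s x\<close> vanished, \<open>a\<close> would lie in the span of
    the earlier frame vectors, which is \<open>span B\<close>, against the independence of the
    basis. This is why the spans are part of the induction.\<close>
  have nz': "E' b x \<noteq> 0" if "x \<in> \<Omega>" "b \<in> insert a B" for b x
    using that s_span[of x] E(4)[OF that(1)] a_notin E(2) E'B by (cases "b = a") (auto simp: E'_def)
  have orth_a: "M x (a - s x) (E b x) = 0" if "x \<in> \<Omega>" "b \<in> B" for x b
  proof -
    have "M x (s x) (E b x) = (\<Sum>b'\<in>B. if b' = b then M x a (E b x) else 0)"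
      unfolding s_def M_sum_left[OF that(1)]
      by (intro sum.cong) (use that E(3) nz in \<open>auto simp: M_arith\<close>)
    then show ?thesis using that insert.hyps(1) by (simp add: M_arith)
  qed
  have orth: "M x (E' b x) (E' b' x) = 0" if "x \<in> \<Omega>" "b \<in> insert a B" "b' \<in> insert a B" "b \<noteq> b'" for x b b'
  proof -
    have "E' a x = a - s x" by (simp add: E'_def)
    then show ?thesis
      using that orth_a[of x b'] orth_a[of x b] M_sym[OF that(1)] E(3)[of x b b'] E'B
      by (cases "b = a"; cases "b' = a") auto
  qed
  have "span ((\<lambda>b. E' b x) ` insert a B) = span (insert a B)" if "x \<in> \<Omega>" for x
  proof -
    have "(\<lambda>b. E' b x) ` insert a B = insert (a - s x) ((\<lambda>b. E b x) ` B)"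
      using E'B by (auto simp: E'_def)
    moreover have "span (insert (a - s x) ((\<lambda>b. E b x) ` B)) = span (insert a ((\<lambda>b. E b x) ` B))"
      by (rule eq_span_insert_eq) (use s_span[of x] span_neg in auto)
    ultimately show ?thesis using E(4)[OF that] by (simp add: span_insert)
  qed
  then show ?case
    by (intro exI[of _ E'] conjI ballI impI) (erule sm | rule nz' orth; assumption | assumption)+
qed

text \<open>In an orthogonal frame the representing vector has the explicit coefficients l(E)/M(E,
  E), which shows its existence and its smooth dependence on \<open>x\<close> at once, without
  inverting a matrix.\<close>

lemma riesz_smooth:
  fixes l :: "'e \<Rightarrow> 'e \<Rightarrow> real"
  assumes l: "\<And>z. smooth_on \<Omega> (\<lambda>x. l x z)" "\<And>x. x \<in> \<Omega> \<Longrightarrow> linear (l x)"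
  obtains w where "smooth_on \<Omega> w" "\<And>x z. x \<in> \<Omega> \<Longrightarrow> M x (w x) z = l x z"
proof -
  obtain E :: "'e \<Rightarrow> 'e \<Rightarrow> 'e" where E: "\<And>b. b \<in> Basis \<Longrightarrow> smooth_on \<Omega> (E b)"
    "\<And>x b. x \<in> \<Omega> \<Longrightarrow> b \<in> Basis \<Longrightarrow> E b x \<noteq> 0"
    "\<And>x b b'. x \<in> \<Omega> \<Longrightarrow> b \<in> Basis \<Longrightarrow> b' \<in> Basis \<Longrightarrow> b \<noteq> b' \<Longrightarrow> M x (E b x) (E b' x) = 0"
    "\<And>x. x \<in> \<Omega> \<Longrightarrow> span ((\<lambda>b. E b x) ` Basis) = UNIV"
    using orthogonal_frame[OF finite_Basis order_refl] unfolding span_Basis by metis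
  define w where "w x = (\<Sum>b\<in>Basis. (l x (E b x) / M x (E b x) (E b x)) *\<^sub>R E b x)" for x
  have nz: "M x (E b x) (E b x) \<noteq> 0" if "x \<in> \<Omega>" "b \<in> Basis" for x b
    using M_pos[OF that(1) E(2)[OF that]] by simp
  have "smooth_on \<Omega> (\<lambda>x. l x (E b x))" if "b \<in> Basis" for b
    by (rule smooth_on_linear_family[OF open_dom l _ _ E(1)[OF that]]) (auto intro: smooth_intros)
  then have "smooth_on \<Omega> w"
    unfolding w_def by (intro smooth_intros open_dom E(1) nz) auto
  moreover have "M x (w x) z = l x z" if x: "x \<in> \<Omega>" for x z
  proof (rule linear_eq_on[OF M_linear[OF x] l(2)[OF x]])
    show "z \<in> span ((\<lambda>b. E b x) ` Basis)" using E(4)[OF x] by simp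
    fix v assume "v \<in> (\<lambda>b. E b x) ` Basis"
    then obtain b where b: "b \<in> Basis" "v = E b x" by auto
    have "M x (w x) (E b x) = (\<Sum>b'\<in>Basis. if b' = b then l x (E b x) else 0)"
      unfolding w_def M_sum_left[OF x]
      by (intro sum.cong) (use x b E(3) nz in \<open>auto simp: M_arith\<close>)
    then show "M x (w x) v = l x v" using b by simp
  qed
  ultimately show thesis using that by blast
qed

section \<open>The Levi-Civita connection from the Koszul formula\<close>

lemma der_M_linear:
  assumes "x \<in> \<Omega>"
  shows "linear (\<lambda>z. der (\<lambda>y. M y v z) x u)"
proof (rule linearI)
  note d = smooth_on_differentiable[OF M_smooth assms]
  show "der (\<lambda>y. M y v (z + z')) x u = der (\<lambda>y. M y v z) x u + der (\<lambda>y. M y v z') x u" for z z'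
    unfolding der_add[OF d d, symmetric]
    by (rule arg_cong[where f="\<lambda>h. h u"], rule der_cong[OF open_dom assms]) (simp add: M_arith)
  show "der (\<lambda>y. M y v (r *\<^sub>R z)) x u = r *\<^sub>R der (\<lambda>y. M y v z) x u" for r z
    unfolding der_bounded_linear[OF bounded_linear_scaleR_right d, symmetric]
    by (rule arg_cong[where f="\<lambda>h. h u"], rule der_cong[OF open_dom assms]) (simp add: M_arith)
qed

lemma linear_divide: "linear f \<Longrightarrow> linear (\<lambda>z. f z / c)" for f :: "'e \<Rightarrow> real"
  using linear_compose_scale_right[of f "inverse c"] by (simp add: divide_inverse mult.commute)

text \<open>The Koszul expression is linear in \<open>z\<close>, so it is represented by a vector.
  One smooth \<open>w\<close> serves all points, so that the definite description behind \<Gamma>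
  inherits smoothness.\<close>

lemma levi_civita_exists:
  "\<exists>w. smooth_on \<Omega> w \<and> (\<forall>x\<in>\<Omega>. \<forall>z. 2 * M x (w x) z = der (\<lambda>y. M y v z) x u + der (\<lambda>y. M y u z) x v - der (\<lambda>y. M y u v) x z)"
proof -
  define l where "l x z = (der (\<lambda>y. M y v z) x u + der (\<lambda>y. M y u z) x v - der (\<lambda>y. M y u v) x z) / 2" for x z
  have "smooth_on \<Omega> (\<lambda>x. l x z)" for z
    unfolding l_def by (intro smooth_intros open_dom M_smooth) simp
  moreover have "linear (l x)" if "x \<in> \<Omega>" for x
    unfolding l_def
    by (intro linear_divide linear_compose_add linear_compose_sub der_M_linear that
        smooth_on_linear_der[OF M_smooth that])
  ultimately obtain w where "smooth_on \<Omega> w" and w: "\<And>x z. x \<in> \<Omega> \<Longrightarrow> M x (w x) z = l x z"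
    using riesz_smooth by blast
  moreover have "2 * M x (w x) z = der (\<lambda>y. M y v z) x u + der (\<lambda>y. M y u z) x v - der (\<lambda>y. M y u v) x z" if "x \<in> \<Omega>" for x z
    unfolding w[OF that] by (simp add: l_def)
  ultimately show ?thesis by (intro exI[of _ w] conjI ballI allI)
qed

text \<open>\<open>M\<close> is nondegenerate, so the Koszul formula has at most one solution.
  Symmetry and linearity of \<Gamma> and the Sasaki connection are all obtained by exhibiting a
  solution.\<close>

lemma levi_civita_eqI:
  assumes "x \<in> \<Omega>"
    "\<And>z. 2 * M x w z = der (\<lambda>y. M y v z) x u + der (\<lambda>y. M y u z) x v - der (\<lambda>y. M y u v) x z"
  shows "\<Gamma> x u v = w"
  unfolding levi_civita_def
proof (rule the_equality)
  show "\<forall>z. 2 * M x w z = der (\<lambda>y. M y v z) x u + der (\<lambda>y. M y u z) x v - der (\<lambda>y. M y u v) x z"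
    by (intro allI assms(2))
  fix w' assume "\<forall>z. 2 * M x w' z = der (\<lambda>y. M y v z) x u + der (\<lambda>y. M y u z) x v - der (\<lambda>y. M y u v) x z"
  then have "2 * M x w' z = 2 * M x w z" for z by (simp only: assms(2))
  then show "w' = w" by (intro M_eq_imp_eq[OF assms(1)]) simp
qed

lemma levi_civita_koszul:
  assumes "x \<in> \<Omega>"
  shows "2 * M x (\<Gamma> x u v) z = der (\<lambda>y. M y v z) x u + der (\<lambda>y. M y u z) x v - der (\<lambda>y. M y u v) x z"
proof -
  obtain w where w: "\<forall>x\<in>\<Omega>. \<forall>z. 2 * M x (w x) z = der (\<lambda>y. M y v z) x u + der (\<lambda>y. M y u z) x v - der (\<lambda>y. M y u v) x z"
    using levi_civita_exists[of v u] by (elim exE conjE)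
  note w' = w[THEN bspec, THEN spec, OF assms]
  show ?thesis unfolding levi_civita_eqI[OF assms w'] by (rule w')
qed

lemma levi_civita_smooth: "smooth_on \<Omega> (\<lambda>x. \<Gamma> x u v)"
proof -
  obtain w where w: "smooth_on \<Omega> w" "\<forall>x\<in>\<Omega>. \<forall>z. 2 * M x (w x) z = der (\<lambda>y. M y v z) x u + der (\<lambda>y. M y u z) x v - der (\<lambda>y. M y u v) x z"
    using levi_civita_exists[of v u] by (elim exE conjE)
  have "\<Gamma> x u v = w x" if "x \<in> \<Omega>" for x
    by (rule levi_civita_eqI[OF that w(2)[THEN bspec, THEN spec, OF that]])
  then show ?thesis
    by (subst smooth_on_cong[OF open_dom]) (assumption | rule w(1))+
qed

lemma der_M_sym:
  assumes "x \<in> \<Omega>" shows "der (\<lambda>y. M y u v) x = der (\<lambda>y. M y v u) x"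
  by (rule der_cong[OF open_dom assms]) (rule M_sym)

lemma levi_civita_sym:
  assumes "x \<in> \<Omega>" shows "\<Gamma> x u v = \<Gamma> x v u"
  by (rule levi_civita_eqI[OF assms])
    (simp add: levi_civita_koszul[OF assms, of v u, simplified] der_M_sym[OF assms, of u v])

lemma levi_civita_linear:
  assumes "x \<in> \<Omega>" shows "linear (\<Gamma> x u)"
proof (rule linearI)
  note l = der_M_linear[OF assms] smooth_on_linear_der[OF M_smooth assms]
  show "\<Gamma> x u (v + v') = \<Gamma> x u v + \<Gamma> x u v'" for v v'
  proof (rule levi_civita_eqI[OF assms])
    fix z
    have "2 * M x (\<Gamma> x u v + \<Gamma> x u v') z = 2 * M x (\<Gamma> x u v) z + 2 * M x (\<Gamma> x u v') z"
      by (simp add: M_arith[OF assms])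
    then show "2 * M x (\<Gamma> x u v + \<Gamma> x u v') z
      = der (\<lambda>y. M y (v + v') z) x u + der (\<lambda>y. M y u z) x (v + v') - der (\<lambda>y. M y u (v + v')) x z"
      unfolding levi_civita_koszul[OF assms]
      using linear_add[OF l(1), of z v v' u] linear_add[OF l(1), of u v v' z]
        linear_add[OF l(2), of u z v v'] der_M_sym[OF assms, of "v + v'" z]
        der_M_sym[OF assms, of v z] der_M_sym[OF assms, of v' z]
      by simp
  qed
  show "\<Gamma> x u (r *\<^sub>R v) = r *\<^sub>R \<Gamma> x u v" for r v
  proof (rule levi_civita_eqI[OF assms])
    fix z
    have "2 * M x (r *\<^sub>R \<Gamma> x u v) z = r * (2 * M x (\<Gamma> x u v) z)" by (simp add: M_arith[OF assms])
    then show "2 * M x (r *\<^sub>R \<Gamma> x u v) z = der (\<lambda>y. M y (r *\<^sub>R v) z) x u + der (\<lambda>y. M y u z) x (r *\<^sub>R v) - der (\<lambda>y. M y u (r *\<^sub>R v)) x z"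
      unfolding levi_civita_koszul[OF assms]
      using linear_scale[OF l(1), of z r v u] linear_scale[OF l(1), of u r v z]
        linear_scale[OF l(2), of u z r v] der_M_sym[OF assms, of "r *\<^sub>R v" z] der_M_sym[OF assms, of v z]
      by (simp add: algebra_simps)
  qed
qed

lemma levi_civita_linear_left:
  assumes "x \<in> \<Omega>" shows "linear (\<lambda>u. \<Gamma> x u v)"
  using levi_civita_linear[OF assms, of v] levi_civita_sym[OF assms, of v] by (metis (no_types, lifting) ext)

lemma levi_civita_arith:
  assumes "x \<in> \<Omega>"
  shows "\<Gamma> x (u + v) w = \<Gamma> x u w + \<Gamma> x v w" "\<Gamma> x w (u + v) = \<Gamma> x w u + \<Gamma> x w v"
    "\<Gamma> x (u - v) w = \<Gamma> x u w - \<Gamma> x v w" "\<Gamma> x w (u - v) = \<Gamma> x w u - \<Gamma> x w v"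
    "\<Gamma> x (- u) w = - \<Gamma> x u w" "\<Gamma> x w (- u) = - \<Gamma> x w u"
    "\<Gamma> x (r *\<^sub>R u) w = r *\<^sub>R \<Gamma> x u w" "\<Gamma> x w (r *\<^sub>R u) = r *\<^sub>R \<Gamma> x w u"
    "\<Gamma> x 0 w = 0" "\<Gamma> x w 0 = 0"
proof -
  note l = levi_civita_linear[OF assms, of w] and r = levi_civita_linear_left[OF assms, of w]
  show "\<Gamma> x (u + v) w = \<Gamma> x u w + \<Gamma> x v w" by (rule linear_add[OF r])
  show "\<Gamma> x w (u + v) = \<Gamma> x w u + \<Gamma> x w v" by (rule linear_add[OF l])
  show "\<Gamma> x (u - v) w = \<Gamma> x u w - \<Gamma> x v w" by (rule linear_diff[OF r])
  show "\<Gamma> x w (u - v) = \<Gamma> x w u - \<Gamma> x w v" by (rule linear_diff[OF l])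
  show "\<Gamma> x (- u) w = - \<Gamma> x u w" by (rule linear_neg[OF r])
  show "\<Gamma> x w (- u) = - \<Gamma> x w u" by (rule linear_neg[OF l])
  show "\<Gamma> x (r *\<^sub>R u) w = r *\<^sub>R \<Gamma> x u w" using linear_scale[OF r, of r u] by simp
  show "\<Gamma> x w (r *\<^sub>R u) = r *\<^sub>R \<Gamma> x w u" using linear_scale[OF l, of r u] by simp
  show "\<Gamma> x 0 w = 0" by (rule linear_0[OF r])
  show "\<Gamma> x w 0 = 0" by (rule linear_0[OF l])
qed

lemma levi_civita_smooth_on [smooth_intros]:
  assumes "open S" "smooth_on S p" "p ` S \<subseteq> \<Omega>" "smooth_on S f" "smooth_on S h"
  shows "smooth_on S (\<lambda>x. \<Gamma> (p x) (f x) (h x))"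
  by (rule smooth_on_bilinear_family[OF assms(1) levi_civita_smooth levi_civita_linear
        levi_civita_linear_left assms(2,3,4,5)])

lemma der_levi_civita:
  assumes "open S" "x \<in> S" "p ` S \<subseteq> \<Omega>" "smooth_on S p" "smooth_on S f" "smooth_on S h"
  shows "der (\<lambda>x. \<Gamma> (p x) (f x) (h x)) x v
    = der (\<lambda>y. \<Gamma> y (f x) (h x)) (p x) (der p x v) + \<Gamma> (p x) (der f x v) (h x) + \<Gamma> (p x) (f x) (der h x v)"
  by (rule der_bilinear_family[OF open_dom levi_civita_smooth levi_civita_linear
        levi_civita_linear_left assms])

text \<open>When the Koszul formulas for the two products are added, the derivatives in the
  directions \<open>u\<close> and \<open>v\<close> cancel and the derivative in the direction
  \<open>w\<close> is left twice.\<close>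

lemma metric_compatible:
  assumes "x \<in> \<Omega>"
  shows "der (\<lambda>y. M y u v) x w = M x (\<Gamma> x w u) v + M x u (\<Gamma> x w v)"
proof -
  have "2 * M x (\<Gamma> x w u) v + 2 * M x u (\<Gamma> x w v) = 2 * der (\<lambda>y. M y u v) x w"
    unfolding M_sym[OF assms, of u "\<Gamma> x w v"] levi_civita_koszul[OF assms]
    using der_M_sym[OF assms, of u v] der_M_sym[OF assms, of w v] der_M_sym[OF assms, of w u] by simp
  then show ?thesis by simp
qed

subsection \<open>Curvature\<close>

text \<open>The curvature R(a, b)u for vectors extended with constant components: the bracket of
  \<open>a\<close> and \<open>b\<close> vanishes, so only the two iterated derivatives
  remain.\<close>

definition Riem :: "'e \<Rightarrow> 'e \<Rightarrow> 'e \<Rightarrow> 'e \<Rightarrow> 'e"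
  where "Riem x a b u = der (\<lambda>y. \<Gamma> y b u) x a - der (\<lambda>y. \<Gamma> y a u) x b
    + \<Gamma> x a (\<Gamma> x b u) - \<Gamma> x b (\<Gamma> x a u)"

lemma Riem_skew: "Riem x a b u = - Riem x b a u"
  by (simp add: Riem_def)

lemma der_levi_civita_sym:
  assumes "x \<in> \<Omega>" shows "der (\<lambda>y. \<Gamma> y u v) x = der (\<lambda>y. \<Gamma> y v u) x"
  by (rule der_cong[OF open_dom assms]) (rule levi_civita_sym)

lemma Riem_minus_right:
  assumes x: "x \<in> \<Omega>" shows "Riem x a (- b) u = - Riem x a b u"
proof -
  have "der (\<lambda>y. \<Gamma> y (- b) u) x = der (\<lambda>y. - \<Gamma> y b u) x"
    by (rule der_cong[OF open_dom x]) (simp add: levi_civita_arith)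
  then show ?thesis
    using der_minus[OF smooth_on_differentiable[OF levi_civita_smooth x], of b u a]
      linear_neg[OF smooth_on_linear_der[OF levi_civita_smooth x], of a u b]
    by (simp add: Riem_def levi_civita_arith[OF x])
qed

lemma Riem_bianchi:
  assumes "x \<in> \<Omega>"
  shows "Riem x a b c + Riem x b c a + Riem x c a b = 0"
  unfolding Riem_def
  using der_levi_civita_sym[OF assms, of a b] der_levi_civita_sym[OF assms, of b c]
    der_levi_civita_sym[OF assms, of a c] levi_civita_sym[OF assms, of a b]
    levi_civita_sym[OF assms, of b c] levi_civita_sym[OF assms, of a c]
  by simp

text \<open>The second derivatives of the function M(u, v) commute. Metric compatibility, used
  twice, turns their difference into the curvature terms, while the products of two first-order
  terms are symmetric in the directions and drop out.\<close>

lemma Riem_metric_skew: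
  assumes x: "x \<in> \<Omega>"
  shows "M x (Riem x a b u) v = - M x u (Riem x a b v)"
proof -
  have D2: "der (\<lambda>y. der (\<lambda>z. M z u v) y a) x b
    = M x (\<Gamma> x b (\<Gamma> x a u)) v + M x (\<Gamma> x a u) (\<Gamma> x b v) + M x (der (\<lambda>y. \<Gamma> y a u) x b) v
    + (M x (\<Gamma> x b u) (\<Gamma> x a v) + M x u (\<Gamma> x b (\<Gamma> x a v)) + M x u (der (\<lambda>y. \<Gamma> y a v) x b))" for a b
  proof -
    have sm: "smooth_on \<Omega> (\<lambda>y. M y (\<Gamma> y a u) v)" "smooth_on \<Omega> (\<lambda>y. M y u (\<Gamma> y a v))"
      by (intro smooth_intros open_dom levi_civita_smooth; simp)+
    have "der (\<lambda>y. der (\<lambda>z. M z u v) y a) x b = der (\<lambda>y. M y (\<Gamma> y a u) v + M y u (\<Gamma> y a v)) x b"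
      by (rule arg_cong[where f="\<lambda>h. h b"], rule der_cong[OF open_dom x]) (rule metric_compatible)
    also have "\<dots> = der (\<lambda>y. M y (\<Gamma> y a u) v) x b + der (\<lambda>y. M y u (\<Gamma> y a v)) x b"
      by (rule der_add[OF sm[THEN smooth_on_differentiable, OF x]])
    also have "der (\<lambda>y. M y (\<Gamma> y a u) v) x b
        = M x (\<Gamma> x b (\<Gamma> x a u)) v + M x (\<Gamma> x a u) (\<Gamma> x b v) + M x (der (\<lambda>y. \<Gamma> y a u) x b) v"
      using der_M[OF open_dom x, of "\<lambda>x. x" "\<lambda>y. \<Gamma> y a u" "\<lambda>_. v" b]
      by (simp add: smooth_on_ident smooth_on_const levi_civita_smooth metric_compatible[OF x] M_arith[OF x])
    also have "der (\<lambda>y. M y u (\<Gamma> y a v)) x b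
        = M x (\<Gamma> x b u) (\<Gamma> x a v) + M x u (\<Gamma> x b (\<Gamma> x a v)) + M x u (der (\<lambda>y. \<Gamma> y a v) x b)"
      using der_M[OF open_dom x, of "\<lambda>x. x" "\<lambda>_. u" "\<lambda>y. \<Gamma> y a v" b]
      by (simp add: smooth_on_ident smooth_on_const levi_civita_smooth metric_compatible[OF x] M_arith[OF x])
    finally show ?thesis .
  qed
  have "der (\<lambda>y. der (\<lambda>z. M z u v) y a) x b = der (\<lambda>y. der (\<lambda>z. M z u v) y b) x a"
    by (rule der_der_commute[OF open_dom M_smooth x])
  then show ?thesis
    unfolding D2 Riem_def by (simp add: M_arith[OF x])
qed

text \<open>The classical octahedron argument: four instances of the Bianchi identity, one for each
  cyclic shift of the arguments, are combined with the two skew symmetries.\<close>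

lemma Riem_pair_sym:
  assumes x: "x \<in> \<Omega>"
  shows "M x (Riem x a b c) d = M x (Riem x c d a) b"
proof -
  define r where "r a b c d = M x (Riem x a b c) d" for a b c d
  have s12: "r a b c d = - r b a c d" for a b c d
    unfolding r_def by (subst Riem_skew) (simp add: M_arith[OF x])
  have s34: "r a b c d = - r a b d c" for a b c d
    unfolding r_def using Riem_metric_skew[OF x, of a b c d] M_sym[OF x] by simp
  have bi: "r a b c d + r b c a d + r c a b d = 0" for a b c d
    using arg_cong[OF Riem_bianchi[OF x, of a b c], of "\<lambda>w. M x w d"]
    by (simp add: r_def M_arith[OF x])
  \<comment> \<open>In the sum of the four identities eight terms cancel, and the other four give
    twice the difference of these two values. Renaming the letters yields the claim.\<close>
  have "r c a b d = r b d c a" for a b c d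
    using bi[of a b c d] bi[of b c d a] bi[of c d a b] bi[of d a b c]
      s34[of a b c d] s34[of b c a d] s34[of c d b a] s34[of d a c b]
      s12[of a c d b] s34[of c a d b] s12[of d b c a] s34[of b d a c]
    by linarith
  then show ?thesis by (simp add: r_def)
qed

end

subsection \<open>Pullback metrics\<close>

lemma coord_metric_subset:
  assumes "coord_metric \<Omega> M" "open P" "P \<subseteq> \<Omega>" shows "coord_metric P M"
proof -
  interpret coord_metric \<Omega> M by (rule assms(1))
  show ?thesis
    by (rule coord_metric.intro)
      (use assms(2,3) in \<open>auto intro: M_linear M_sym M_pos smooth_on_subset[OF M_smooth]\<close>)
qed

text \<open>Positivity survives because \<open>F\<close> is an immersion. The source may have
  smaller dimension, as for the inclusion of the unit tangent bundle.\<close>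

lemma pullback_coord_metric:
  fixes F :: "'f::euclidean_space \<Rightarrow> 'e::euclidean_space"
  assumes M: "coord_metric \<Omega> M" and P: "open P" and F: "smooth_on P F" "F ` P \<subseteq> \<Omega>"
    and inj: "\<And>y u. y \<in> P \<Longrightarrow> der F y u = 0 \<Longrightarrow> u = 0"
    and pull: "\<And>y u v. y \<in> P \<Longrightarrow> N y u v = M (F y) (der F y u) (der F y v)"
  shows "coord_metric P N"
proof (rule coord_metric.intro)
  interpret coord_metric \<Omega> M by (rule M)
  fix y u v assume y: "y \<in> P"
  have Fy: "F y \<in> \<Omega>" using F(2) y by auto
  note l = smooth_on_linear_der[OF F(1) y]
  show "linear (N y u)"
    by (rule linearI) (simp_all add: pull[OF y] linear_add[OF l] linear_scale[OF l] M_arith[OF Fy])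
  show "N y u v = N y v u" unfolding pull[OF y] by (rule M_sym[OF Fy])
  show "N y u u > 0" if "u \<noteq> 0"
    unfolding pull[OF y] by (rule M_pos[OF Fy]) (use inj[OF y] that in blast)
next
  interpret coord_metric \<Omega> M by (rule M)
  fix u v
  have "smooth_on P (\<lambda>y. M (F y) (der F y u) (der F y v))"
    by (intro M_smooth_on P F smooth_on_der)
  then show "smooth_on P (\<lambda>y. N y u v)" by (rule smooth_on_eqI[OF _ P pull])
qed (rule P)

text \<open>Differentiating the pulled-back coefficients adds six terms with second derivatives of
  \<open>F\<close> to the Koszul formula; four cancel by symmetry and two give the Hessian term.
  Only products with vectors \<open>der F y z\<close> are determined, so for an immersion this is
  the Gauss formula and for a coordinate change the transformation law.\<close>

lemma pullback_levi_civita: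
  fixes F :: "'f::euclidean_space \<Rightarrow> 'e::euclidean_space"
  assumes N: "coord_metric P N" and M: "coord_metric \<Omega> M"
    and F: "smooth_on P F" "F ` P \<subseteq> \<Omega>"
    and pull: "\<And>y u v. y \<in> P \<Longrightarrow> N y u v = M (F y) (der F y u) (der F y v)"
    and y: "y \<in> P"
  shows "N y (levi_civita N y u v) z
    = M (F y) (der (\<lambda>y. der F y v) y u + levi_civita M (F y) (der F y u) (der F y v)) (der F y z)"
proof -
  interpret N: coord_metric P N by (rule N)
  interpret M: coord_metric \<Omega> M by (rule M)
  have Fy: "F y \<in> \<Omega>" using F(2) y by auto
  let ?H = "\<lambda>u v. der (\<lambda>y. der F y v) y u"
  have H: "?H u v = ?H v u" for u v
    by (rule der_der_commute[OF N.open_dom F(1) y])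
  have D: "der (\<lambda>y. N y v z) y u = der (\<lambda>x. M x (der F y v) (der F y z)) (F y) (der F y u)
      + M (F y) (?H u v) (der F y z) + M (F y) (?H u z) (der F y v)" for u v z
  proof -
    have "der (\<lambda>y. N y v z) y = der (\<lambda>y. M (F y) (der F y v) (der F y z)) y"
      by (rule der_cong[OF N.open_dom y pull])
    then show ?thesis
      using M.der_M[OF N.open_dom y F(2,1) smooth_on_der[OF F(1)] smooth_on_der[OF F(1)], of v z u]
      by (simp add: M.M_sym[OF Fy, of _ "der F y v"])
  qed
  have "2 * N y (levi_civita N y u v) z = 2 * M (F y) (levi_civita M (F y) (der F y u) (der F y v)) (der F y z)
      + 2 * M (F y) (?H u v) (der F y z)"
    unfolding N.levi_civita_koszul[OF y] M.levi_civita_koszul[OF Fy] D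
    using H[of u v] H[of u z] H[of v z] by simp
  then show ?thesis by (simp add: M.M_arith[OF Fy])
qed

lemma smooth_on_der_apply:
  fixes F :: "'f::euclidean_space \<Rightarrow> 'e::euclidean_space"
  assumes "smooth_on P F" "open S" "S \<subseteq> P" "smooth_on S Y"
  shows "smooth_on S (\<lambda>y. der F y (Y y))"
  by (rule smooth_on_linear_family[where L="der F", OF assms(2) smooth_on_der[OF assms(1)]
        smooth_on_linear_der[OF assms(1)] smooth_on_ident _ assms(4)])
    (use assms in auto)

lemma der_der_apply:
  fixes F :: "'f::euclidean_space \<Rightarrow> 'e::euclidean_space"
  assumes "open P" "smooth_on P F" "open S" "S \<subseteq> P" "y \<in> S" "smooth_on S Y"
  shows "der (\<lambda>y. der F y (Y y)) y X = der (\<lambda>z. der F z (Y y)) y X + der F y (der Y y X)"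
proof -
  have "der (\<lambda>y. der F y (Y y)) y X = der (\<lambda>z. der F z (Y y)) y (der (\<lambda>y. y) y X) + der F y (der Y y X)"
    by (rule der_linear_family(2)[where L="der F", OF assms(1) _ _ assms(3,5)])
      (use assms smooth_on_differentiable[OF smooth_on_der[OF assms(2)]] smooth_on_differentiable[OF assms(6)]
        smooth_on_linear_der[OF assms(2)] in auto)
  then show "der (\<lambda>y. der F y (Y y)) y X = der (\<lambda>z. der F z (Y y)) y X + der F y (der Y y X)" by simp
qed

lemma pullback_covariant_derivative:
  fixes F :: "'f::euclidean_space \<Rightarrow> 'e::euclidean_space"
  assumes N: "coord_metric P N" and M: "coord_metric \<Omega> M"
    and F: "smooth_on P F" "F ` P \<subseteq> \<Omega>"
    and pull: "\<And>y u v. y \<in> P \<Longrightarrow> N y u v = M (F y) (der F y u) (der F y v)"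
    and S: "open S" "S \<subseteq> P" "y \<in> S" "smooth_on S Y"
  shows "N y (der Y y X + levi_civita N y X (Y y)) z
    = M (F y) (der (\<lambda>y. der F y (Y y)) y X + levi_civita M (F y) (der F y X) (der F y (Y y))) (der F y z)"
proof -
  interpret N: coord_metric P N by (rule N)
  interpret M: coord_metric \<Omega> M by (rule M)
  have y: "y \<in> P" and Fy: "F y \<in> \<Omega>" using F(2) S by auto
  show ?thesis
    using pullback_levi_civita[OF N M F pull y, of X "Y y" z] pull[OF y, of "der Y y X" z]
      der_der_apply[OF N.open_dom F(1) S, of X]
    by (simp add: N.M_arith[OF y] M.M_arith[OF Fy])
qed

section \<open>The Sasaki metric in coordinates\<close>

locale sasaki_coord = coord_metric \<Omega> M + S: coord_metric "\<Omega> \<times> UNIV" M2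
  for \<Omega> :: "'e::euclidean_space set" and M
    and M2 :: "'e \<times> 'e \<Rightarrow> 'e \<times> 'e \<Rightarrow> 'e \<times> 'e \<Rightarrow> real" +
  assumes M2_eq: "x \<in> \<Omega> \<Longrightarrow> M2 (x, u) (a, b) (a', b')
    = M x a a' + M x (b + levi_civita M x a u) (b' + levi_civita M x a' u)"
begin

text \<open>The map K; its kernel consists of the horizontal vectors.\<close>

definition conn :: "'e \<Rightarrow> 'e \<Rightarrow> 'e \<times> 'e \<Rightarrow> 'e"
  where "conn x u w = snd w + \<Gamma> x (fst w) u"

lemma M2_conn: "x \<in> \<Omega> \<Longrightarrow> M2 (x, u) w w' = M x (fst w) (fst w') + M x (conn x u w) (conn x u w')"
  using M2_eq[of x u "fst w" "snd w" "fst w'" "snd w'"] by (simp add: conn_def)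

lemma conn_arith:
  assumes "x \<in> \<Omega>"
  shows "conn x u (w + w') = conn x u w + conn x u w'" "conn x u (w - w') = conn x u w - conn x u w'"
    "conn x u (r *\<^sub>R w) = r *\<^sub>R conn x u w" "conn x u 0 = 0"
  by (simp_all add: conn_def levi_civita_arith[OF assms] scaleR_add_right)

text \<open>\<open>mixed x u w w'\<close> is the covariant derivative along \<open>w\<close> of \<open>conn _ _ w'\<close>, for constant \<open>w'\<close>.\<close>

definition mixed :: "'e \<Rightarrow> 'e \<Rightarrow> 'e \<times> 'e \<Rightarrow> 'e \<times> 'e \<Rightarrow> 'e"
  where "mixed x u w w' = \<Gamma> x (fst w) (conn x u w') + der (\<lambda>y. \<Gamma> y (fst w') u) x (fst w) + \<Gamma> x (fst w') (snd w)"

text \<open>The covariant derivatives of \<open>conn\<close> in the two orders differ by the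
  curvature. This is where the curvature of M enters the Sasaki connection.\<close>

lemma mixed_diff:
  "x \<in> \<Omega> \<Longrightarrow> mixed x u w w' = mixed x u w' w + Riem x (fst w) (fst w') u"
  by (simp add: mixed_def conn_def Riem_def levi_civita_arith)

lemma der_M2:
  assumes x: "x \<in> \<Omega>"
  shows "der (\<lambda>Q. M2 Q w' w'') (x, u) w
    = M x (\<Gamma> x (fst w) (fst w')) (fst w'') + M x (fst w') (\<Gamma> x (fst w) (fst w''))
    + M x (mixed x u w w') (conn x u w'') + M x (conn x u w') (mixed x u w w'')"
proof -
  let ?P = "\<Omega> \<times> (UNIV :: 'e set)"
  \<comment> \<open>\<open>k v\<close> is \<open>conn\<close> of the constant vector
    \<open>v\<close>, read as a function of the point of TM; its derivative together with a \<Gamma>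
    term is \<open>mixed\<close>.\<close>
  define k where "k v Q = snd v + \<Gamma> (fst Q) (fst v) (snd Q)" for v Q :: "'e \<times> 'e"
  have P: "(x, u) \<in> ?P" "fst ` ?P \<subseteq> \<Omega>" using x by auto
  note f = smooth_on_projections[OF S.open_dom]
  note df = der_projections
  have gs: "smooth_on ?P (\<lambda>Q. \<Gamma> (fst Q) (fst v) (snd Q))" for v :: "'e \<times> 'e"
    by (rule levi_civita_smooth_on[OF S.open_dom f(1) P(2) smooth_on_const f(2)])
  have k: "smooth_on ?P (k v)" for v
    unfolding k_def by (rule smooth_on_add[OF S.open_dom smooth_on_const gs])
  have dk: "der (k v) (x, u) w = der (\<lambda>y. \<Gamma> y (fst v) u) x (fst w) + \<Gamma> x (fst v) (snd w)" for v
  proof -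
    have "der (k v) (x, u) w = der (\<lambda>Q. snd v) (x, u) w + der (\<lambda>Q. \<Gamma> (fst Q) (fst v) (snd Q)) (x, u) w"
      unfolding k_def
      by (rule der_add[OF smooth_on_differentiable[OF smooth_on_const P(1)] smooth_on_differentiable[OF gs P(1)]])
    then show ?thesis
      using der_levi_civita[OF S.open_dom P f(1) smooth_on_const f(2), of "fst v" w] x
      by (simp add: df levi_civita_arith)
  qed
  have eq: "M2 Q w' w'' = M (fst Q) (fst w') (fst w'') + M (fst Q) (k w' Q) (k w'' Q)" if "Q \<in> ?P" for Q
    using that M2_conn[of "fst Q" "snd Q" w' w''] by (auto simp: k_def conn_def)
  have s1: "smooth_on ?P (\<lambda>Q. M (fst Q) (fst w') (fst w''))"
    by (rule M_smooth_on[OF S.open_dom f(1) P(2) smooth_on_const smooth_on_const])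
  have s2: "smooth_on ?P (\<lambda>Q. M (fst Q) (k w' Q) (k w'' Q))"
    by (rule M_smooth_on[OF S.open_dom f(1) P(2) k k])
  have "der (\<lambda>Q. M2 Q w' w'') (x, u)
      = der (\<lambda>Q. M (fst Q) (fst w') (fst w'') + M (fst Q) (k w' Q) (k w'' Q)) (x, u)"
    by (rule der_cong[OF S.open_dom P(1) eq])
  then have "der (\<lambda>Q. M2 Q w' w'') (x, u) w
      = der (\<lambda>Q. M (fst Q) (fst w') (fst w'')) (x, u) w + der (\<lambda>Q. M (fst Q) (k w' Q) (k w'' Q)) (x, u) w"
    using der_add[OF smooth_on_differentiable[OF s1 P(1)] smooth_on_differentiable[OF s2 P(1)]] by simp
  also have "der (\<lambda>Q. M (fst Q) (fst w') (fst w'')) (x, u) w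
      = M x (\<Gamma> x (fst w) (fst w')) (fst w'') + M x (fst w') (\<Gamma> x (fst w) (fst w''))"
    using der_M[OF S.open_dom P f(1) smooth_on_const smooth_on_const, of "fst w'" "fst w''" w] x
    by (simp add: df metric_compatible M_arith)
  also have "der (\<lambda>Q. M (fst Q) (k w' Q) (k w'' Q)) (x, u) w
      = M x (mixed x u w w') (conn x u w'') + M x (conn x u w') (mixed x u w w'')"
    using der_M[OF S.open_dom P f(1) k k, of w' w'' w] x
    by (simp add: df metric_compatible M_arith dk mixed_def k_def conn_def levi_civita_arith)
  finally show ?thesis by simp
qed

lemma sasaki_levi_civita:
  assumes x: "x \<in> \<Omega>"
  shows "fst (S.\<Gamma> (x, u) w w') = \<Gamma> x (fst w) (fst w')
      + (1/2) *\<^sub>R (Riem x u (conn x u w') (fst w) + Riem x u (conn x u w) (fst w'))" (is "_ = ?a")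
    and "conn x u (S.\<Gamma> (x, u) w w') = (1/2) *\<^sub>R (mixed x u w w' + mixed x u w' w)" (is "_ = ?k")
proof -
  \<comment> \<open>The vector is assembled from its horizontal part \<open>?a\<close> and its
    vertical part \<open>?k\<close>; the correction makes \<open>conn\<close> of it equal to
    \<open>?k\<close>.\<close>
  define W where "W = (?a, ?k - \<Gamma> x ?a u)"
  have W: "fst W = ?a" "conn x u W = ?k" by (simp_all add: W_def conn_def)
  have "S.\<Gamma> (x, u) w w' = W"
  proof (rule S.levi_civita_eqI)
    show "(x, u) \<in> \<Omega> \<times> UNIV" using x by simp
    fix z
    have "2 * M2 (x, u) W z = 2 * M x ?a (fst z) + 2 * M x ?k (conn x u z)"
      by (simp add: M2_conn[OF x] W)
    also have "\<dots> = 2 * M x (\<Gamma> x (fst w) (fst w')) (fst z)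
        + M x (Riem x u (conn x u w') (fst w)) (fst z) + M x (Riem x u (conn x u w) (fst w')) (fst z)
        + M x (mixed x u w w') (conn x u z) + M x (mixed x u w' w) (conn x u z)"
      by (simp add: M_arith[OF x] algebra_simps)
    \<comment> \<open>The candidate has a curvature multiplied with \<open>fst z\<close>, whereas
      the Koszul formula yields curvatures with \<open>fst z\<close> in the second slot. Pair
      symmetry converts one into the other.\<close>
    also have "M x (Riem x u (conn x u w') (fst w)) (fst z) = M x (conn x u w') (Riem x (fst w) (fst z) u)"
      using Riem_pair_sym[OF x, of u "conn x u w'" "fst w" "fst z"] M_sym[OF x] by simp
    also have "M x (Riem x u (conn x u w) (fst w')) (fst z) = M x (conn x u w) (Riem x (fst w') (fst z) u)"
      using Riem_pair_sym[OF x, of u "conn x u w" "fst w'" "fst z"] M_sym[OF x] by simp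
    finally have L: "2 * M2 (x, u) W z = 2 * M x (\<Gamma> x (fst w) (fst w')) (fst z)
        + M x (conn x u w') (Riem x (fst w) (fst z) u) + M x (conn x u w) (Riem x (fst w') (fst z) u)
        + M x (mixed x u w w') (conn x u z) + M x (mixed x u w' w) (conn x u z)" .
    show "2 * M2 (x, u) W z = der (\<lambda>Q. M2 Q w' z) (x, u) w + der (\<lambda>Q. M2 Q w z) (x, u) w'
        - der (\<lambda>Q. M2 Q w w') (x, u) z"
      unfolding L der_M2[OF x] mixed_diff[OF x, of u w z] mixed_diff[OF x, of u w' z]
      by (simp add: M_arith[OF x] levi_civita_sym[OF x, of "fst w'" "fst w"]
          levi_civita_sym[OF x, of "fst z" "fst w"] levi_civita_sym[OF x, of "fst z" "fst w'"]
          M_sym[OF x, of "mixed x u z w"] M_sym[OF x, of "mixed x u z w'"]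
          M_sym[OF x, of "\<Gamma> x (fst w) (fst z)"])
  qed
  then show "fst (S.\<Gamma> (x, u) w w') = ?a" "conn x u (S.\<Gamma> (x, u) w w') = ?k" using W by auto
qed

end

section \<open>Unit vector fields in coordinates\<close>

text \<open>\<open>cov1 x a\<close> is \<open>\<nabla>\<^sub>a \<xi> = - A\<^sub>\<xi> a\<close>, and \<open>cov2 x a b\<close> is \<open>\<nabla>\<^sub>a \<nabla>\<^sub>b \<xi>\<close> for \<open>b\<close> with constant
  components; \<open>tg_defect\<close> is the left-hand side of the equation to be proved.\<close>

locale unit_field_coord = coord_metric \<Omega> M
  for \<Omega> :: "'e::euclidean_space set" and M +
  fixes W :: "'e set" and \<xi> :: "'e \<Rightarrow> 'e"
  assumes open_W: "open W" and W_subset: "W \<subseteq> \<Omega>" and \<xi>_smooth: "smooth_on W \<xi>"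
    and \<xi>_unit: "x \<in> W \<Longrightarrow> M x (\<xi> x) (\<xi> x) = 1"
begin

definition cov :: "('e \<Rightarrow> 'e) \<Rightarrow> ('e \<Rightarrow> 'e) \<Rightarrow> 'e \<Rightarrow> 'e"
  where "cov X Y = (\<lambda>x. der Y x (X x) + \<Gamma> x (X x) (Y x))"

definition cov1 :: "'e \<Rightarrow> 'e \<Rightarrow> 'e"
  where "cov1 x a = der \<xi> x a + \<Gamma> x a (\<xi> x)"

definition cov2 :: "'e \<Rightarrow> 'e \<Rightarrow> 'e \<Rightarrow> 'e"
  where "cov2 x a b = der (\<lambda>y. cov1 y b) x a + \<Gamma> x a (cov1 x b)"

text \<open>\<open>Hess\<close> for arguments with constant components, where the derivative of
  \<open>b\<close> along \<open>a\<close> is \<open>\<Gamma> x a b\<close>. The signs here and in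
  \<open>hm\<close> come from A = - \<open>cov1\<close>.\<close>

definition hess :: "'e \<Rightarrow> 'e \<Rightarrow> 'e \<Rightarrow> 'e"
  where "hess x a b = - (1/2) *\<^sub>R (cov2 x a b + cov2 x b a) + cov1 x (\<Gamma> x a b)"

definition hm :: "'e \<Rightarrow> 'e \<Rightarrow> 'e \<Rightarrow> 'e"
  where "hm x a b = - (1/2) *\<^sub>R (Riem x (\<xi> x) (cov1 x a) b + Riem x (\<xi> x) (cov1 x b) a)"

definition tg_defect :: "'e \<Rightarrow> 'e \<Rightarrow> 'e \<Rightarrow> 'e"
  where "tg_defect x a b = hess x a b - cov1 x (hm x a b) - M x (cov1 x a) (cov1 x b) *\<^sub>R \<xi> x"

lemma in_dom: "x \<in> W \<Longrightarrow> x \<in> \<Omega>" using W_subset by auto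

lemma smooth_cov1: "smooth_on S Y \<Longrightarrow> open S \<Longrightarrow> S \<subseteq> W \<Longrightarrow> smooth_on S (\<lambda>x. cov1 x (Y x))"
  unfolding cov1_def using W_subset smooth_on_subset[OF \<xi>_smooth, of S]
  by (intro smooth_on_add levi_civita_smooth_on smooth_on_ident
      smooth_on_linear_family[where L="der \<xi>" and p="\<lambda>x. x", OF _ smooth_on_der[OF \<xi>_smooth] smooth_on_linear_der[OF \<xi>_smooth]])
    auto

lemma linear_cov1: "x \<in> W \<Longrightarrow> linear (cov1 x)"
  unfolding cov1_def
  by (intro linear_compose_add smooth_on_linear_der[OF \<xi>_smooth] levi_civita_linear_left in_dom)

lemma cov1_arith:
  assumes "x \<in> W"
  shows "cov1 x (a + b) = cov1 x a + cov1 x b" "cov1 x (a - b) = cov1 x a - cov1 x b"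
    "cov1 x (- a) = - cov1 x a" "cov1 x (r *\<^sub>R a) = r *\<^sub>R cov1 x a" "cov1 x 0 = 0"
  using linear_cov1[OF assms]
  by (simp_all add: linear_add[of "cov1 x"] linear_diff[of "cov1 x"] linear_neg[of "cov1 x"]
      linear_scale[of "cov1 x"] linear_0[of "cov1 x"])

lemma der_cov1:
  assumes "x \<in> S" "open S" "S \<subseteq> W" "smooth_on S Y"
  shows "der (\<lambda>x. cov1 x (Y x)) x a = der (\<lambda>y. cov1 y (Y x)) x a + cov1 x (der Y x a)"
proof -
  have "(\<lambda>y. cov1 y v) differentiable at y" if "y \<in> W" for v y
    by (rule smooth_on_differentiable[OF smooth_cov1[OF smooth_on_const open_W order_refl] that])
  then have "der (\<lambda>x. cov1 x (Y x)) x a = der (\<lambda>y. cov1 y (Y x)) x (der (\<lambda>x. x) x a) + cov1 x (der Y x a)"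
    by (intro der_linear_family(2)[where L=cov1 and p="\<lambda>x. x", OF open_W _ linear_cov1 assms(2,1)])
      (use assms smooth_on_differentiable[OF assms(4,1)] in auto)
  then show ?thesis by simp
qed

lemma cov_\<xi>: "cov X \<xi> = (\<lambda>x. cov1 x (X x))"
  by (simp add: cov_def cov1_def)

text \<open>The derivative of \<open>Y\<close> enters both terms through \<open>cov1\<close> and
  cancels, so the expression depends only on the values of \<open>X\<close> and \<open>Y\<close> at
  \<open>x\<close>.\<close>

lemma cov_cov_\<xi>:
  assumes "x \<in> S" "open S" "S \<subseteq> W" "smooth_on S X" "smooth_on S Y"
  shows "cov X (cov Y \<xi>) x - cov (cov X Y) \<xi> x = cov2 x (X x) (Y x) - cov1 x (\<Gamma> x (X x) (Y x))"
  unfolding cov_\<xi> unfolding cov_def der_cov1[OF assms(1-3,5)] using assms(1,3)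
  by (auto simp: cov2_def cov1_arith)

text \<open>Tensoriality of the curvature: the bracket term removes the derivatives of
  \<open>X\<close> and \<open>Y\<close>, and the first and second derivatives of \<open>Z\<close>
  cancel by symmetry.\<close>

lemma cov_curvature:
  assumes "x \<in> S" "open S" "S \<subseteq> \<Omega>" "smooth_on S X" "smooth_on S Y" "smooth_on S Z"
  shows "cov X (cov Y Z) x - cov Y (cov X Z) x - cov (\<lambda>x. der Y x (X x) - der X x (Y x)) Z x
    = Riem x (X x) (Y x) (Z x)"
proof -
  have x: "x \<in> \<Omega>" using assms by auto
  have sub: "(\<lambda>x. x) ` S \<subseteq> \<Omega>" using assms(3) by auto
  have D: "der (cov Y Z) x a = der (\<lambda>z. der Z z (Y x)) x a + der Z x (der Y x a)
      + (der (\<lambda>y. \<Gamma> y (Y x) (Z x)) x a + \<Gamma> x (der Y x a) (Z x) + \<Gamma> x (Y x) (der Z x a))"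
    if "smooth_on S Y" for Y a
  proof -
    note d = der_der_apply[OF assms(2,6,2) order_refl assms(1) that]
      smooth_on_der_apply[OF assms(6,2) order_refl that]
    have "smooth_on S (\<lambda>x. \<Gamma> x (Y x) (Z x))"
      by (rule levi_civita_smooth_on[OF assms(2) smooth_on_ident sub that assms(6)])
    then have "der (cov Y Z) x a = der (\<lambda>y. der Z y (Y y)) x a + der (\<lambda>x. \<Gamma> x (Y x) (Z x)) x a"
      unfolding cov_def
      by (intro der_add smooth_on_differentiable[OF d(2) assms(1)] smooth_on_differentiable[OF _ assms(1)])
    then show ?thesis
      using d(1)[of a] der_levi_civita[OF assms(2,1) sub smooth_on_ident that assms(6), of a] by simp
  qed
  have sym: "der (\<lambda>z. der Z z (Y x)) x (X x) = der (\<lambda>z. der Z z (X x)) x (Y x)"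
    by (rule der_der_commute[OF assms(2,6,1)])
  have lin: "linear (der Z x)" by (rule smooth_on_linear_der[OF assms(6,1)])
  have "cov X (cov Y Z) x - cov Y (cov X Z) x - cov (\<lambda>x. der Y x (X x) - der X x (Y x)) Z x
    = der (cov Y Z) x (X x) + \<Gamma> x (X x) (cov Y Z x) - (der (cov X Z) x (Y x) + \<Gamma> x (Y x) (cov X Z x))
      - (der Z x (der Y x (X x) - der X x (Y x)) + \<Gamma> x (der Y x (X x) - der X x (Y x)) (Z x))"
    by (simp add: cov_def)
  also have "\<dots> = Riem x (X x) (Y x) (Z x)"
    unfolding D[OF assms(4)] D[OF assms(5)]
    by (simp add: cov_def Riem_def levi_civita_arith[OF x] linear_diff[OF lin] sym)
  finally show ?thesis .
qed

lemma cov1_orthogonal: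
  assumes "x \<in> W" shows "M x (cov1 x a) (\<xi> x) = 0"
proof -
  have sub: "(\<lambda>x. x) ` W \<subseteq> \<Omega>" using W_subset by auto
  have "der (\<lambda>x. M x (\<xi> x) (\<xi> x)) x = der (\<lambda>_. 1) x"
    by (rule der_cong[OF open_W assms \<xi>_unit])
  then have "der (\<lambda>x. M x (\<xi> x) (\<xi> x)) x a = 0" by simp
  then have "2 * M x (cov1 x a) (\<xi> x) = 0"
    using der_M[OF open_W assms sub smooth_on_ident \<xi>_smooth \<xi>_smooth, of a]
      in_dom[OF assms] M_sym[OF in_dom[OF assms], of "\<xi> x"]
    by (simp add: metric_compatible M_arith cov1_def)
  then show ?thesis by simp
qed

lemma cov2_orthogonal:
  assumes "x \<in> W" shows "M x (cov2 x a b) (\<xi> x) = - M x (cov1 x b) (cov1 x a)"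
proof -
  have sub: "(\<lambda>x. x) ` W \<subseteq> \<Omega>" using W_subset by auto
  have "der (\<lambda>x. M x (cov1 x b) (\<xi> x)) x = der (\<lambda>_. 0) x"
    by (rule der_cong[OF open_W assms cov1_orthogonal])
  then have "der (\<lambda>x. M x (cov1 x b) (\<xi> x)) x a = 0" by simp
  then show ?thesis
    using der_M[OF open_W assms sub smooth_on_ident smooth_cov1[OF smooth_on_const open_W order_refl] \<xi>_smooth, of b a]
      in_dom[OF assms]
    by (simp add: metric_compatible M_arith cov1_def[of x a] cov2_def)
qed

end

section \<open>A unit vector field as a section of the tangent bundle, in coordinates\<close>

locale sasaki_section = sasaki_coord \<Omega> M M2 + unit_field_coord \<Omega> M W \<xi>
  for \<Omega> :: "'e::euclidean_space set" and M M2 W \<xi>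
begin

definition graph :: "'e \<Rightarrow> 'e \<times> 'e"
  where "graph x = (x, \<xi> x)"

lemma graph_smooth: "smooth_on W graph"
  unfolding graph_def by (intro smooth_intros open_W \<xi>_smooth)

lemma der_graph: "x \<in> W \<Longrightarrow> der graph x a = (a, der \<xi> x a)"
  unfolding graph_def
  using der_Pair[of "\<lambda>x. x" x \<xi> a] smooth_on_differentiable[OF \<xi>_smooth] by simp

lemma conn_graph: "x \<in> W \<Longrightarrow> conn x (\<xi> x) (der graph x a) = cov1 x a"
  by (simp add: conn_def der_graph cov1_def)

definition second :: "'e \<Rightarrow> 'e \<Rightarrow> 'e \<Rightarrow> 'e \<times> 'e"
  where "second x a b = der (\<lambda>y. der graph y b) x a + S.\<Gamma> (graph x) (der graph x a) (der graph x b)"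

lemma der_der_graph:
  assumes "x \<in> W" shows "der (\<lambda>y. der graph y b) x a = (0, der (\<lambda>y. der \<xi> y b) x a)"
proof -
  have "der (\<lambda>y. der graph y b) x = der (\<lambda>y. (b, der \<xi> y b)) x"
    by (rule der_cong[OF open_W assms der_graph])
  then show ?thesis
    using der_Pair[of "\<lambda>_. b" x "\<lambda>y. der \<xi> y b" a] smooth_on_differentiable[OF smooth_on_der[OF \<xi>_smooth] assms]
    by simp
qed

lemma fst_second:
  assumes "x \<in> W" shows "fst (second x a b) = \<Gamma> x a b - hm x a b"
  unfolding second_def graph_def[of x] fst_add sasaki_levi_civita(1)[OF in_dom[OF assms]]
  using conn_graph[OF assms, unfolded der_graph[OF assms]]
  by (simp add: der_der_graph[OF assms] hm_def der_graph[OF assms] algebra_simps)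

text \<open>\<open>cov2\<close> is the second derivative of \<xi> plus \<open>mixed\<close> along
  the section. The Sasaki connection contributes the symmetrized \<open>mixed\<close>, and the
  second derivative of \<xi> is symmetric already, so the two combine to the symmetrized
  \<open>cov2\<close>.\<close>

lemma conn_second:
  assumes x: "x \<in> W" shows "conn x (\<xi> x) (second x a b) = (1/2) *\<^sub>R (cov2 x a b + cov2 x b a)"
proof -
  note xd = in_dom[OF x]
  have sub: "(\<lambda>x. x) ` W \<subseteq> \<Omega>" using W_subset by auto
  have c2: "cov2 x a b = der (\<lambda>y. der \<xi> y b) x a + mixed x (\<xi> x) (der graph x a) (der graph x b)" for a b
  proof -
    have "smooth_on W (\<lambda>y. \<Gamma> y b (\<xi> y))"
      by (rule levi_civita_smooth_on[OF open_W smooth_on_ident sub smooth_on_const \<xi>_smooth])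
    then have "der (\<lambda>y. cov1 y b) x a = der (\<lambda>y. der \<xi> y b) x a + der (\<lambda>y. \<Gamma> y b (\<xi> y)) x a"
      unfolding cov1_def
      by (intro der_add smooth_on_differentiable[OF smooth_on_der[OF \<xi>_smooth] x] smooth_on_differentiable[OF _ x])
    also have "der (\<lambda>y. \<Gamma> y b (\<xi> y)) x a = der (\<lambda>y. \<Gamma> y b (\<xi> x)) x a + \<Gamma> x b (der \<xi> x a)"
      using der_levi_civita[OF open_W x sub smooth_on_ident smooth_on_const \<xi>_smooth, of b a] xd
      by (simp add: levi_civita_arith)
    finally show ?thesis
      unfolding cov2_def mixed_def conn_graph[OF x] by (simp add: der_graph[OF x])
  qed
  have "conn x (\<xi> x) (second x a b) = der (\<lambda>y. der \<xi> y b) x a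
      + (1/2) *\<^sub>R (mixed x (\<xi> x) (der graph x a) (der graph x b) + mixed x (\<xi> x) (der graph x b) (der graph x a))"
    unfolding second_def graph_def[of x] conn_arith(1)[OF xd] sasaki_levi_civita(2)[OF xd]
    using conn_def[of x "\<xi> x" "(0, der (\<lambda>y. der \<xi> y b) x a)"]
    by (simp add: der_der_graph[OF x] levi_civita_arith[OF xd])
  also have "\<dots> = (1/2) *\<^sub>R (cov2 x a b + cov2 x b a)"
    unfolding c2 der_der_commute[OF open_W \<xi>_smooth x, of b a]
    by (simp add: scaleR_add_right scaleR_half_double add_ac flip: scaleR_add_left)
  finally show ?thesis .
qed

lemma tangent_part_iff:
  assumes x: "x \<in> W"
  shows "(\<exists>v. second x a b - M x (conn x (\<xi> x) (second x a b)) (\<xi> x) *\<^sub>R (0, \<xi> x) = der graph x v)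
    \<longleftrightarrow> tg_defect x a b = 0"
proof -
  note xd = in_dom[OF x]
  let ?l = "M x (conn x (\<xi> x) (second x a b)) (\<xi> x)"
  have l: "?l = - M x (cov1 x a) (cov1 x b)"
    unfolding conn_second[OF x]
    by (simp add: M_arith[OF xd] cov2_orthogonal[OF x] M_sym[OF xd, of "cov1 x b"])
  \<comment> \<open>The normal is vertical, and a vector tangent to the section is determined by its
    first component; so the only candidate for \<open>v\<close> is the first component of
    \<open>second\<close>.\<close>
  have "(\<exists>v. second x a b - ?l *\<^sub>R (0, \<xi> x) = der graph x v)
      \<longleftrightarrow> second x a b - ?l *\<^sub>R (0, \<xi> x) = der graph x (fst (second x a b))"
    by (auto simp: der_graph[OF x] prod_eq_iff)
  also have "\<dots> \<longleftrightarrow> snd (second x a b) - ?l *\<^sub>R \<xi> x = der \<xi> x (fst (second x a b))"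
    by (simp add: der_graph[OF x] prod_eq_iff)
  \<comment> \<open>Adding \<open>\<Gamma> x (fst (second x a b)) (\<xi> x)\<close> to both sides
    replaces the coordinate expressions by covariant ones.\<close>
  also have "\<dots> \<longleftrightarrow> conn x (\<xi> x) (second x a b) - ?l *\<^sub>R \<xi> x = cov1 x (fst (second x a b))"
    by (auto simp: conn_def cov1_def algebra_simps)
  also have "\<dots> \<longleftrightarrow> tg_defect x a b = 0"
    unfolding l unfolding conn_second[OF x] fst_second[OF x] tg_defect_def hess_def
    by (auto simp: cov1_arith[OF x] algebra_simps)
  finally show ?thesis .
qed

end

section \<open>Atlases and submanifolds\<close>

text \<open>The conditions on charts are isolated so that one theory serves M, its tangent bundle
  and the atlases of submanifolds.\<close>

locale smooth_atlas =
  fixes A :: "('a, 'e::euclidean_space) chart set"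
  assumes chart_inj: "c \<in> A \<Longrightarrow> inj_on (snd c) (fst c)"
    and chart_open: "c \<in> A \<Longrightarrow> open (snd c ` fst c)"
    and overlap_open: "c \<in> A \<Longrightarrow> d \<in> A \<Longrightarrow> open (snd c ` (fst c \<inter> fst d))"
    and transition_smooth: "c \<in> A \<Longrightarrow> d \<in> A \<Longrightarrow> smooth_on (snd c ` (fst c \<inter> fst d)) (transition c d)"
begin

lemma chart_inv_chart [simp]: "c \<in> A \<Longrightarrow> p \<in> fst c \<Longrightarrow> chart_inv c (snd c p) = p"
  by (simp add: chart_inv_def inv_into_f_f chart_inj)

lemma chart_mem_image_iff: "c \<in> A \<Longrightarrow> p \<in> fst c \<Longrightarrow> S \<subseteq> fst c \<Longrightarrow> snd c p \<in> snd c ` S \<longleftrightarrow> p \<in> S"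
  using inj_on_image_mem_iff chart_inj by metis

lemma openin_iff: "openin (atlas_topology A) S \<longleftrightarrow> S \<subseteq> atlas_carrier A \<and> (\<forall>c\<in>A. open (snd c ` (fst c \<inter> S)))"
  by (rule openin_atlas_topology) (rule chart_inj)

lemma chart_openin: "c \<in> A \<Longrightarrow> openin (atlas_topology A) (fst c)"
  unfolding openin_iff using overlap_open by (auto simp: atlas_carrier_def)

lemma open_image: "c \<in> A \<Longrightarrow> openin (atlas_topology A) S \<Longrightarrow> open (snd c ` (fst c \<inter> S))"
  by (simp add: openin_iff)

lemma transition_chart [simp]: "c \<in> A \<Longrightarrow> p \<in> fst c \<Longrightarrow> transition c d (snd c p) = snd d p"
  by (simp add: transition_def)

lemma transition_differentiable:
  "c \<in> A \<Longrightarrow> d \<in> A \<Longrightarrow> p \<in> fst c \<Longrightarrow> p \<in> fst d \<Longrightarrow> transition c d differentiable at (snd c p)"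
  by (rule smooth_on_differentiable[OF transition_smooth]) auto

lemma linear_der_transition:
  "c \<in> A \<Longrightarrow> d \<in> A \<Longrightarrow> p \<in> fst c \<Longrightarrow> p \<in> fst d \<Longrightarrow> linear (der (transition c d) (snd c p))"
  using transition_differentiable linear_frechet_derivative by blast

lemma der_transition_compose:
  assumes "c \<in> A" "d \<in> A" "e \<in> A" "p \<in> fst c" "p \<in> fst d" "p \<in> fst e"
  shows "der (transition c e) (snd c p) u = der (transition d e) (snd d p) (der (transition c d) (snd c p) u)"
proof -
  have op: "openin (atlas_topology A) (fst d \<inter> fst e)"
    using assms chart_openin by blast
  have "der (transition c e) (snd c p) = der (\<lambda>x. transition d e (transition c d x)) (snd c p)"
    by (rule der_cong[OF open_image[OF assms(1) op]]) (use assms in auto)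
  then show ?thesis
    using der_compose[OF transition_differentiable[OF assms(1,2,4,5)], of "transition d e" u]
      transition_differentiable[OF assms(2,3,5,6)] assms by simp
qed

lemma der_transition_self:
  assumes "c \<in> A" "p \<in> fst c" shows "der (transition c c) (snd c p) u = u"
proof -
  have "der (transition c c) (snd c p) = der (\<lambda>x. x) (snd c p)"
    by (rule der_cong[OF chart_open[OF assms(1)]]) (use assms in auto)
  then show ?thesis by simp
qed

lemma der_transition_inverse:
  assumes "c \<in> A" "d \<in> A" "p \<in> fst c" "p \<in> fst d"
  shows "der (transition d c) (snd d p) (der (transition c d) (snd c p) u) = u"
  using der_transition_compose[OF assms(1,2,1,3,4,3)] der_transition_self[OF assms(1,3)] by simp

lemma coord_vector_apply:
  "d \<in> A \<Longrightarrow> p \<in> fst d \<Longrightarrow> coord_vector A c p u d = der (transition c d) (snd c p) u"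
  by (simp add: coord_vector_def)

lemma coord_vector_self [simp]: "c \<in> A \<Longrightarrow> p \<in> fst c \<Longrightarrow> coord_vector A c p u c = u"
  by (simp add: coord_vector_def der_transition_self)

lemma coord_vector_tangent: "c \<in> A \<Longrightarrow> p \<in> fst c \<Longrightarrow> coord_vector A c p u \<in> tangent_space A p"
  unfolding tangent_space_def coord_vector_def by (auto intro: der_transition_compose)

lemma tangent_vector_eq:
  assumes "c \<in> A" "p \<in> fst c" "v \<in> tangent_space A p"
  shows "v = coord_vector A c p (v c)"
proof
  fix d show "v d = coord_vector A c p (v c) d"
  proof (cases "d \<in> A \<and> p \<in> fst d")
    case True
    then have "v d = der (transition c d) (snd c p) (v c)"
      using assms unfolding tangent_space_def by blast
    then show ?thesis using True by (simp add: coord_vector_def)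
  next
    case False
    then have "v d = 0" using assms(3) unfolding tangent_space_def by blast
    then show ?thesis using False by (auto simp: coord_vector_def)
  qed
qed

lemma tangent_vector_eqI:
  "c \<in> A \<Longrightarrow> p \<in> fst c \<Longrightarrow> v \<in> tangent_space A p \<Longrightarrow> w \<in> tangent_space A p \<Longrightarrow> v c = w c \<Longrightarrow> v = w"
  by (rule trans[OF tangent_vector_eq[of c p v] trans[OF _ tangent_vector_eq[of c p w, symmetric]]]) simp_all

lemma tangent_vector_outside: "v \<in> tangent_space A p \<Longrightarrow> \<not> (c \<in> A \<and> p \<in> fst c) \<Longrightarrow> v c = 0"
  unfolding tangent_space_def by blast

lemma tangent_vector_transition:
  "v \<in> tangent_space A p \<Longrightarrow> c \<in> A \<Longrightarrow> d \<in> A \<Longrightarrow> p \<in> fst c \<Longrightarrow> p \<in> fst d \<Longrightarrow>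
    v d = der (transition c d) (snd c p) (v c)"
  unfolding tangent_space_def by blast

lemma coord_vector_change:
  assumes "c \<in> A" "d \<in> A" "p \<in> fst c" "p \<in> fst d"
  shows "coord_vector A c p u = coord_vector A d p (der (transition c d) (snd c p) u)"
  by (rule tangent_vector_eqI[OF assms(2,4) coord_vector_tangent[OF assms(1,3)] coord_vector_tangent[OF assms(2,4)]])
    (use assms in \<open>simp add: coord_vector_apply\<close>)

lemma coord_vector_linear:
  assumes "c \<in> A" "p \<in> fst c"
  shows "coord_vector A c p (u + v) = coord_vector A c p u + coord_vector A c p v"
    "coord_vector A c p (r *\<^sub>R u) = r *\<^sub>R coord_vector A c p u"
    "coord_vector A c p 0 = 0"
  using linear_add[OF linear_der_transition] linear_scale[OF linear_der_transition]
    linear_0[OF linear_der_transition] assms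
  by (auto simp: coord_vector_def fun_eq_iff scaleR_fun_def)

lemma tangent_space_add:
  assumes "v \<in> tangent_space A p" "w \<in> tangent_space A p"
  shows "v + w \<in> tangent_space A p"
proof (cases "\<exists>c\<in>A. p \<in> fst c")
  case True
  then obtain c where c: "c \<in> A" "p \<in> fst c" by blast
  show ?thesis
    by (subst tangent_vector_eq[OF c assms(1)], subst tangent_vector_eq[OF c assms(2)],
        subst coord_vector_linear(1)[OF c, symmetric]) (rule coord_vector_tangent[OF c])
next
  case False
  then show ?thesis using assms unfolding tangent_space_def by auto
qed

lemma coord_vector_eq_0_iff: "c \<in> A \<Longrightarrow> p \<in> fst c \<Longrightarrow> coord_vector A c p u = 0 \<longleftrightarrow> u = 0"
  using coord_vector_linear(3) coord_vector_self by (metis zero_fun_apply)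

text \<open>The local parametrization of a submanifold in an ambient chart. Unlike
  \<open>transition\<close> it relates charts with different model spaces.\<close>

definition par :: "('a, 'k::euclidean_space) chart \<Rightarrow> ('a, 'e) chart \<Rightarrow> 'k \<Rightarrow> 'e"
  where "par c d = snd d \<circ> chart_inv c"

lemma submanifold_chartD:
  assumes "c \<in> submanifold_atlas A N"
  shows "\<exists>T. openin (atlas_topology A) T \<and> fst c = N \<inter> T" "fst c \<subseteq> N" "fst c \<subseteq> atlas_carrier A"
    "inj_on (snd c) (fst c)" "open (snd c ` fst c)"
    "\<And>d. d \<in> A \<Longrightarrow> open (snd c ` (fst c \<inter> fst d))"
    "\<And>d. d \<in> A \<Longrightarrow> smooth_on (snd c ` (fst c \<inter> fst d)) (par c d)"
    "\<And>d p. d \<in> A \<Longrightarrow> p \<in> fst c \<Longrightarrow> p \<in> fst d \<Longrightarrow> \<exists>S h. open S \<and> snd d p \<in> S \<and> smooth_on S h \<and>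
       (\<forall>q\<in>fst c \<inter> fst d. snd d q \<in> S \<longrightarrow> h (snd d q) = snd c q)"
proof -
  obtain W \<psi> where c: "c = (W, \<psi>)" by fastforce
  note A = assms[unfolded submanifold_atlas_def c, simplified]
  have o: "openin (subtopology (atlas_topology A) N) W" using A by blast
  then show T: "\<exists>T. openin (atlas_topology A) T \<and> fst c = N \<inter> T"
    by (auto simp: c openin_subtopology)
  then show "fst c \<subseteq> N" "fst c \<subseteq> atlas_carrier A" using openin_iff by auto
  show "inj_on (snd c) (fst c)" "open (snd c ` fst c)"
    "\<And>d. d \<in> A \<Longrightarrow> open (snd c ` (fst c \<inter> fst d))"
    "\<And>d. d \<in> A \<Longrightarrow> smooth_on (snd c ` (fst c \<inter> fst d)) (par c d)"
    "\<And>d p. d \<in> A \<Longrightarrow> p \<in> fst c \<Longrightarrow> p \<in> fst d \<Longrightarrow> \<exists>S h. open S \<and> snd d p \<in> S \<and> smooth_on S h \<and>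
       (\<forall>q\<in>fst c \<inter> fst d. snd d q \<in> S \<longrightarrow> h (snd d q) = snd c q)"
    using A by (auto simp: c par_def)
qed

lemma submanifold_chart_inv [simp]:
  "c \<in> submanifold_atlas A N \<Longrightarrow> p \<in> fst c \<Longrightarrow> chart_inv c (snd c p) = p"
  by (simp add: chart_inv_def inv_into_f_f submanifold_chartD(4))

lemma par_chart [simp]: "c \<in> submanifold_atlas A N \<Longrightarrow> p \<in> fst c \<Longrightarrow> par c d (snd c p) = snd d p"
  by (simp add: par_def)

text \<open>Ambient charts cover the domain of \<open>c\<close>; over each of them the image of
  \<open>T\<close> is a preimage under the continuous parametrization.\<close>

lemma submanifold_chart_open:
  assumes c: "c \<in> submanifold_atlas A N" and T: "openin (atlas_topology A) T"
  shows "open (snd c ` (fst c \<inter> T))"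
proof -
  have "open (snd c ` (fst c \<inter> fst d \<inter> T))" if d: "d \<in> A" for d
  proof -
    have "par c d (snd c q) \<in> snd d ` (fst d \<inter> T) \<longleftrightarrow> q \<in> T" if "q \<in> fst c" "q \<in> fst d" for q
      using chart_mem_image_iff[OF d that(2), of "fst d \<inter> T"] that c by simp
    then have "snd c ` (fst c \<inter> fst d \<inter> T) = snd c ` (fst c \<inter> fst d) \<inter> par c d -` (snd d ` (fst d \<inter> T))"
      by blast
    then show ?thesis
      using open_preimage_Int[OF submanifold_chartD(7)[OF c d] submanifold_chartD(6)[OF c d] open_image[OF d T]] by simp
  qed
  moreover have "snd c ` (fst c \<inter> T) = (\<Union>d\<in>A. snd c ` (fst c \<inter> fst d \<inter> T))"
    using submanifold_chartD(3)[OF c] by (fastforce simp: atlas_carrier_def)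
  ultimately show ?thesis by (metis (no_types, lifting) open_UN)
qed

text \<open>A transition map between two charts of the submanifold factors locally through an
  ambient chart: the parametrization belonging to the first chart is followed by the smooth
  extension of the second, which the definition of \<open>submanifold_atlas\<close>
  provides.\<close>

lemma smooth_atlas_submanifold: "smooth_atlas (submanifold_atlas A N :: ('a, 'k::euclidean_space) chart set)"
proof
  fix c d :: "('a, 'k) chart" assume c: "c \<in> submanifold_atlas A N"
  show "inj_on (snd c) (fst c)" "open (snd c ` fst c)"
    using submanifold_chartD(4,5)[OF c] by auto
  assume d: "d \<in> submanifold_atlas A N"
  obtain T where T: "openin (atlas_topology A) T" "fst d = N \<inter> T" using submanifold_chartD(1)[OF d] by blast
  have "fst c \<inter> fst d = fst c \<inter> T" using T submanifold_chartD(2)[OF c] by auto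
  then show op: "open (snd c ` (fst c \<inter> fst d))" using submanifold_chart_open[OF c T(1)] by simp
  show "smooth_on (snd c ` (fst c \<inter> fst d)) (transition c d)"
  proof (rule smooth_on_local)
    fix y assume "y \<in> snd c ` (fst c \<inter> fst d)"
    then obtain p where p: "p \<in> fst c" "p \<in> fst d" "y = snd c p" by auto
    obtain e where e: "e \<in> A" "p \<in> fst e" using submanifold_chartD(3)[OF c] p by (auto simp: atlas_carrier_def)
    obtain S h where S: "open S" "snd e p \<in> S" "smooth_on S h"
      "\<forall>q\<in>fst d \<inter> fst e. snd e q \<in> S \<longrightarrow> h (snd e q) = snd d q"
      using submanifold_chartD(8)[OF d e(1) p(2) e(2)] by blast
    define Y where "Y = snd c ` (fst c \<inter> fst e) \<inter> par c e -` S"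
    define Z where "Z = snd c ` (fst c \<inter> fst d) \<inter> Y"
    have oY: "open Y"
      unfolding Y_def by (rule open_preimage_Int[OF submanifold_chartD(7)[OF c e(1)] submanifold_chartD(6)[OF c e(1)] S(1)])
    have oZ: "open Z" unfolding Z_def using op oY by auto
    have "smooth_on Z (\<lambda>y. h (par c e y))"
      by (rule smooth_on_compose[OF oZ S(3) smooth_on_subset[OF submanifold_chartD(7)[OF c e(1)]]])
        (auto simp: Z_def Y_def)
    then have "smooth_on Z (transition c d)"
    proof (rule smooth_on_eqI[OF _ oZ])
      fix y assume y: "y \<in> Z"
      obtain q where q: "q \<in> fst c" "q \<in> fst d" "y = snd c q" using y unfolding Z_def by blast
      obtain r where r: "r \<in> fst c" "r \<in> fst e" "y = snd c r" using y unfolding Z_def Y_def by blast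
      have qr: "q = r" by (rule inj_onD[OF submanifold_chartD(4)[OF c]]) (use q r in simp_all)
      have "snd e q \<in> S" using y par_chart[OF c q(1), of e] unfolding Z_def Y_def q(3) by simp
      then have "h (snd e q) = snd d q" using S(4) q(2) r(2) qr by blast
      then show "transition c d y = h (par c e y)" using c q by (simp add: transition_def)
    qed
    moreover have "y \<in> Z" using p e S c by (auto simp: Z_def Y_def)
    ultimately show "\<exists>T. open T \<and> y \<in> T \<and> smooth_on T (transition c d)" using oZ by blast
  qed
qed

text \<open>The definition of \<open>submanifold_atlas\<close> tests a chart against all ambient
  charts. It suffices to test one ambient chart around each point, since transition maps carry both
  the parametrization and the local extension to any other.\<close>

lemma submanifold_atlasI:
  fixes \<psi> :: "'a \<Rightarrow> 'k::euclidean_space"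
  assumes W: "openin (atlas_topology A) T" "W = N \<inter> T" "inj_on \<psi> W" "open (\<psi> ` W)"
    and loc: "\<And>p. p \<in> W \<Longrightarrow> \<exists>e\<in>A. p \<in> fst e \<and> open (\<psi> ` (W \<inter> fst e)) \<and> smooth_on (\<psi> ` (W \<inter> fst e)) (par (W, \<psi>) e) \<and>
      (\<exists>S h. open S \<and> snd e p \<in> S \<and> smooth_on S h \<and> (\<forall>q\<in>W \<inter> fst e. snd e q \<in> S \<longrightarrow> h (snd e q) = \<psi> q))"
  shows "(W, \<psi>) \<in> submanifold_atlas A N"
proof -
  have inv: "chart_inv (W, \<psi>) (\<psi> q) = q" if "q \<in> W" for q
    by (simp add: chart_inv_def inv_into_f_f W(3) that)
  have nbhd: "\<exists>Z. open Z \<and> \<psi> p \<in> Z \<and> Z \<subseteq> \<psi> ` (W \<inter> fst d) \<and> smooth_on Z (par (W, \<psi>) d)"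
    if d: "d \<in> A" and p: "p \<in> W" "p \<in> fst d" for d p
  proof -
    obtain e where e: "e \<in> A" "p \<in> fst e" "open (\<psi> ` (W \<inter> fst e))" "smooth_on (\<psi> ` (W \<inter> fst e)) (par (W, \<psi>) e)"
      using loc[OF p(1)] by blast
    define Z where "Z = \<psi> ` (W \<inter> fst e) \<inter> par (W, \<psi>) e -` (snd e ` (fst e \<inter> fst d))"
    have oZ: "open Z" unfolding Z_def by (rule open_preimage_Int[OF e(4,3) overlap_open[OF e(1) d]])
    have Zq: "\<exists>q. q \<in> W \<and> q \<in> fst e \<and> q \<in> fst d \<and> y = \<psi> q" if "y \<in> Z" for y
    proof -
      obtain q where q: "q \<in> W" "q \<in> fst e" "y = \<psi> q" using \<open>y \<in> Z\<close> by (auto simp: Z_def)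
      then have "snd e q \<in> snd e ` (fst e \<inter> fst d)" using \<open>y \<in> Z\<close> by (simp add: Z_def par_def inv)
      then show ?thesis using q chart_mem_image_iff[OF e(1) q(2), of "fst e \<inter> fst d"] by auto
    qed
    have "smooth_on Z (\<lambda>y. transition e d (par (W, \<psi>) e y))"
      by (rule smooth_on_compose[OF oZ transition_smooth[OF e(1) d] smooth_on_subset[OF e(4)]]) (auto simp: Z_def)
    then have "smooth_on Z (par (W, \<psi>) d)"
      by (rule smooth_on_eqI[OF _ oZ]) (use Zq e(1) in \<open>force simp: par_def inv\<close>)
    moreover have "\<psi> p \<in> Z" using p e by (auto simp: Z_def par_def inv)
    moreover have "Z \<subseteq> \<psi> ` (W \<inter> fst d)" using Zq by blast
    ultimately show ?thesis using oZ by blast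
  qed
  have o: "openin (subtopology (atlas_topology A) N) W"
    using W(1,2) by (auto simp: openin_subtopology)
  have "open (\<psi> ` (W \<inter> fst d))" if "d \<in> A" for d
    by (subst open_subopen) (use nbhd[OF that] in blast)
  moreover have "smooth_on (\<psi> ` (W \<inter> fst d)) (snd d \<circ> chart_inv (W, \<psi>))" if "d \<in> A" for d
    by (rule smooth_on_local) (use nbhd[OF that] in \<open>auto simp: par_def\<close>)
  moreover have "\<exists>S h. open S \<and> snd d p \<in> S \<and> smooth_on S h \<and> (\<forall>q\<in>W \<inter> fst d. snd d q \<in> S \<longrightarrow> h (snd d q) = \<psi> q)"
    if d: "d \<in> A" and p: "p \<in> W \<inter> fst d" for d p
  proof -
    have "p \<in> W" using p by simp
    from loc[OF this] obtain e S h where e: "e \<in> A" "p \<in> fst e" "open S" "snd e p \<in> S" "smooth_on S h"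
      "\<forall>q\<in>W \<inter> fst e. snd e q \<in> S \<longrightarrow> h (snd e q) = \<psi> q"
      by blast
    define S' where "S' = snd d ` (fst d \<inter> fst e) \<inter> transition d e -` S"
    have oS: "open S'" unfolding S'_def
      by (rule open_preimage_Int[OF transition_smooth[OF d e(1)] overlap_open[OF d e(1)] e(3)])
    have "smooth_on S' (\<lambda>x. h (transition d e x))"
      by (rule smooth_on_compose[OF oS e(5) smooth_on_subset[OF transition_smooth[OF d e(1)]]]) (auto simp: S'_def)
    moreover have "snd d p \<in> S'" using p e d by (auto simp: S'_def)
    moreover have "h (transition d e (snd d q)) = \<psi> q" if "q \<in> W \<inter> fst d" "snd d q \<in> S'" for q
    proof -
      have "q \<in> fst e" using that chart_mem_image_iff[OF d, of q "fst d \<inter> fst e"] by (auto simp: S'_def)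
      then show ?thesis using that e(6) d by (auto simp: S'_def)
    qed
    ultimately show ?thesis using oS by (intro exI[of _ S'] exI[of _ "\<lambda>x. h (transition d e x)"]) blast
  qed
  ultimately show ?thesis
    unfolding submanifold_atlas_def using o W(3,4) by blast
qed

text \<open>The local extension \<open>h\<close> of the chart is a left inverse of the
  parametrization, which therefore is an immersion. The neighbourhoods are part of the statement
  because the smoothness of \<open>ext_field\<close> needs the derivative of \<open>h\<close> near a
  point and not just at it.\<close>

lemma der_par_left_inverse:
  fixes c :: "('a, 'k::euclidean_space) chart"
  assumes c: "c \<in> submanifold_atlas A N" and d: "d \<in> A" and p: "p \<in> fst c" "p \<in> fst d"
  obtains S h Z where "open S" "snd d p \<in> S" "smooth_on S h" "open Z" "snd c p \<in> Z" "Z \<subseteq> snd c ` (fst c \<inter> fst d)"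
    "\<And>y. y \<in> Z \<Longrightarrow> par c d y \<in> S" "\<And>y. y \<in> Z \<Longrightarrow> h (par c d y) = y"
    "\<And>y v. y \<in> Z \<Longrightarrow> der h (par c d y) (der (par c d) y v) = v"
proof -
  obtain S h where S: "open S" "snd d p \<in> S" "smooth_on S h"
    "\<forall>q\<in>fst c \<inter> fst d. snd d q \<in> S \<longrightarrow> h (snd d q) = snd c q"
    using submanifold_chartD(8)[OF c d p] by blast
  define Z where "Z = snd c ` (fst c \<inter> fst d) \<inter> par c d -` S"
  have oZ: "open Z" unfolding Z_def
    by (rule open_preimage_Int[OF submanifold_chartD(7)[OF c d] submanifold_chartD(6)[OF c d] S(1)])
  have h: "h (par c d y) = y" if "y \<in> Z" for y using that S(4) c by (auto simp: Z_def)
  have inS: "par c d y \<in> S" if "y \<in> Z" for y using that by (auto simp: Z_def)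
  have "der h (par c d y) (der (par c d) y v) = v" if y: "y \<in> Z" for y v
  proof -
    have "par c d differentiable at y"
      by (rule smooth_on_differentiable[OF submanifold_chartD(7)[OF c d]]) (use y in \<open>auto simp: Z_def\<close>)
    then have "der (\<lambda>y. h (par c d y)) y v = der h (par c d y) (der (par c d) y v)"
      by (rule der_compose) (rule smooth_on_differentiable[OF S(3) inS[OF y]])
    moreover have "der (\<lambda>y. h (par c d y)) y = der (\<lambda>y. y) y"
      by (rule der_cong[OF oZ y h])
    ultimately show ?thesis by simp
  qed
  moreover have "snd c p \<in> Z" using p S c by (auto simp: Z_def)
  ultimately show thesis by (intro that[of S h Z]) (use S oZ h inS in \<open>auto simp: Z_def\<close>)
qed

lemma der_par_inj:
  assumes "c \<in> submanifold_atlas A N" "d \<in> A" "p \<in> fst c" "p \<in> fst d"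
    and "der (par c d) (snd c p) v = der (par c d) (snd c p) w"
  shows "v = w"
  using der_par_left_inverse[OF assms(1-4)] assms(5) by metis

lemma par_differentiable:
  "c \<in> submanifold_atlas A N \<Longrightarrow> d \<in> A \<Longrightarrow> p \<in> fst c \<Longrightarrow> p \<in> fst d \<Longrightarrow> par c d differentiable at (snd c p)"
  by (rule smooth_on_differentiable[OF submanifold_chartD(7)]) auto

lemma der_par_transition:
  assumes c: "c \<in> submanifold_atlas A N" and d: "d \<in> A" "e \<in> A" and p: "p \<in> fst c" "p \<in> fst d" "p \<in> fst e"
  shows "der (par c e) (snd c p) v = der (transition d e) (snd d p) (der (par c d) (snd c p) v)"
proof -
  have op: "openin (atlas_topology A) (fst d \<inter> fst e)" using d chart_openin by blast
  have "der (par c e) (snd c p) = der (\<lambda>y. transition d e (par c d y)) (snd c p)"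
    by (rule der_cong[OF submanifold_chart_open[OF c op]]) (use c d p in auto)
  then show ?thesis
    using der_compose[OF par_differentiable[OF c d(1) p(1,2)], of "transition d e" v]
      transition_differentiable[OF d p(2,3)] c p by simp
qed

lemma der_par_change:
  fixes c c' :: "('a, 'k::euclidean_space) chart"
  assumes c: "c \<in> submanifold_atlas A N" "c' \<in> submanifold_atlas A N" and d: "d \<in> A"
    and p: "p \<in> fst c" "p \<in> fst c'" "p \<in> fst d"
  shows "der (par c d) (snd c p) v = der (par c' d) (snd c' p) (der (transition c c') (snd c p) v)"
proof -
  interpret C: smooth_atlas "submanifold_atlas A N :: ('a, 'k) chart set" by (rule smooth_atlas_submanifold)
  have "der (par c d) (snd c p) = der (\<lambda>y. par c' d (transition c c' y)) (snd c p)"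
    by (rule der_cong[OF C.overlap_open[OF c]]) (use c d p in auto)
  then show ?thesis
    using der_compose[OF C.transition_differentiable[OF c p(1,2)], of "par c' d" v]
      par_differentiable[OF c(2) d p(2,3)] c p by simp
qed

definition push :: "('a, 'k::euclidean_space) chart \<Rightarrow> 'a \<Rightarrow> 'k \<Rightarrow> ('a, 'e) tvec"
  where "push c p v = (\<lambda>d. if d \<in> A \<and> p \<in> fst d then der (par c d) (snd c p) v else 0)"

text \<open>\<open>pushforward\<close> chooses an arbitrary chart around \<open>p\<close>; by the
  chain rule every chart gives the same vector, so from here on the chart can be prescribed.\<close>

lemma pushforward_eq_push:
  fixes c :: "('a, 'k::euclidean_space) chart"
  assumes c: "c \<in> submanifold_atlas A N" "p \<in> fst c"
    and u: "u \<in> tangent_space (submanifold_atlas A N) p"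
  shows "pushforward (submanifold_atlas A N) A (\<lambda>q. q) p u = push c p (u c)"
proof -
  interpret C: smooth_atlas "submanifold_atlas A N :: ('a, 'k) chart set" by (rule smooth_atlas_submanifold)
  define c' where "c' = (SOME c :: ('a, 'k) chart. c \<in> submanifold_atlas A N \<and> p \<in> fst c)"
  have c': "c' \<in> submanifold_atlas A N" "p \<in> fst c'"
    using someI[of "\<lambda>c :: ('a, 'k) chart. c \<in> submanifold_atlas A N \<and> p \<in> fst c"] c unfolding c'_def by blast+
  have "pushforward (submanifold_atlas A N) A (\<lambda>q. q) p u = push c' p (u c')"
    unfolding pushforward_def push_def par_def Let_def c'_def[symmetric] by (auto simp: o_def)
  also have "\<dots> = push c p (u c)"
    unfolding push_def C.tangent_vector_transition[OF u c'(1) c(1) c'(2) c(2)]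
    using der_par_change[OF c'(1) c(1) _ c'(2) c(2)] by auto
  finally show ?thesis .
qed

lemma push_eq_coord_vector:
  assumes "c \<in> submanifold_atlas A N" "p \<in> fst c" "d \<in> A" "p \<in> fst d"
  shows "push c p v = coord_vector A d p (der (par c d) (snd c p) v)"
  using der_par_transition[OF assms(1,3) _ assms(2,4)] by (auto simp: push_def coord_vector_def)

lemma submanifold_tangent_eq:
  fixes c :: "('a, 'k::euclidean_space) chart"
  assumes c: "c \<in> submanifold_atlas A N" "p \<in> fst c"
  shows "submanifold_tangent TYPE('k) A N p = range (push c p)"
proof -
  interpret C: smooth_atlas "submanifold_atlas A N :: ('a, 'k) chart set" by (rule smooth_atlas_submanifold)
  have "push c p v \<in> submanifold_tangent TYPE('k) A N p" for v
  proof -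
    have "coord_vector (submanifold_atlas A N) c p v \<in> tangent_space (submanifold_atlas A N) p"
      by (rule C.coord_vector_tangent[OF c])
    from pushforward_eq_push[OF c this] this show ?thesis
      unfolding submanifold_tangent_def Let_def using C.coord_vector_self[OF c] by (metis image_eqI)
  qed
  then show ?thesis
    unfolding submanifold_tangent_def Let_def using pushforward_eq_push[OF c] by auto
qed

end

section \<open>Riemannian metrics in charts\<close>

context smooth_atlas
begin

definition rep :: "('a, 'e) chart \<Rightarrow> ('a, 'e) vfield \<Rightarrow> 'e \<Rightarrow> 'e"
  where "rep c X x = X (chart_inv c x) c"

lemma rep_chart: "c \<in> A \<Longrightarrow> p \<in> fst c \<Longrightarrow> rep c X (snd c p) = X p c"
  by (simp add: rep_def)

lemma smooth_rep: "smooth_vector_field A V X \<Longrightarrow> c \<in> A \<Longrightarrow> smooth_on (snd c ` (fst c \<inter> V)) (rep c X)"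
  by (simp add: smooth_vector_field_def rep_def[abs_def])

lemma field_tangent: "smooth_vector_field A V X \<Longrightarrow> p \<in> V \<Longrightarrow> X p \<in> tangent_space A p"
  by (simp add: smooth_vector_field_def)

lemma nabla_chart:
  "c \<in> A \<Longrightarrow> p \<in> fst c \<Longrightarrow> nabla A g X Y p c
    = der (rep c Y) (snd c p) (X p c) + christoffel A g c (snd c p) (X p c) (Y p c)"
  by (simp add: nabla_def rep_def[abs_def])

end

locale riemannian_atlas = smooth_atlas A for A :: "('a, 'e::euclidean_space) chart set" +
  fixes g :: "('a, 'e) metric"
  assumes metric: "riemannian_metric A g"
begin

lemma g_sym: "p \<in> atlas_carrier A \<Longrightarrow> u \<in> tangent_space A p \<Longrightarrow> v \<in> tangent_space A p \<Longrightarrow> g p u v = g p v u"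
  using metric unfolding riemannian_metric_def by blast

lemma g_add_left: "p \<in> atlas_carrier A \<Longrightarrow> u \<in> tangent_space A p \<Longrightarrow> v \<in> tangent_space A p \<Longrightarrow> w \<in> tangent_space A p
    \<Longrightarrow> g p (u + v) w = g p u w + g p v w"
  using metric unfolding riemannian_metric_def by blast

lemma g_scale_left: "p \<in> atlas_carrier A \<Longrightarrow> u \<in> tangent_space A p \<Longrightarrow> v \<in> tangent_space A p
    \<Longrightarrow> g p (r *\<^sub>R u) v = r * g p u v"
  using metric unfolding riemannian_metric_def by blast

lemma g_pos: "p \<in> atlas_carrier A \<Longrightarrow> u \<in> tangent_space A p \<Longrightarrow> u \<noteq> 0 \<Longrightarrow> g p u u > 0"
  using metric unfolding riemannian_metric_def by blast

lemma g_add_right: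
  assumes "p \<in> atlas_carrier A" "u \<in> tangent_space A p" "v \<in> tangent_space A p" "w \<in> tangent_space A p"
  shows "g p w (u + v) = g p w u + g p w v"
  unfolding g_sym[OF assms(1,4) tangent_space_add[OF assms(2,3)]] g_sym[OF assms(1,4,2)] g_sym[OF assms(1,4,3)]
  by (rule g_add_left[OF assms])

lemma tangent_space_scale:
  assumes "v \<in> tangent_space A p"
  shows "r *\<^sub>R v \<in> tangent_space A p"
proof (cases "\<exists>c\<in>A. p \<in> fst c")
  case True
  then obtain c where c: "c \<in> A" "p \<in> fst c" by blast
  show ?thesis
    by (subst tangent_vector_eq[OF c assms], subst coord_vector_linear(2)[OF c, symmetric])
      (rule coord_vector_tangent[OF c])
next
  case False
  then show ?thesis using assms unfolding tangent_space_def by (auto simp: scaleR_fun_def)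
qed

lemma g_scale_right:
  assumes "p \<in> atlas_carrier A" "u \<in> tangent_space A p" "v \<in> tangent_space A p"
  shows "g p u (r *\<^sub>R v) = r * g p u v"
  unfolding g_sym[OF assms] g_sym[OF assms(1,2) tangent_space_scale[OF assms(3)]]
  by (rule g_scale_left[OF assms(1,3,2)])

lemma in_carrier: "c \<in> A \<Longrightarrow> p \<in> fst c \<Longrightarrow> p \<in> atlas_carrier A"
  by (auto simp: atlas_carrier_def)

lemma metric_coord_chart:
  "c \<in> A \<Longrightarrow> p \<in> fst c \<Longrightarrow> metric_coord A g c (snd c p) u v = g p (coord_vector A c p u) (coord_vector A c p v)"
  by (simp add: metric_coord_def)

lemma g_eq_metric_coord:
  assumes "c \<in> A" "p \<in> fst c" "u \<in> tangent_space A p" "v \<in> tangent_space A p"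
  shows "g p u v = metric_coord A g c (snd c p) (u c) (v c)"
  unfolding metric_coord_chart[OF assms(1,2)]
  by (rule arg_cong2[where f="g p", OF tangent_vector_eq[OF assms(1,2,3)] tangent_vector_eq[OF assms(1,2,4)]])

lemma coord_metric_chart:
  assumes c: "c \<in> A" shows "coord_metric (snd c ` fst c) (metric_coord A g c)"
proof (rule coord_metric.intro)
  fix x u v assume "x \<in> snd c ` fst c"
  then obtain p where p: "p \<in> fst c" "x = snd c p" by auto
  note cv = coord_vector_tangent[OF c p(1)] coord_vector_linear[OF c p(1)]
  note pc = in_carrier[OF c p(1)]
  show "linear (metric_coord A g c x u)"
    unfolding p(2)
    by (rule linearI)
      (simp_all add: metric_coord_chart[OF c p(1)] cv(2,3) g_add_right[OF pc cv(1) cv(1) cv(1)]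
        g_scale_right[OF pc cv(1) cv(1)])
  show "metric_coord A g c x u v = metric_coord A g c x v u"
    unfolding p(2) metric_coord_chart[OF c p(1)] by (rule g_sym[OF pc cv(1) cv(1)])
  show "0 < metric_coord A g c x u u" if "u \<noteq> 0"
    unfolding p(2) metric_coord_chart[OF c p(1)]
    by (rule g_pos[OF pc cv(1)]) (simp add: coord_vector_eq_0_iff[OF c p(1)] that)
next
  show "open (snd c ` fst c)" by (rule chart_open[OF c])
  show "smooth_on (snd c ` fst c) (\<lambda>x. metric_coord A g c x u v)" for u v
    using metric[unfolded riemannian_metric_def, THEN conjunct2, THEN bspec, OF c] by (elim allE)
qed

text \<open>A transition map pulls the coefficients of one chart back to those of the other. Its
  differential is invertible, so every \<open>z\<close> is of the form to which
  \<open>pullback_levi_civita\<close> applies, and the products determine the vector.\<close>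

lemma christoffel_transition:
  assumes c: "c \<in> A" "d \<in> A" and p: "p \<in> fst c" "p \<in> fst d"
  shows "der (transition c d) (snd c p) (christoffel A g c (snd c p) u v)
    = der (\<lambda>y. der (transition c d) y v) (snd c p) u
      + christoffel A g d (snd d p) (der (transition c d) (snd c p) u) (der (transition c d) (snd c p) v)"
proof -
  interpret D: coord_metric "snd d ` fst d" "metric_coord A g d" by (rule coord_metric_chart[OF c(2)])
  let ?P = "snd c ` (fst c \<inter> fst d)"
  let ?\<tau> = "transition c d"
  have cmP: "coord_metric ?P (metric_coord A g c)"
    by (rule coord_metric_subset[OF coord_metric_chart[OF c(1)] overlap_open[OF c]]) auto
  have im: "?\<tau> ` ?P \<subseteq> snd d ` fst d" using c by auto
  have pull: "metric_coord A g c y u v = metric_coord A g d (?\<tau> y) (der ?\<tau> y u) (der ?\<tau> y v)"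
    if "y \<in> ?P" for y u v
  proof -
    obtain q where q: "q \<in> fst c" "q \<in> fst d" "y = snd c q" using \<open>y \<in> ?P\<close> by blast
    then show ?thesis
      using c by (simp add: metric_coord_chart coord_vector_change[OF c q(1,2)])
  qed
  have yP: "snd c p \<in> ?P" using p by auto
  have dp: "snd d p \<in> snd d ` fst d" using p by auto
  show ?thesis
  proof (rule D.M_eq_imp_eq[OF dp])
    fix z
    let ?z = "der (transition d c) (snd d p) z"
    have z: "der ?\<tau> (snd c p) ?z = z" by (rule der_transition_inverse[OF c(2,1) p(2,1)])
    show "metric_coord A g d (snd d p) (der ?\<tau> (snd c p) (christoffel A g c (snd c p) u v)) z
      = metric_coord A g d (snd d p) (der (\<lambda>y. der ?\<tau> y v) (snd c p) u
      + christoffel A g d (snd d p) (der ?\<tau> (snd c p) u) (der ?\<tau> (snd c p) v)) z"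
      using pullback_levi_civita[OF cmP D.coord_metric_axioms transition_smooth[OF c] im pull yP, of u v ?z]
        pull[OF yP, of "christoffel A g c (snd c p) u v" ?z]
      unfolding z transition_chart[OF c(1) p(1)] christoffel_eq_levi_civita by simp
  qed
qed

text \<open>Differentiating the transformation law of \<open>Y\<close> produces a second derivative
  of the transition map, which is exactly the inhomogeneous term of
  \<open>christoffel_transition\<close>.\<close>

lemma nabla_tangent:
  assumes V: "openin (atlas_topology A) V" "p \<in> V" and X: "X p \<in> tangent_space A p"
    and Y: "smooth_vector_field A V Y"
  shows "nabla A g X Y p \<in> tangent_space A p"
proof -
  have "nabla A g X Y p d = der (transition c d) (snd c p) (nabla A g X Y p c)"
    if c: "c \<in> A" "d \<in> A" and p: "p \<in> fst c" "p \<in> fst d" for c d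
  proof -
    let ?\<tau> = "transition c d"
    let ?S = "snd c ` (fst c \<inter> (fst d \<inter> V))"
    have S: "open ?S" "?S \<subseteq> snd c ` (fst c \<inter> fst d)" "snd c p \<in> ?S"
      using open_image[OF c(1)] openin_Int[OF chart_openin[OF c(2)] V(1)] V(2) p by auto
    have sY: "smooth_on ?S (rep c Y)"
      by (rule smooth_on_subset[OF smooth_rep[OF Y c(1)]]) auto
    have "rep d Y differentiable at (snd d p)"
      by (rule smooth_on_differentiable[OF smooth_rep[OF Y c(2)]]) (use p V in auto)
    then have "der (\<lambda>y. rep d Y (?\<tau> y)) (snd c p) (X p c) = der (rep d Y) (snd d p) (X p d)"
      using der_compose[OF transition_differentiable[OF c p], of "rep d Y" "X p c"] c p
        tangent_vector_transition[OF X c p] by simp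
    moreover have "der (\<lambda>y. rep d Y (?\<tau> y)) (snd c p) = der (\<lambda>y. der ?\<tau> y (rep c Y y)) (snd c p)"
    proof (rule der_cong[OF S(1,3)])
      fix y assume "y \<in> ?S"
      then obtain q where q: "q \<in> fst c" "q \<in> fst d" "q \<in> V" "y = snd c q" by auto
      show "rep d Y (?\<tau> y) = der ?\<tau> y (rep c Y y)"
        using q c tangent_vector_transition[OF field_tangent[OF Y q(3)] c q(1,2)] by (simp add: rep_chart)
    qed
    moreover have "der (\<lambda>y. der ?\<tau> y (rep c Y y)) (snd c p) (X p c)
        = der (\<lambda>y. der ?\<tau> y (Y p c)) (snd c p) (X p c) + der ?\<tau> (snd c p) (der (rep c Y) (snd c p) (X p c))"
      using der_der_apply[OF overlap_open[OF c] transition_smooth[OF c] S sY, of "X p c"] c p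
      by (simp add: rep_chart)
    ultimately show ?thesis
      unfolding nabla_chart[OF c(1) p(1)] nabla_chart[OF c(2) p(2)]
        linear_add[OF linear_der_transition[OF c p]] christoffel_transition[OF c p]
        tangent_vector_transition[OF X c p, symmetric]
        tangent_vector_transition[OF field_tangent[OF Y V(2)] c p, symmetric]
      by (simp add: add.commute)
  qed
  moreover have "nabla A g X Y p c = 0" if "\<not> (c \<in> A \<and> p \<in> fst c)" for c
    using that by (auto simp: nabla_def)
  ultimately show ?thesis
    unfolding tangent_space_def by blast
qed

end

section \<open>The tangent bundle\<close>

context smooth_atlas
begin

lemma fst_tangent_chart: "Q \<in> fst (tangent_chart A c) \<longleftrightarrow> fst Q \<in> fst c \<and> snd Q \<in> tangent_space A (fst Q)"
  by (cases Q) (simp add: tangent_chart_def)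

lemma snd_tangent_chart: "snd (tangent_chart A c) Q = (snd c (fst Q), snd Q c)"
  by (cases Q) (simp add: tangent_chart_def)

lemma tangent_chart_image:
  assumes c: "c \<in> A" and S: "S \<subseteq> fst c"
  shows "snd (tangent_chart A c) ` (fst (tangent_chart A c) \<inter> {Q. fst Q \<in> S}) = (snd c ` S) \<times> UNIV"
proof (intro equalityI subsetI)
  fix z assume "z \<in> (snd c ` S) \<times> (UNIV :: 'e set)"
  then obtain p u where z: "z = (snd c p, u)" "p \<in> S" by auto
  then have p: "p \<in> fst c" using S by auto
  let ?Q = "(p, coord_vector A c p u)"
  have "?Q \<in> fst (tangent_chart A c)" "snd (tangent_chart A c) ?Q = z"
    using z p coord_vector_tangent[OF c p] coord_vector_self[OF c p]
    by (simp_all add: fst_tangent_chart snd_tangent_chart)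
  then show "z \<in> snd (tangent_chart A c) ` (fst (tangent_chart A c) \<inter> {Q. fst Q \<in> S})"
    using z(2) by force
qed (auto simp: snd_tangent_chart)

lemma tangent_chart_image_full:
  assumes "c \<in> A"
  shows "snd (tangent_chart A c) ` fst (tangent_chart A c) = (snd c ` fst c) \<times> UNIV"
proof -
  have "fst (tangent_chart A c) \<inter> {Q. fst Q \<in> fst c} = fst (tangent_chart A c)"
    by (auto simp: fst_tangent_chart)
  then show ?thesis using tangent_chart_image[OF assms order_refl] by simp
qed

lemma tangent_chart_inj: "c \<in> A \<Longrightarrow> inj_on (snd (tangent_chart A c)) (fst (tangent_chart A c))"
proof (rule inj_onI)
  fix P Q assume c: "c \<in> A" and P: "P \<in> fst (tangent_chart A c)" and Q: "Q \<in> fst (tangent_chart A c)"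
    and eq: "snd (tangent_chart A c) P = snd (tangent_chart A c) Q"
  have "fst P = fst Q"
    using P Q eq inj_onD[OF chart_inj[OF c], of "fst P" "fst Q"] by (simp add: fst_tangent_chart snd_tangent_chart)
  moreover have "snd P = snd Q"
    by (rule tangent_vector_eqI[OF c, of "fst Q"])
      (use P Q eq \<open>fst P = fst Q\<close> in \<open>simp_all add: fst_tangent_chart snd_tangent_chart\<close>)
  ultimately show "P = Q" by (rule prod_eqI)
qed

lemma tangent_chart_inv_chart:
  "c \<in> A \<Longrightarrow> Q \<in> fst (tangent_chart A c) \<Longrightarrow> chart_inv (tangent_chart A c) (snd c (fst Q), snd Q c) = Q"
  using inv_into_f_f[OF tangent_chart_inj, of c Q] by (simp add: chart_inv_def snd_tangent_chart)

lemma tangent_chart_inv: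
  assumes "c \<in> A" "p \<in> fst c"
  shows "chart_inv (tangent_chart A c) (snd c p, u) = (p, coord_vector A c p u)"
proof -
  have "(p, coord_vector A c p u) \<in> fst (tangent_chart A c)"
    by (simp add: fst_tangent_chart assms coord_vector_tangent)
  from tangent_chart_inv_chart[OF assms(1) this] show ?thesis using assms by simp
qed

lemma tangent_transition:
  assumes c: "c \<in> A" "d \<in> A" and x: "x \<in> snd c ` (fst c \<inter> fst d)"
  shows "transition (tangent_chart A c) (tangent_chart A d) (x, u) = (transition c d x, der (transition c d) x u)"
proof -
  obtain p where p: "p \<in> fst c" "p \<in> fst d" "x = snd c p" using x by auto
  show ?thesis
    using c p by (simp add: transition_def[of "tangent_chart A c"] tangent_chart_inv snd_tangent_chart coord_vector_apply)
qed

lemma tangent_overlap: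
  "fst (tangent_chart A c) \<inter> fst (tangent_chart A d) = fst (tangent_chart A c) \<inter> {Q. fst Q \<in> fst c \<inter> fst d}"
  by (auto simp: fst_tangent_chart)

lemma tangent_overlap_image:
  "c \<in> A \<Longrightarrow> snd (tangent_chart A c) ` (fst (tangent_chart A c) \<inter> fst (tangent_chart A d)) = snd c ` (fst c \<inter> fst d) \<times> UNIV"
  unfolding tangent_overlap by (rule tangent_chart_image) auto

lemma smooth_atlas_tangent: "smooth_atlas (tangent_atlas A)"
proof
  fix C D assume C: "C \<in> tangent_atlas A"
  then obtain c where c: "c \<in> A" "C = tangent_chart A c" by (auto simp: tangent_atlas_def)
  show "inj_on (snd C) (fst C)" using tangent_chart_inj c by simp
  show "open (snd C ` fst C)"
    unfolding c(2) tangent_chart_image_full[OF c(1)] by (intro open_Times chart_open c open_UNIV)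
  assume D: "D \<in> tangent_atlas A"
  then obtain d where d: "d \<in> A" "D = tangent_chart A d" by (auto simp: tangent_atlas_def)
  let ?P = "snd c ` (fst c \<inter> fst d) \<times> (UNIV :: 'e set)"
  have oP: "open ?P" by (intro open_Times overlap_open c d open_UNIV)
  then show "open (snd C ` (fst C \<inter> fst D))"
    unfolding c(2) d(2) tangent_overlap_image[OF c(1)] .
  note f = smooth_on_projections[OF oP]
  have "smooth_on ?P (\<lambda>Q. (transition c d (fst Q), der (transition c d) (fst Q) (snd Q)))"
    by (intro smooth_on_Pair oP smooth_on_compose[OF oP transition_smooth[OF c(1) d(1)] f(1)]
        smooth_on_linear_family[where L="der (transition c d)", OF oP smooth_on_der[OF transition_smooth[OF c(1) d(1)]]
          smooth_on_linear_der[OF transition_smooth[OF c(1) d(1)]] f(1) _ f(2)]) auto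
  then show "smooth_on (snd C ` (fst C \<inter> fst D)) (transition C D)"
    unfolding c(2) d(2) tangent_overlap_image[OF c(1)]
    by (rule smooth_on_eqI[OF _ oP]) (auto simp: tangent_transition[OF c(1) d(1)])
qed

lemma der_tangent_transition:
  assumes c: "c \<in> A" "d \<in> A" and p: "p \<in> fst c" "p \<in> fst d"
  shows "der (transition (tangent_chart A c) (tangent_chart A d)) (snd c p, u) (a, b)
    = (der (transition c d) (snd c p) a,
       der (\<lambda>y. der (transition c d) y u) (snd c p) a + der (transition c d) (snd c p) b)"
proof -
  let ?O = "snd c ` (fst c \<inter> fst d)"
  let ?P = "?O \<times> (UNIV :: 'e set)"
  let ?\<tau> = "transition c d"
  have oO: "open ?O" by (rule overlap_open[OF c])
  have oP: "open ?P" by (intro open_Times oO open_UNIV)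
  have xP: "(snd c p, u) \<in> ?P" "fst ` ?P \<subseteq> ?O" using p by auto
  note f = smooth_on_projections[OF oP]
  note df = der_projections
  note s\<tau> = transition_smooth[OF c]
  have fd: "fst differentiable at (snd c p, u)" "snd differentiable at (snd c p, u)"
    using f xP(1) smooth_on_differentiable by blast+
  have xO: "snd c p \<in> ?O" using p by auto
  have d1: "(\<lambda>Q. ?\<tau> (fst Q)) differentiable at (snd c p, u)"
    using smooth_on_compose[OF oP s\<tau> f(1) xP(2)] xP(1) smooth_on_differentiable by blast
  have fam: "(\<lambda>Q. der ?\<tau> (fst Q) (snd Q)) differentiable at (snd c p, u)"
    "der (\<lambda>Q. der ?\<tau> (fst Q) (snd Q)) (snd c p, u) (a, b)
      = der (\<lambda>y. der ?\<tau> y u) (snd c p) a + der ?\<tau> (snd c p) b"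
    using der_linear_family[where L="der ?\<tau>" and p=fst and f=snd, OF oO
        smooth_on_differentiable[OF smooth_on_der[OF s\<tau>]] smooth_on_linear_der[OF s\<tau>] oP xP fd]
    by (simp_all add: df)
  have "der (transition (tangent_chart A c) (tangent_chart A d)) (snd c p, u)
      = der (\<lambda>Q. (?\<tau> (fst Q), der ?\<tau> (fst Q) (snd Q))) (snd c p, u)"
    by (rule der_cong[OF oP xP(1)]) (auto simp: tangent_transition[OF c])
  then have "der (transition (tangent_chart A c) (tangent_chart A d)) (snd c p, u) (a, b)
      = (der (\<lambda>Q. ?\<tau> (fst Q)) (snd c p, u) (a, b), der (\<lambda>Q. der ?\<tau> (fst Q) (snd Q)) (snd c p, u) (a, b))"
    using der_Pair[OF d1 fam(1)] by simp
  also have "der (\<lambda>Q. ?\<tau> (fst Q)) (snd c p, u) (a, b) = der ?\<tau> (snd c p) a"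
    using der_compose[OF fd(1), of ?\<tau> "(a, b)"] smooth_on_differentiable[OF s\<tau> xO] by (simp add: df)
  finally show ?thesis unfolding fam(2) .
qed

end

locale sasaki = riemannian_atlas A g for A :: "('a, 'e::euclidean_space) chart set" and g +
  fixes G :: "('a \<times> ('a, 'e) tvec, 'e \<times> 'e) metric"
  assumes inj_tangent_chart: "inj_on (tangent_chart A) A"
    and sasaki: "sasaki_metric A g G"
begin

sublocale TM: riemannian_atlas "tangent_atlas A" G
  using smooth_atlas_tangent sasaki unfolding sasaki_metric_def
  by (simp add: riemannian_atlas_def riemannian_atlas_axioms_def)

lemma tangent_chart_in: "c \<in> A \<Longrightarrow> tangent_chart A c \<in> tangent_atlas A"
  by (simp add: tangent_atlas_def)

text \<open>The lifts are defined chart by chart, and their components have to be those of a single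
  tangent vector of TM. For the horizontal lift, the inhomogeneous term in the law of the
  Christoffel symbols matches the second derivative in
  \<open>der_tangent_transition\<close>.\<close>

lemma lift_eq_coord_vector:
  assumes c: "c \<in> A" and Q: "Q \<in> fst (tangent_chart A c)" and X: "X \<in> tangent_space A (fst Q)"
  shows "horizontal_lift A g Q X = coord_vector (tangent_atlas A) (tangent_chart A c) Q
      (X c, - christoffel A g c (snd c (fst Q)) (X c) (snd Q c))" (is ?H)
    and "vertical_lift A Q X = coord_vector (tangent_atlas A) (tangent_chart A c) Q (0, X c)" (is ?V)
proof -
  have p: "fst Q \<in> fst c" and v: "snd Q \<in> tangent_space A (fst Q)"
    using Q by (simp_all add: fst_tangent_chart)
  have "horizontal_lift A g Q X D = coord_vector (tangent_atlas A) (tangent_chart A c) Q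
      (X c, - christoffel A g c (snd c (fst Q)) (X c) (snd Q c)) D
    \<and> vertical_lift A Q X D = coord_vector (tangent_atlas A) (tangent_chart A c) Q (0, X c) D" for D
  proof (cases "D \<in> tangent_atlas A \<and> Q \<in> fst D")
    case True
    then obtain d where d: "d \<in> A" "D = tangent_chart A d" by (auto simp: tangent_atlas_def)
    have pd: "fst Q \<in> fst d" using True by (simp add: d fst_tangent_chart)
    have inv: "the_inv_into A (tangent_chart A) D = d"
      unfolding d by (rule the_inv_into_f_f[OF inj_tangent_chart d(1)])
    note l = linear_der_transition[OF c d(1) p pd]
    have "(X d, - christoffel A g d (snd d (fst Q)) (X d) (snd Q d))
      = der (transition (tangent_chart A c) D) (snd c (fst Q), snd Q c)
        (X c, - christoffel A g c (snd c (fst Q)) (X c) (snd Q c))"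
      unfolding d(2) der_tangent_transition[OF c d(1) p pd] linear_neg[OF l]
        christoffel_transition[OF c d(1) p pd]
        tangent_vector_transition[OF X c d(1) p pd, symmetric]
        tangent_vector_transition[OF v c d(1) p pd, symmetric] by simp
    moreover have "(0, X d) = der (transition (tangent_chart A c) D) (snd c (fst Q), snd Q c) (0, X c)"
    proof -
      have "linear (der (\<lambda>y. der (transition c d) y (snd Q c)) (snd c (fst Q)))"
        by (rule smooth_on_linear_der[OF smooth_on_der[OF transition_smooth[OF c d(1)]]]) (use p pd in auto)
      then show ?thesis
        unfolding d(2) der_tangent_transition[OF c d(1) p pd] linear_0[OF l]
          tangent_vector_transition[OF X c d(1) p pd, symmetric] by (simp add: linear_0)
    qed
    ultimately show ?thesis
      using True by (simp add: horizontal_lift_def vertical_lift_def coord_vector_def inv Let_def snd_tangent_chart)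
  next
    case False
    then show ?thesis by (auto simp: horizontal_lift_def vertical_lift_def coord_vector_def)
  qed
  then show ?H ?V by blast+
qed

text \<open>Any \<open>(a, b)\<close> is the horizontal lift of \<open>a\<close> plus the vertical
  lift of \<open>b + M.\<Gamma> x a u\<close>. The three conditions on lifts then give the
  coefficients by bilinearity.\<close>

lemma sasaki_coord_chart:
  assumes c: "c \<in> A"
  shows "sasaki_coord (snd c ` fst c) (metric_coord A g c) (metric_coord (tangent_atlas A) G (tangent_chart A c))"
proof -
  interpret M: coord_metric "snd c ` fst c" "metric_coord A g c" by (rule coord_metric_chart[OF c])
  interpret S: coord_metric "snd c ` fst c \<times> UNIV" "metric_coord (tangent_atlas A) G (tangent_chart A c)"
    using TM.coord_metric_chart[OF tangent_chart_in[OF c]] tangent_chart_image_full[OF c] by simp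
  let ?C = "tangent_chart A c"
  show ?thesis
  proof
    fix x u a b a' b' assume "x \<in> snd c ` fst c"
    then obtain p where p: "p \<in> fst c" "x = snd c p" by auto
    define Q where "Q = (p, coord_vector A c p u)"
    have Q: "Q \<in> fst ?C" "snd ?C Q = (x, u)"
      using p coord_vector_tangent[OF c p(1)] coord_vector_self[OF c p(1)]
      by (simp_all add: Q_def fst_tangent_chart snd_tangent_chart)
    note Cin = tangent_chart_in[OF c]
    note QC = TM.in_carrier[OF Cin Q(1)]
    define h where "h a = horizontal_lift A g Q (coord_vector A c p a)" for a
    define v where "v a b = vertical_lift A Q (coord_vector A c p (b + M.\<Gamma> x a u))" for a b
    note cv = coord_vector_tangent[OF c p(1)]
    have cvQ: "coord_vector A c p a \<in> tangent_space A (fst Q)" for a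
      using cv by (simp add: Q_def)
    have h: "h a = coord_vector (tangent_atlas A) ?C Q (a, - M.\<Gamma> x a u)" for a
      unfolding h_def lift_eq_coord_vector(1)[OF c Q(1) cvQ] using c p
      by (simp add: Q_def christoffel_eq_levi_civita)
    have v: "v a b = coord_vector (tangent_atlas A) ?C Q (0, b + M.\<Gamma> x a u)" for a b
      unfolding v_def lift_eq_coord_vector(2)[OF c Q(1) cvQ] using c p by simp
    have t: "h a \<in> tangent_space (tangent_atlas A) Q" "v a b \<in> tangent_space (tangent_atlas A) Q" for a b
      unfolding h v by (rule TM.coord_vector_tangent[OF Cin Q(1)])+
    have sum: "coord_vector (tangent_atlas A) ?C Q (a, b) = h a + v a b" for a b
      unfolding h v TM.coord_vector_linear(1)[OF Cin Q(1), symmetric] by simp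
    have s: "G Q (h a) (h a') = metric_coord A g c x a a'"
      "G Q (h a) (v a' b') = 0"
      "G Q (v a b) (v a' b') = metric_coord A g c x (b + M.\<Gamma> x a u) (b' + M.\<Gamma> x a' u)" for a b a' b'
      using sasaki QC cvQ c p unfolding sasaki_metric_def h_def v_def by (auto simp: metric_coord_chart Q_def)
    have "metric_coord (tangent_atlas A) G ?C (x, u) (a, b) (a', b') = G Q (h a + v a b) (h a' + v a' b')"
      unfolding Q(2)[symmetric] TM.metric_coord_chart[OF Cin Q(1)] sum ..
    also have "\<dots> = G Q (h a) (h a') + G Q (h a) (v a' b') + (G Q (v a b) (h a') + G Q (v a b) (v a' b'))"
      by (simp add: TM.g_add_left[OF QC] TM.g_add_right[OF QC] t TM.tangent_space_add)
    also have "G Q (v a b) (h a') = 0" using TM.g_sym[OF QC t(2) t(1)] s(2) by simp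
    finally show "metric_coord (tangent_atlas A) G ?C (x, u) (a, b) (a', b')
      = metric_coord A g c x a a' + metric_coord A g c x (b + M.\<Gamma> x a u) (b' + M.\<Gamma> x a' u)"
      using s by simp
  qed
qed

end

section \<open>Charts of the unit tangent bundle\<close>

text \<open>\<open>l\<close> is the projection along \<open>k\<close> onto its orthogonal
  complement, identified with the model space by a linear isometry, and \<sigma> is the inverse
  identification. The dimension condition makes the identification possible.\<close>

lemma hyperplane_projection:
  fixes k :: "'v::euclidean_space"
  assumes "k \<noteq> 0" "DIM('f::euclidean_space) + 1 = DIM('v)"
  obtains l :: "'v \<Rightarrow> 'f::euclidean_space" and \<sigma> where "linear l" "linear \<sigma>" "l k = 0"
    "\<And>y. l (\<sigma> y) = y" "\<And>z. \<exists>s. \<sigma> (l z) = z - s *\<^sub>R k"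
proof -
  have "dim (UNIV :: 'f set) = dim {x. k \<bullet> x = 0}"
    using assms by (simp add: dim_hyperplane)
  from isometries_subspaces[OF subspace_UNIV subspace_hyperplane this]
  obtain f :: "'f \<Rightarrow> 'v" and f' where f: "linear f" "linear f'" and fi: "f ` UNIV = {x. k \<bullet> x = 0}"
    and "f' ` {x. k \<bullet> x = 0} = UNIV"
    and "\<And>x. x \<in> UNIV \<Longrightarrow> norm (f x) = norm x" "\<And>x. x \<in> {x. k \<bullet> x = 0} \<Longrightarrow> norm (f' x) = norm x"
    and ff: "\<And>x. x \<in> UNIV \<Longrightarrow> f' (f x) = x" "\<And>x. x \<in> {x. k \<bullet> x = 0} \<Longrightarrow> f (f' x) = x"
    by blast
  define pr where "pr z = z - ((k \<bullet> z) / (k \<bullet> k)) *\<^sub>R k" for z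
  have kpr: "k \<bullet> pr z = 0" for z using assms(1) by (simp add: pr_def inner_diff_right)
  have "linear pr"
    by (rule linearI) (simp_all add: pr_def inner_add_right add_divide_distrib algebra_simps)
  then have "linear (f' \<circ> pr)" by (rule linear_compose[OF _ f(2)])
  moreover have "pr k = 0" using assms(1) by (simp add: pr_def)
  moreover have "f' (pr (f y)) = y" for y
  proof -
    have "k \<bullet> f y = 0" using fi by blast
    then show ?thesis by (simp add: pr_def ff(1))
  qed
  moreover have "f (f' (pr z)) = z - ((k \<bullet> z) / (k \<bullet> k)) *\<^sub>R k" for z
    using ff(2)[of "pr z"] kpr by (simp add: pr_def)
  ultimately show thesis
    by (intro that[of "f' \<circ> pr" f]) (use f(1) linear_0[OF f(2)] in auto)
qed

text \<open>Near a vector with \<open>M(u, u\<^sub>0) > 0\<close> the unit sphere bundle is a graph in the direction \<open>u\<^sub>0\<close>: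
  the height is the larger root of a quadratic equation.\<close>

lemma (in coord_metric) unit_sphere_parametrization:
  fixes l :: "'e \<times> 'e \<Rightarrow> 'f::euclidean_space"
  assumes l: "linear l" "linear \<sigma>" "l (0, u0) = 0" "\<And>y. l (\<sigma> y) = y" "\<And>z. \<exists>s. \<sigma> (l z) = z - s *\<^sub>R (0, u0)"
    and u0: "u0 \<noteq> 0"
  obtains D F where "open D" "smooth_on D F"
    "\<And>y. y \<in> D \<Longrightarrow> fst (F y) \<in> \<Omega> \<and> M (fst (F y)) (snd (F y)) (snd (F y)) = 1 \<and> M (fst (F y)) (snd (F y)) u0 > 0 \<and> l (F y) = y"
    "\<And>x u. x \<in> \<Omega> \<Longrightarrow> M x u u = 1 \<Longrightarrow> M x u u0 > 0 \<Longrightarrow> l (x, u) \<in> D \<and> F (l (x, u)) = (x, u)"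
proof -
  define X where "X y = fst (\<sigma> y)" for y
  define w where "w y = snd (\<sigma> y)" for y
  define a where "a y = M (X y) u0 u0" for y
  define b where "b y = M (X y) (w y) u0" for y
  define q where "q y = M (X y) (w y) (w y)" for y
  \<comment> \<open>For \<open>t\<close> the equation M(w + t u0, w + t u0) = 1 reads a t^2 + 2 b t
    + (q - 1) = 0; \<open>disc\<close> is a quarter of its discriminant.\<close>
  define disc where "disc y = b y * b y - a y * (q y - 1)" for y
  define t where "t y = (sqrt (disc y) - b y) / a y" for y
  define F where "F y = (X y, w y + t y *\<^sub>R u0)" for y
  define E where "E = X -` \<Omega>"
  define D where "D = E \<inter> disc -` {0<..}"
  have XU: "smooth_on UNIV X" "smooth_on UNIV w"
    unfolding X_def w_def by (intro smooth_intros open_UNIV smooth_on_linear l)+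
  have oE: "open E"
    using open_preimage_Int[OF XU(1) open_UNIV open_dom] by (simp add: E_def)
  have Xw: "smooth_on E X" "smooth_on E w" using XU smooth_on_subset by blast+
  have XE: "X ` E \<subseteq> \<Omega>" by (auto simp: E_def)
  have abq: "smooth_on E a" "smooth_on E b" "smooth_on E q"
    unfolding a_def b_def q_def by (intro M_smooth_on oE Xw XE smooth_on_const)+
  have "smooth_on E disc"
    unfolding disc_def by (intro smooth_intros oE abq)
  then have disc: "smooth_on D disc" by (rule smooth_on_subset) (auto simp: D_def)
  have oD: "open D"
    unfolding D_def by (rule open_preimage_Int[OF \<open>smooth_on E disc\<close> oE]) simp
  have apos: "a y > 0" if "y \<in> E" for y using that M_pos[OF _ u0] by (auto simp: a_def E_def)
  have DE: "D \<subseteq> E" by (auto simp: D_def)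
  note sD = smooth_on_subset[OF _ DE]
  have "smooth_on D t"
    unfolding t_def
  proof (intro smooth_on_divide smooth_on_diff smooth_on_sqrt oD disc sD[OF abq(1)] sD[OF abq(2)])
    show "disc y > 0" if "y \<in> D" for y using that by (simp add: D_def)
    show "a y \<noteq> 0" if "y \<in> D" for y using that apos DE by force
  qed
  then have sF: "smooth_on D F"
    unfolding F_def by (intro smooth_on_Pair smooth_on_add smooth_on_scaleR oD sD[OF Xw(1)] sD[OF Xw(2)] smooth_on_const)
  have "fst (F y) \<in> \<Omega> \<and> M (fst (F y)) (snd (F y)) (snd (F y)) = 1 \<and> M (fst (F y)) (snd (F y)) u0 > 0 \<and> l (F y) = y"
    if y: "y \<in> D" for y
  proof -
    have X: "X y \<in> \<Omega>" and dp: "disc y > 0" using y by (auto simp: D_def E_def)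
    have a: "a y > 0" using apos y DE by auto
    \<comment> \<open>The larger root is the one for which the product with \<open>u0\<close> is
      positive: that product equals \<open>sqrt (disc y)\<close>.\<close>
    have u: "M (X y) (w y + t y *\<^sub>R u0) u0 = b y + t y * a y"
      by (simp add: M_arith[OF X] a_def b_def)
    also have r: "\<dots> = sqrt (disc y)" using a by (simp add: t_def)
    finally have pos: "M (X y) (w y + t y *\<^sub>R u0) u0 > 0" using dp by simp
    have "M (X y) (w y + t y *\<^sub>R u0) (w y + t y *\<^sub>R u0) = q y + 2 * t y * b y + t y * t y * a y"
      by (simp add: M_arith[OF X] a_def b_def q_def M_sym[OF X, of u0 "w y"] algebra_simps)
    moreover have "a y * (q y + 2 * t y * b y + t y * t y * a y) = a y * q y + (b y + t y * a y) * (b y + t y * a y) - b y * b y"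
      by (simp add: algebra_simps)
    moreover have "(b y + t y * a y) * (b y + t y * a y) = disc y" unfolding r using dp by simp
    ultimately have "a y * M (X y) (w y + t y *\<^sub>R u0) (w y + t y *\<^sub>R u0) = a y * 1"
      by (simp add: disc_def algebra_simps)
    then have one: "M (X y) (w y + t y *\<^sub>R u0) (w y + t y *\<^sub>R u0) = 1" using a by simp
    have "F y = \<sigma> y + t y *\<^sub>R (0, u0)" by (simp add: F_def X_def w_def prod_eq_iff)
    then have "l (F y) = y" by (simp only: linear_add[OF l(1)] linear_scale[OF l(1)] l(3,4)) simp
    then show ?thesis using X one pos by (simp add: F_def)
  qed
  moreover have "l (x, u) \<in> D \<and> F (l (x, u)) = (x, u)" if x: "x \<in> \<Omega>" and u: "M x u u = 1" "M x u u0 > 0" for x u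
  proof -
    let ?y = "l (x, u)"
    obtain s where s: "\<sigma> ?y = (x, u) - s *\<^sub>R (0, u0)" using l(5) by blast
    then have X: "X ?y = x" and w: "w ?y = u - s *\<^sub>R u0" by (simp_all add: X_def w_def)
    define m where "m = M x u u0"
    have a: "a ?y > 0" using apos[of ?y] x X by (simp add: E_def)
    \<comment> \<open>The point found by \<sigma> on the line through \<open>u\<close> differs from
      \<open>u\<close> by a multiple of \<open>u0\<close>. The discriminant does not see this shift:
      it is M(u, u0)^2, and its positive root leads back to \<open>u\<close>.\<close>
    have ab: "b ?y = m - s * a ?y" "q ?y = 1 - 2 * s * m + s * s * a ?y"
      using u by (simp_all add: b_def q_def a_def X w M_arith[OF x] m_def M_sym[OF x, of u0 u] algebra_simps)
    have d: "disc ?y = m * m" unfolding disc_def ab by (simp add: algebra_simps)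
    have m: "m > 0" using u by (simp add: m_def)
    then have "sqrt (disc ?y) = m" using d by simp
    then have "t ?y = s" using a by (simp add: t_def ab)
    then show ?thesis using X w d m x by (simp add: D_def E_def F_def)
  qed
  ultimately show thesis using that[OF oD sF] by blast
qed

lemma (in smooth_atlas) openin_chart_preimage:
  assumes c: "c \<in> A" and Z: "open Z"
  shows "openin (atlas_topology A) {p \<in> fst c. snd c p \<in> Z}"
  unfolding openin_iff
proof (intro conjI ballI)
  show "{p \<in> fst c. snd c p \<in> Z} \<subseteq> atlas_carrier A" using c by (auto simp: atlas_carrier_def)
  fix d assume d: "d \<in> A"
  have "snd d ` (fst d \<inter> {p \<in> fst c. snd c p \<in> Z}) = snd d ` (fst d \<inter> fst c) \<inter> transition d c -` Z"
    using d by auto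
  then show "open (snd d ` (fst d \<inter> {p \<in> fst c. snd c p \<in> Z}))"
    using open_preimage_Int[OF transition_smooth[OF d c] overlap_open[OF d c] Z] by simp
qed

locale unit_bundle = sasaki A g G for A :: "('a, 'e::euclidean_space) chart set" and g G +
  fixes T1 :: "('a \<times> ('a, 'e) tvec, 'f::euclidean_space) chart set"
  assumes T1_eq: "T1 = unit_tangent_atlas A g"
    and dim_T1: "DIM('f) + 1 = 2 * DIM('e)"
begin

lemma T1_submanifold: "T1 = submanifold_atlas (tangent_atlas A) (unit_tangent_bundle A g)"
  by (simp add: T1_eq unit_tangent_atlas_def)

lemma T1_submanifold_chart: "d \<in> T1 \<Longrightarrow> d \<in> submanifold_atlas (tangent_atlas A) (unit_tangent_bundle A g)"
  by (simp add: T1_submanifold)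

sublocale T1: smooth_atlas T1
  unfolding T1_submanifold by (rule TM.smooth_atlas_submanifold)

lemma unit_bundle_iff:
  assumes c: "c \<in> A" and Q: "Q \<in> fst (tangent_chart A c)"
  shows "Q \<in> unit_tangent_bundle A g \<longleftrightarrow> metric_coord A g c (snd c (fst Q)) (snd Q c) (snd Q c) = 1"
  using Q g_eq_metric_coord[OF c, of "fst Q" "snd Q" "snd Q"] in_carrier[OF c, of "fst Q"]
  by (cases Q) (simp add: fst_tangent_chart unit_tangent_bundle_def)

text \<open>The atlas of the unit tangent bundle is the set of all charts of a subset of TM, so
  charts have to be exhibited. Around \<open>Q0\<close> the projection of the coordinates along its
  own fibre vector is one, since the product of a unit vector with itself is positive.\<close>

lemma T1_covers:
  assumes Q0: "Q0 \<in> unit_tangent_bundle A g"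
  obtains d where "d \<in> T1" "Q0 \<in> fst d"
proof -
  obtain p0 v0 where pv: "Q0 = (p0, v0)" "p0 \<in> atlas_carrier A" "v0 \<in> tangent_space A p0" "g p0 v0 v0 = 1"
    using Q0 by (auto simp: unit_tangent_bundle_def)
  obtain c where c: "c \<in> A" "p0 \<in> fst c" using pv(2) by (auto simp: atlas_carrier_def)
  let ?C = "tangent_chart A c"
  let ?N = "unit_tangent_bundle A g"
  interpret M: coord_metric "snd c ` fst c" "metric_coord A g c" by (rule coord_metric_chart[OF c(1)])
  note Cin = tangent_chart_in[OF c(1)]
  have Q0C: "Q0 \<in> fst ?C" using c pv by (simp add: fst_tangent_chart)
  define u0 where "u0 = v0 c"
  have M0: "metric_coord A g c (snd c p0) u0 u0 = 1"
    using unit_bundle_iff[OF c(1) Q0C] Q0 by (simp add: pv u0_def)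
  have p0: "snd c p0 \<in> snd c ` fst c" using c by auto
  have u0: "u0 \<noteq> 0"
    using M0 M.M_arith(9)[OF p0] by force
  have "(0 :: 'e, u0) \<noteq> 0" "DIM('f) + 1 = DIM('e \<times> 'e)" using u0 dim_T1 by (auto simp: prod_eq_iff)
  then obtain l :: "'e \<times> 'e \<Rightarrow> 'f" and \<sigma> where l: "linear l" "linear \<sigma>" "l (0, u0) = 0"
    "\<And>y. l (\<sigma> y) = y" "\<And>z. \<exists>s. \<sigma> (l z) = z - s *\<^sub>R (0, u0)"
    using hyperplane_projection[of "(0, u0)"] by metis
  obtain D F where D: "open D" "smooth_on D F"
    and D1: "\<And>y. y \<in> D \<Longrightarrow> fst (F y) \<in> snd c ` fst c \<and> metric_coord A g c (fst (F y)) (snd (F y)) (snd (F y)) = 1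
      \<and> metric_coord A g c (fst (F y)) (snd (F y)) u0 > 0 \<and> l (F y) = y"
    and D2: "\<And>x u. x \<in> snd c ` fst c \<Longrightarrow> metric_coord A g c x u u = 1 \<Longrightarrow> metric_coord A g c x u u0 > 0
      \<Longrightarrow> l (x, u) \<in> D \<and> F (l (x, u)) = (x, u)"
    using M.unit_sphere_parametrization[OF l u0] by blast
  define Z where "Z = {z \<in> (snd c ` fst c) \<times> UNIV. metric_coord A g c (fst z) (snd z) u0 > 0}"
  have oP: "open ((snd c ` fst c) \<times> (UNIV :: 'e set))" by (intro open_Times M.open_dom open_UNIV)
  have "smooth_on ((snd c ` fst c) \<times> UNIV) (\<lambda>z. metric_coord A g c (fst z) (snd z) u0)"
    by (intro M.M_smooth_on oP smooth_intros) auto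
  from open_preimage_Int[OF this oP, of "{0<..}"] have oZ: "open Z"
    by (simp add: Z_def vimage_def Int_def)
  define T where "T = {Q \<in> fst ?C. snd ?C Q \<in> Z}"
  define W where "W = ?N \<inter> T"
  define \<psi> where "\<psi> Q = l (snd ?C Q)" for Q
  have WC: "W \<subseteq> fst ?C" by (auto simp: W_def T_def)
  have W: "\<psi> Q \<in> D" "F (\<psi> Q) = snd ?C Q" if "Q \<in> W" for Q
  proof -
    have Q: "Q \<in> fst ?C" "Q \<in> ?N" "snd ?C Q \<in> Z" using that by (auto simp: W_def T_def)
    have "l (snd c (fst Q), snd Q c) \<in> D \<and> F (l (snd c (fst Q), snd Q c)) = (snd c (fst Q), snd Q c)"
      by (rule D2) (use Q unit_bundle_iff[OF c(1) Q(1)] in \<open>auto simp: Z_def snd_tangent_chart fst_tangent_chart\<close>)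
    then show "\<psi> Q \<in> D" "F (\<psi> Q) = snd ?C Q" by (simp_all add: \<psi>_def snd_tangent_chart)
  qed
  have D3: "\<exists>Q\<in>W. \<psi> Q = y" if y: "y \<in> D" for y
  proof -
    obtain p where p: "p \<in> fst c" "fst (F y) = snd c p" using D1[OF y] by auto
    define Q where "Q = (p, coord_vector A c p (snd (F y)))"
    have Q: "Q \<in> fst ?C" "snd ?C Q = F y"
      using p c(1) coord_vector_tangent[OF c(1) p(1)]
      by (simp_all add: Q_def fst_tangent_chart snd_tangent_chart prod_eq_iff)
    have "Q \<in> ?N"
      using unit_bundle_iff[OF c(1) Q(1)] D1[OF y] Q(2) by (simp add: snd_tangent_chart prod_eq_iff)
    moreover have "snd ?C Q \<in> Z" unfolding Q(2) using D1[OF y] by (simp add: Z_def mem_Times_iff)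
    ultimately have "Q \<in> W" using Q(1) by (simp add: W_def T_def)
    moreover have "\<psi> Q = y" using D1[OF y] Q(2) by (simp add: \<psi>_def)
    ultimately show ?thesis by blast
  qed
  have img: "\<psi> ` W = D" using W(1) D3 by blast
  have inj: "inj_on \<psi> W"
  proof (rule inj_onI)
    fix Q R assume "Q \<in> W" "R \<in> W" "\<psi> Q = \<psi> R"
    then have "snd ?C Q = snd ?C R" using W(2) by metis
    then show "Q = R" using inj_onD[OF TM.chart_inj[OF Cin]] WC \<open>Q \<in> W\<close> \<open>R \<in> W\<close> by blast
  qed
  have sp: "smooth_on D (TM.par (W, \<psi>) ?C)"
  proof (rule smooth_on_eqI[OF D(2,1)])
    fix y assume "y \<in> D"
    then obtain Q where Q: "Q \<in> W" "y = \<psi> Q" using D3 by blast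
    then have "chart_inv (W, \<psi>) y = Q" by (simp add: chart_inv_def inv_into_f_f inj)
    then show "TM.par (W, \<psi>) ?C y = F y" using W(2)[OF Q(1)] Q(2) by (simp add: TM.par_def)
  qed
  have "(W, \<psi>) \<in> submanifold_atlas (tangent_atlas A) ?N"
  proof (rule TM.submanifold_atlasI[where T=T])
    show "openin (atlas_topology (tangent_atlas A)) T"
      unfolding T_def by (rule TM.openin_chart_preimage[OF Cin oZ])
    show "W = ?N \<inter> T" by (rule W_def)
    show "inj_on \<psi> W" by (rule inj)
    show "open (\<psi> ` W)" unfolding img by (rule D(1))
    fix Q assume "Q \<in> W"
    have WW: "W \<inter> fst ?C = W" using WC by auto
    \<comment> \<open>The chart \<psi> is the linear map \<open>l\<close> applied to coordinates of
      TM, so \<open>l\<close> itself, on the whole space, is the smooth extension that is asked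
      for.\<close>
    have "smooth_on UNIV l" by (rule smooth_on_linear[OF l(1)])
    then show "\<exists>e\<in>tangent_atlas A. Q \<in> fst e \<and> open (\<psi> ` (W \<inter> fst e)) \<and> smooth_on (\<psi> ` (W \<inter> fst e)) (TM.par (W, \<psi>) e) \<and>
      (\<exists>S h. open S \<and> snd e Q \<in> S \<and> smooth_on S h \<and> (\<forall>q\<in>W \<inter> fst e. snd e q \<in> S \<longrightarrow> h (snd e q) = \<psi> q))"
      using Cin \<open>Q \<in> W\<close> WC D(1) sp
      by (intro bexI[of _ ?C] conjI exI[of _ UNIV] exI[of _ l]) (auto simp: WW img \<psi>_def[symmetric])
  qed
  moreover have "Q0 \<in> W"
    using Q0 Q0C M0 p0 by (simp add: W_def T_def Z_def snd_tangent_chart u0_def pv)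
  ultimately show thesis using that[of "(W, \<psi>)"] by (simp add: T1_submanifold)
qed

lemma T1_carrier: "atlas_carrier T1 = unit_tangent_bundle A g"
proof
  show "atlas_carrier T1 \<subseteq> unit_tangent_bundle A g"
    unfolding T1_submanifold atlas_carrier_def using TM.submanifold_chartD(2) by blast
  show "unit_tangent_bundle A g \<subseteq> atlas_carrier T1"
    unfolding atlas_carrier_def using T1_covers by blast
qed

section \<open>The inclusion of the unit tangent bundle into TM, in charts\<close>

context
  fixes c :: "('a, 'e) chart" and d :: "('a \<times> ('a, 'e) tvec, 'f) chart"
  assumes c: "c \<in> A" and d: "d \<in> T1"
begin

abbreviation "tchart \<equiv> tangent_chart A c"
abbreviation "incl \<equiv> TM.par d tchart"
abbreviation "incl_dom \<equiv> snd d ` (fst d \<inter> fst tchart)"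

lemmas T1_chart = T1_submanifold_chart[OF d]

interpretation SC: sasaki_coord "snd c ` fst c" "metric_coord A g c" "metric_coord (tangent_atlas A) G tchart"
  by (rule sasaki_coord_chart[OF c])

lemma incl_dom_open: "open incl_dom" by (rule TM.submanifold_chartD(6)[OF T1_chart tangent_chart_in[OF c]])

lemma incl_smooth: "smooth_on incl_dom incl" by (rule TM.submanifold_chartD(7)[OF T1_chart tangent_chart_in[OF c]])

lemma incl_chart: "Q \<in> fst d \<Longrightarrow> incl (snd d Q) = (snd c (fst Q), snd Q c)"
  by (simp add: TM.par_chart[OF T1_chart] snd_tangent_chart)

lemma incl_image: "incl ` incl_dom \<subseteq> snd c ` fst c \<times> UNIV"
  using incl_chart by (auto simp: fst_tangent_chart)

lemma der_incl_inj: "y \<in> incl_dom \<Longrightarrow> der incl y v = der incl y w \<Longrightarrow> v = w"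
  using TM.der_par_inj[OF T1_chart tangent_chart_in[OF c]] by blast

lemma linear_der_incl: "y \<in> incl_dom \<Longrightarrow> linear (der incl y)"
  by (rule smooth_on_linear_der[OF incl_smooth])

lemma incl_unit:
  assumes "y \<in> incl_dom" shows "metric_coord A g c (fst (incl y)) (snd (incl y)) (snd (incl y)) = 1"
proof -
  obtain Q where Q: "Q \<in> fst d" "Q \<in> fst tchart" "y = snd d Q" using assms by blast
  have "Q \<in> unit_tangent_bundle A g" using Q(1) TM.submanifold_chartD(2)[OF T1_chart] by blast
  then show ?thesis using unit_bundle_iff[OF c Q(2)] Q incl_chart[OF Q(1)] by simp
qed

lemma fst_incl_in:
  assumes "y \<in> incl_dom" shows "fst (incl y) \<in> snd c ` fst c"
proof -
  have "incl y \<in> snd c ` fst c \<times> UNIV" using incl_image assms by blast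
  then show ?thesis by (simp add: mem_Times_iff)
qed

text \<open>Differentiating M(u, u) = 1 shows that the differential takes values in the complement
  of the normal \<open>(0, u)\<close>. That complement is proper, hence of dimension at most
  \<open>2 * DIM('e) - 1\<close>, which is the rank of the injective differential.\<close>

lemma range_der_incl:
  assumes y: "y \<in> incl_dom"
  shows "range (der incl y) = {w. metric_coord A g c (fst (incl y)) (SC.conn (fst (incl y)) (snd (incl y)) w) (snd (incl y)) = 0}"
    (is "_ = ?H")
proof -
  let ?M = "metric_coord A g c"
  let ?x = "fst (incl y)"
  let ?u = "snd (incl y)"
  have x: "?x \<in> snd c ` fst c" by (rule fst_incl_in[OF y])
  have "der incl y v \<in> ?H" for v
  proof -
    have f: "smooth_on incl_dom (\<lambda>y. fst (incl y))" "smooth_on incl_dom (\<lambda>y. snd (incl y))"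
      by (intro smooth_intros incl_dom_open incl_smooth)+
    have df: "der (\<lambda>y. fst (incl y)) y v = fst (der incl y v)" "der (\<lambda>y. snd (incl y)) y v = snd (der incl y v)"
      using der_bounded_linear[OF bounded_linear_fst smooth_on_differentiable[OF incl_smooth y]]
        der_bounded_linear[OF bounded_linear_snd smooth_on_differentiable[OF incl_smooth y]] by auto
    have "der (\<lambda>y. ?M (fst (incl y)) (snd (incl y)) (snd (incl y))) y = der (\<lambda>_. 1) y"
      by (rule der_cong[OF incl_dom_open y incl_unit])
    then have "der (\<lambda>y. ?M (fst (incl y)) (snd (incl y)) (snd (incl y))) y v = 0" by simp
    moreover have "(\<lambda>y. fst (incl y)) ` incl_dom \<subseteq> snd c ` fst c" using fst_incl_in by blast
    ultimately have "2 * ?M ?x (SC.conn ?x ?u (der incl y v)) ?u = 0"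
      using SC.der_M[OF incl_dom_open y _ f(1,2,2), of v] x
      by (simp add: df SC.metric_compatible[OF x] SC.M_arith[OF x] SC.conn_def SC.M_sym[OF x, of ?u])
    then show ?thesis by simp
  qed
  then have sub: "range (der incl y) \<subseteq> ?H" by blast
  have H: "subspace ?H"
    unfolding subspace_def by (auto simp: SC.conn_arith[OF x] SC.M_arith[OF x])
  have "(0, ?u) \<notin> ?H"
    using incl_unit[OF y] by (simp add: SC.conn_def SC.levi_civita_arith[OF x])
  then have "?H \<noteq> UNIV" by blast
  then have "dim ?H < DIM('e \<times> 'e)"
    using dim_eq_full[of ?H] dim_subset_UNIV[of ?H] span_eq_iff[of ?H] H by (metis le_neq_implies_less)
  moreover have "dim (range (der incl y)) = DIM('f)"
  proof -
    have "inj (der incl y)" using der_incl_inj[OF y] by (auto simp: inj_on_def)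
    then show ?thesis using dim_image_eq[OF linear_der_incl[OF y], of UNIV] by simp
  qed
  ultimately have "dim (range (der incl y)) \<ge> dim ?H" using dim_T1 by simp
  moreover have "subspace (range (der incl y))" by (rule linear_subspace_image[OF linear_der_incl[OF y] subspace_UNIV])
  ultimately show ?thesis using subspace_dim_equal H sub by blast
qed

abbreviation "induced \<equiv> induced_metric (tangent_atlas A) G T1"

lemma induced_metric_pullback:
  assumes y: "y \<in> incl_dom"
  shows "metric_coord T1 induced d y v w = metric_coord (tangent_atlas A) G tchart (incl y) (der incl y v) (der incl y w)"
proof -
  obtain Q where Q: "Q \<in> fst d" "Q \<in> fst tchart" "y = snd d Q" using y by blast
  have cv: "coord_vector T1 d Q v \<in> tangent_space T1 Q" for v
    by (rule T1.coord_vector_tangent[OF d Q(1)])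
  have "pushforward T1 (tangent_atlas A) (\<lambda>q. q) Q (coord_vector T1 d Q v)
      = coord_vector (tangent_atlas A) tchart Q (der incl y v)" for v
    using TM.pushforward_eq_push[OF T1_chart Q(1), folded T1_submanifold, OF cv]
      TM.push_eq_coord_vector[OF T1_chart Q(1) tangent_chart_in[OF c] Q(2)] T1.coord_vector_self[OF d Q(1)] Q(3) by simp
  then have "metric_coord T1 induced d y v w
      = G Q (coord_vector (tangent_atlas A) tchart Q (der incl y v)) (coord_vector (tangent_atlas A) tchart Q (der incl y w))"
    unfolding metric_coord_def induced_metric_def using T1.chart_inv_chart[OF d Q(1)] Q(3) by simp
  also have "\<dots> = metric_coord (tangent_atlas A) G tchart (incl y) (der incl y v) (der incl y w)"
    using TM.metric_coord_chart[OF tangent_chart_in[OF c] Q(2)] incl_chart[OF Q(1)] Q(3)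
    by (simp add: snd_tangent_chart)
  finally show ?thesis .
qed

lemma induced_coord_metric: "coord_metric incl_dom (metric_coord T1 induced d)"
proof (rule pullback_coord_metric[OF SC.S.coord_metric_axioms incl_dom_open incl_smooth incl_image _ induced_metric_pullback])
  fix y v assume "y \<in> incl_dom" "der incl y v = 0"
  then show "v = 0" using der_incl_inj[of y v 0] linear_0[OF linear_der_incl] by simp
qed

text \<open>The derivative formed in TM may have a component normal to the unit tangent bundle,
  which products with tangent vectors do not see.\<close>

lemma nabla_pullback:
  assumes Q: "Q \<in> fst d" "Q \<in> fst tchart" and S: "openin (atlas_topology T1) S" "Q \<in> S"
    and Y: "smooth_vector_field T1 S Y"
  shows "metric_coord (tangent_atlas A) G tchart (incl (snd d Q)) (der incl (snd d Q) (nabla T1 induced X Y Q d)) (der incl (snd d Q) z)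
    = metric_coord (tangent_atlas A) G tchart (incl (snd d Q))
       (der (\<lambda>y. der incl y (T1.rep d Y y)) (snd d Q) (X Q d)
        + levi_civita (metric_coord (tangent_atlas A) G tchart) (incl (snd d Q)) (der incl (snd d Q) (X Q d)) (der incl (snd d Q) (Y Q d)))
       (der incl (snd d Q) z)"
proof -
  let ?y = "snd d Q"
  let ?S = "incl_dom \<inter> snd d ` (fst d \<inter> S)"
  have y: "?y \<in> incl_dom" using Q by blast
  have yS: "?y \<in> ?S" using Q S by blast
  have oS: "open ?S" using incl_dom_open T1.open_image[OF d S(1)] by (rule open_Int)
  have sY: "smooth_on ?S (T1.rep d Y)"
    by (rule smooth_on_subset[OF T1.smooth_rep[OF Y d]]) blast
  have "metric_coord T1 induced d ?y (nabla T1 induced X Y Q d) z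
    = metric_coord T1 induced d ?y (der (T1.rep d Y) ?y (X Q d) + levi_civita (metric_coord T1 induced d) ?y (X Q d) (T1.rep d Y ?y)) z"
    unfolding T1.nabla_chart[OF d Q(1)] christoffel_eq_levi_civita T1.rep_chart[OF d Q(1)] ..
  also have "\<dots> = metric_coord (tangent_atlas A) G tchart (incl ?y)
      (der (\<lambda>y. der incl y (T1.rep d Y y)) ?y (X Q d) + levi_civita (metric_coord (tangent_atlas A) G tchart) (incl ?y) (der incl ?y (X Q d)) (der incl ?y (T1.rep d Y ?y)))
      (der incl ?y z)"
    by (rule pullback_covariant_derivative[OF induced_coord_metric SC.S.coord_metric_axioms incl_smooth incl_image
          induced_metric_pullback oS Int_lower1 yS sY])
  finally show ?thesis
    unfolding induced_metric_pullback[OF y] T1.rep_chart[OF d Q(1)] .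
qed

end

end

section \<open>The defect of a unit vector field in a chart\<close>

locale unit_field = riemannian_atlas A g for A :: "('a, 'e::euclidean_space) chart set" and g +
  fixes U :: "'a set" and \<xi> :: "('a, 'e) vfield"
  assumes open_U: "openin (atlas_topology A) U" and unit_field: "unit_vector_field A g U \<xi>"
begin

lemma \<xi>_field: "smooth_vector_field A U \<xi>" and \<xi>_unit: "p \<in> U \<Longrightarrow> g p (\<xi> p) (\<xi> p) = 1"
  using unit_field by (auto simp: unit_vector_field_def)

lemma unit_field_coord_chart:
  assumes c: "c \<in> A"
  shows "unit_field_coord (snd c ` fst c) (metric_coord A g c) (snd c ` (fst c \<inter> U)) (rep c \<xi>)"
proof -
  interpret coord_metric "snd c ` fst c" "metric_coord A g c" by (rule coord_metric_chart[OF c])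
  show ?thesis
  proof
    show "open (snd c ` (fst c \<inter> U))" by (rule open_image[OF c open_U])
    show "snd c ` (fst c \<inter> U) \<subseteq> snd c ` fst c" by auto
    show "smooth_on (snd c ` (fst c \<inter> U)) (rep c \<xi>)" by (rule smooth_rep[OF \<xi>_field c])
    fix x assume "x \<in> snd c ` (fst c \<inter> U)"
    then obtain p where p: "p \<in> fst c" "p \<in> U" "x = snd c p" by auto
    show "metric_coord A g c x (rep c \<xi> x) (rep c \<xi> x) = 1"
      using g_eq_metric_coord[OF c p(1) field_tangent[OF \<xi>_field p(2)] field_tangent[OF \<xi>_field p(2)]] \<xi>_unit[OF p(2)]
      by (simp add: p(3) rep_chart[OF c p(1)])
  qed
qed

context
  fixes c assumes c: "c \<in> A"
begin

interpretation UF: unit_field_coord "snd c ` fst c" "metric_coord A g c" "snd c ` (fst c \<inter> U)" "rep c \<xi>"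
  by (rule unit_field_coord_chart[OF c])

lemma rep_nabla:
  assumes "x \<in> snd c ` fst c"
  shows "rep c (nabla A g X Y) x = UF.cov (rep c X) (rep c Y) x"
proof -
  obtain p where p: "p \<in> fst c" "x = snd c p" using assms by auto
  show ?thesis
    unfolding p(2) rep_chart[OF c p(1)] nabla_chart[OF c p(1)] UF.cov_def christoffel_eq_levi_civita ..
qed

lemma cov_cong:
  assumes "X x = X' x" "open S" "x \<in> S" "\<And>y. y \<in> S \<Longrightarrow> Y y = Y' y"
  shows "UF.cov X Y x = UF.cov X' Y' x"
  using der_cong[OF assms(2,3,4)] assms(1) assms(4)[OF assms(3)] by (simp add: UF.cov_def)

lemma rep_nabla_nabla:
  assumes "x \<in> snd c ` fst c"
  shows "rep c (nabla A g X (nabla A g Y Z)) x = UF.cov (rep c X) (UF.cov (rep c Y) (rep c Z)) x"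
  unfolding rep_nabla[OF assms] by (rule cov_cong[OF refl chart_open[OF c] assms rep_nabla])

lemma curvature_chart:
  assumes p: "p \<in> fst c" "p \<in> V" and V: "openin (atlas_topology A) V"
    and sm: "smooth_on (snd c ` (fst c \<inter> V)) (rep c X)" "smooth_on (snd c ` (fst c \<inter> V)) (rep c Y)"
      "smooth_on (snd c ` (fst c \<inter> V)) (rep c Z)"
  shows "curvature A g X Y Z p c = UF.Riem (snd c p) (X p c) (Y p c) (Z p c)"
proof -
  have x: "snd c p \<in> snd c ` fst c" and xV: "snd c p \<in> snd c ` (fst c \<inter> V)" using p by auto
  have "rep c (lie_bracket A X Y) (snd c p)
      = der (rep c Y) (snd c p) (rep c X (snd c p)) - der (rep c X) (snd c p) (rep c Y (snd c p))"
    using p c by (simp add: rep_chart lie_bracket_def) (simp add: rep_def[abs_def])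
  then have "UF.cov (rep c (lie_bracket A X Y)) (rep c Z) (snd c p)
    = UF.cov (\<lambda>x. der (rep c Y) x (rep c X x) - der (rep c X) x (rep c Y x)) (rep c Z) (snd c p)"
    by (intro cov_cong[OF _ chart_open[OF c] x]) auto
  moreover have "curvature A g X Y Z p c = rep c (nabla A g X (nabla A g Y Z)) (snd c p)
      - rep c (nabla A g Y (nabla A g X Z)) (snd c p) - rep c (nabla A g (lie_bracket A X Y) Z) (snd c p)"
    by (simp add: curvature_def rep_chart[OF c p(1)])
  ultimately show ?thesis
    unfolding rep_nabla_nabla[OF x] unfolding rep_nabla[OF x]
    using UF.cov_curvature[OF xV open_image[OF c V] _ sm] by (auto simp: rep_chart[OF c p(1)])
qed

lemma A_op_chart: "p \<in> fst c \<Longrightarrow> A_op A g \<xi> X p c = - UF.cov1 (snd c p) (X p c)"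
  using rep_nabla[of "snd c p" X \<xi>] by (simp add: A_op_def rep_chart[OF c] UF.cov_\<xi>)

lemma smooth_A_op:
  assumes V: "openin (atlas_topology A) V" "V \<subseteq> U" and X: "smooth_vector_field A V X"
  shows "smooth_on (snd c ` (fst c \<inter> V)) (rep c (A_op A g \<xi> X))"
proof (rule smooth_on_eqI)
  show o: "open (snd c ` (fst c \<inter> V))" by (rule open_image[OF c V(1)])
  show "smooth_on (snd c ` (fst c \<inter> V)) (\<lambda>x. - UF.cov1 x (rep c X x))"
    by (intro smooth_on_minus o UF.smooth_cov1 smooth_rep[OF X c]) (use V(2) in auto)
  fix x assume "x \<in> snd c ` (fst c \<inter> V)"
  then show "rep c (A_op A g \<xi> X) x = - UF.cov1 x (rep c X x)"
    by (auto simp: rep_chart[OF c] A_op_chart)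
qed

text \<open>All derivatives of \<open>X\<close> and \<open>Y\<close> have cancelled in
  \<open>cov_cov_\<xi>\<close> and \<open>cov_curvature\<close>, so the left-hand side depends only
  on their values at \<open>p\<close>.\<close>

lemma defect_chart:
  assumes V: "openin (atlas_topology A) V" "V \<subseteq> U"
    and X: "smooth_vector_field A V X" and Y: "smooth_vector_field A V Y" and p: "p \<in> V" "p \<in> fst c"
  shows "(Hess A g \<xi> X Y p + A_op A g \<xi> (Hm A g \<xi> X Y) p - g p (A_op A g \<xi> X p) (A_op A g \<xi> Y p) *\<^sub>R \<xi> p) c
    = UF.tg_defect (snd c p) (X p c) (Y p c)"
proof -
  let ?S = "snd c ` (fst c \<inter> V)"
  let ?x = "snd c p"
  have x: "?x \<in> snd c ` fst c" and xS: "?x \<in> ?S" and xU: "?x \<in> snd c ` (fst c \<inter> U)" using p V by auto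
  have S: "open ?S" "?S \<subseteq> snd c ` (fst c \<inter> U)" using open_image[OF c V(1)] V(2) by auto
  note sX = smooth_rep[OF X c] and sY = smooth_rep[OF Y c]
  have s\<xi>: "smooth_on ?S (rep c \<xi>)" by (rule smooth_on_subset[OF smooth_rep[OF \<xi>_field c] S(2)])
  have nA: "nabla_A_op A g \<xi> X Y p c = - (UF.cov2 ?x (X p c) (Y p c) - UF.cov1 ?x (UF.\<Gamma> ?x (X p c) (Y p c)))"
    if X: "smooth_vector_field A V X" and Y: "smooth_vector_field A V Y" for X Y
  proof -
    have "UF.cov (rep c (nabla A g X Y)) (rep c \<xi>) ?x = UF.cov (UF.cov (rep c X) (rep c Y)) (rep c \<xi>) ?x"
      by (intro cov_cong[OF _ chart_open[OF c] x]) (simp_all add: rep_nabla[OF x])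
    moreover have "nabla_A_op A g \<xi> X Y p c
        = - (rep c (nabla A g X (nabla A g Y \<xi>)) ?x - rep c (nabla A g (nabla A g X Y) \<xi>) ?x)"
      by (simp add: nabla_A_op_def rep_chart[OF c p(2)])
    ultimately show ?thesis
      unfolding rep_nabla_nabla[OF x] unfolding rep_nabla[OF x]
      using UF.cov_cov_\<xi>[OF xS S smooth_rep[OF X c] smooth_rep[OF Y c]] by (simp add: rep_chart[OF c p(2)])
  qed
  have hess: "Hess A g \<xi> X Y p c = UF.hess ?x (X p c) (Y p c)"
    by (simp add: Hess_def scaleR_fun_def nA[OF X Y] nA[OF Y X] UF.hess_def
        UF.levi_civita_sym[OF x, of "Y p c" "X p c"] algebra_simps flip: scaleR_add_left)
  have hm: "Hm A g \<xi> X Y p c = UF.hm ?x (X p c) (Y p c)"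
    using curvature_chart[OF p(2,1) V(1) s\<xi> smooth_A_op[OF V X] sY]
      curvature_chart[OF p(2,1) V(1) s\<xi> smooth_A_op[OF V Y] sX]
    by (simp add: Hm_def scaleR_fun_def A_op_chart[OF p(2)] UF.Riem_minus_right[OF x] UF.hm_def
        rep_chart[OF c p(2)] algebra_simps)
  have t: "A_op A g \<xi> X p \<in> tangent_space A p" if X: "smooth_vector_field A V X" for X
  proof -
    have "A_op A g \<xi> X p = (-1) *\<^sub>R nabla A g X \<xi> p" by (simp add: A_op_def)
    moreover have "nabla A g X \<xi> p \<in> tangent_space A p"
      by (rule nabla_tangent[where V=U]) (use p V open_U \<xi>_field field_tangent[OF X p(1)] in auto)
    ultimately show ?thesis using tangent_space_scale by metis
  qed
  have "g p (A_op A g \<xi> X p) (A_op A g \<xi> Y p)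
      = metric_coord A g c ?x (UF.cov1 ?x (X p c)) (UF.cov1 ?x (Y p c))"
    unfolding g_eq_metric_coord[OF c p(2) t[OF X] t[OF Y]] A_op_chart[OF p(2)] by (simp add: UF.M_arith[OF x])
  then show ?thesis
    by (simp add: hess A_op_chart[OF p(2)] hm UF.tg_defect_def rep_chart[OF c p(2)] scaleR_fun_def)
qed

end

text \<open>A tangent vector is a family over all charts, with value 0 at charts not containing the
  point. Equality of such families has to be checked there as well.\<close>

lemma defect_outside:
  assumes "p \<in> U" "\<not> (c \<in> A \<and> p \<in> fst c)"
  shows "(Hess A g \<xi> X Y p + A_op A g \<xi> Z p - r *\<^sub>R \<xi> p) c = 0"
  using assms(2) tangent_vector_outside[OF field_tangent[OF \<xi>_field assms(1)] assms(2)]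
  by (auto simp: Hess_def nabla_A_op_def A_op_def nabla_def scaleR_fun_def)

text \<open>Fields with constant components in \<open>c\<close> realize every pair of vectors at a
  point, so that the equation for fields yields the equation for vectors.\<close>

lemma constant_field:
  assumes c: "c \<in> A" and V: "openin (atlas_topology A) V" "V \<subseteq> fst c"
  shows "smooth_vector_field A V (\<lambda>p. coord_vector A c p a)"
  unfolding smooth_vector_field_def
proof (intro conjI ballI)
  show "coord_vector A c p a \<in> tangent_space A p" if "p \<in> V" for p
    using coord_vector_tangent[OF c] that V(2) by auto
  fix d assume d: "d \<in> A"
  let ?S = "snd d ` (fst d \<inter> V)"
  have oS: "open ?S" by (rule open_image[OF d V(1)])
  have sub: "?S \<subseteq> snd d ` (fst d \<inter> fst c)" using V(2) by auto
  have "smooth_on ?S (\<lambda>x. der (transition c d) (transition d c x) a)"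
    by (rule smooth_on_compose[OF oS smooth_on_der[OF transition_smooth[OF c d]]
          smooth_on_subset[OF transition_smooth[OF d c] sub]])
      (use V(2) d in auto)
  then show "smooth_on ?S (\<lambda>x. coord_vector A c (chart_inv d x) a d)"
    by (rule smooth_on_eqI[OF _ oS]) (use d in \<open>auto simp: coord_vector_def\<close>)
qed

end

section \<open>The submanifold of a unit vector field\<close>

locale unit_section = unit_bundle A g G T1 + unit_field A g U \<xi>
  for A :: "('a, 'e::euclidean_space) chart set" and g G
    and T1 :: "('a \<times> ('a, 'e) tvec, 'f::euclidean_space) chart set" and U \<xi>
begin

definition image_\<xi> :: "('a \<times> ('a, 'e) tvec) set"
  where "image_\<xi> = (\<lambda>q. (q, \<xi> q)) ` U"

text \<open>The image of \<xi> is a graph over \<open>U\<close>, so a chart of M composed with the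
  projection to the base point is a chart of it, with model space \<open>'e\<close>.\<close>

definition base_chart :: "('a, 'e) chart \<Rightarrow> ('a \<times> ('a, 'e) tvec, 'e) chart"
  where "base_chart c = (image_\<xi> \<inter> {Q. fst Q \<in> fst c}, \<lambda>Q. snd c (fst Q))"

lemma fst_base_chart: "Q \<in> fst (base_chart c) \<longleftrightarrow> Q \<in> image_\<xi> \<and> fst Q \<in> fst c"
  and snd_base_chart: "snd (base_chart c) Q = snd c (fst Q)"
  by (simp_all add: base_chart_def)

lemma image_\<xi>_iff: "Q \<in> image_\<xi> \<longleftrightarrow> fst Q \<in> U \<and> snd Q = \<xi> (fst Q)"
  by (cases Q) (auto simp: image_\<xi>_def)

lemma U_carrier: "U \<subseteq> atlas_carrier A"
  using open_U openin_iff by blast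

lemma image_\<xi>_subset: "image_\<xi> \<subseteq> unit_tangent_bundle A g"
  using U_carrier field_tangent[OF \<xi>_field] \<xi>_unit
  by (auto simp: image_\<xi>_def unit_tangent_bundle_def)

lemma image_\<xi>_tchart: "Q \<in> image_\<xi> \<Longrightarrow> fst Q \<in> fst c \<Longrightarrow> Q \<in> fst (tchart c)"
  using field_tangent[OF \<xi>_field, of "fst Q"] by (simp add: fst_tangent_chart image_\<xi>_iff)

lemma T1_openin:
  assumes "openin (atlas_topology (tangent_atlas A)) T"
  shows "openin (atlas_topology T1) (unit_tangent_bundle A g \<inter> T)"
  unfolding T1.openin_iff
proof (intro conjI ballI)
  show "unit_tangent_bundle A g \<inter> T \<subseteq> atlas_carrier T1" unfolding T1_carrier by simp
  fix d assume d: "d \<in> T1"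
  have "fst d \<inter> (unit_tangent_bundle A g \<inter> T) = fst d \<inter> T"
    using TM.submanifold_chartD(2)[OF T1_submanifold_chart[OF d]] by blast
  then show "open (snd d ` (fst d \<inter> (unit_tangent_bundle A g \<inter> T)))"
    using TM.submanifold_chart_open[OF T1_submanifold_chart[OF d] assms] by simp
qed

section \<open>The image of the field over one chart of M\<close>

context
  fixes c assumes c: "c \<in> A"
begin

abbreviation "M1 \<equiv> metric_coord A g c"
abbreviation "M2 \<equiv> metric_coord (tangent_atlas A) G (tchart c)"
abbreviation "base_dom \<equiv> snd c ` (fst c \<inter> U)"

interpretation SS: sasaki_section "snd c ` fst c" M1 M2 base_dom "rep c \<xi>"
  by (rule sasaki_section.intro[OF sasaki_coord_chart[OF c] unit_field_coord_chart[OF c]])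

lemma graph_chart: "Q \<in> fst (base_chart c) \<Longrightarrow> SS.graph (snd c (fst Q)) = snd (tchart c) Q"
  by (auto simp: fst_base_chart SS.graph_def rep_chart[OF c] snd_tangent_chart image_\<xi>_iff)

lemma base_chart_inj: "inj_on (snd (base_chart c)) (fst (base_chart c))"
proof (rule inj_onI)
  fix Q R assume Q: "Q \<in> fst (base_chart c)" and R: "R \<in> fst (base_chart c)" and "snd (base_chart c) Q = snd (base_chart c) R"
  then have "fst Q = fst R" using inj_onD[OF chart_inj[OF c]] by (simp add: fst_base_chart snd_base_chart)
  then show "Q = R" using Q R by (simp add: fst_base_chart image_\<xi>_iff prod_eq_iff)
qed

lemma base_chart_image: "snd (base_chart c) ` fst (base_chart c) = base_dom"
proof
  show "snd (base_chart c) ` fst (base_chart c) \<subseteq> base_dom"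
    by (auto simp: fst_base_chart snd_base_chart image_\<xi>_iff)
  show "base_dom \<subseteq> snd (base_chart c) ` fst (base_chart c)"
  proof
    fix x assume "x \<in> base_dom"
    then obtain p where "p \<in> fst c" "p \<in> U" "x = snd c p" by blast
    then show "x \<in> snd (base_chart c) ` fst (base_chart c)"
      by (intro image_eqI[of _ _ "(p, \<xi> p)"]) (auto simp: fst_base_chart snd_base_chart image_\<xi>_iff)
  qed
qed

text \<open>This is continuity of the section into TM, read in charts through
  \<open>graph\<close>.\<close>

lemma base_chart_preimage:
  assumes T: "openin (atlas_topology (tangent_atlas A)) T"
  shows "open (snd (base_chart c) ` (fst (base_chart c) \<inter> T))"
proof -
  note tc = tangent_chart_in[OF c]
  have "snd (base_chart c) ` (fst (base_chart c) \<inter> T)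
      = base_dom \<inter> SS.graph -` (snd (tchart c) ` (fst (tchart c) \<inter> T))"
  proof (intro equalityI subsetI)
    fix x assume "x \<in> snd (base_chart c) ` (fst (base_chart c) \<inter> T)"
    then obtain Q where Q: "Q \<in> fst (base_chart c)" "Q \<in> T" "x = snd c (fst Q)" by (auto simp: snd_base_chart)
    then show "x \<in> base_dom \<inter> SS.graph -` (snd (tchart c) ` (fst (tchart c) \<inter> T))"
      using graph_chart[OF Q(1)] image_\<xi>_tchart[of Q c] by (auto simp: fst_base_chart image_\<xi>_iff)
  next
    fix x assume x: "x \<in> base_dom \<inter> SS.graph -` (snd (tchart c) ` (fst (tchart c) \<inter> T))"
    then have "x \<in> snd (base_chart c) ` fst (base_chart c)" unfolding base_chart_image by blast
    then obtain Q where Q: "Q \<in> fst (base_chart c)" "x = snd c (fst Q)"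
      by (auto simp: snd_base_chart)
    have "Q \<in> fst (tchart c)" using Q image_\<xi>_tchart by (auto simp: fst_base_chart)
    then have "Q \<in> T"
      using x graph_chart[OF Q(1)] Q(2) TM.chart_mem_image_iff[OF tc, of Q "fst (tchart c) \<inter> T"] by simp
    then show "x \<in> snd (base_chart c) ` (fst (base_chart c) \<inter> T)" using Q by (auto simp: snd_base_chart)
  qed
  then show ?thesis
    using open_preimage_Int[OF SS.graph_smooth SS.open_W TM.open_image[OF tc T]] by simp
qed

text \<open>Smoothness in both directions is imported from TM. In a chart \<open>e\<close> of the
  unit tangent bundle the section is the local extension of \<open>e\<close> applied to
  \<open>graph\<close>; conversely the base point is the first component of the inclusion into
  TM.\<close>

lemma base_chart_mem: "base_chart c \<in> submanifold_atlas T1 image_\<xi>"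
proof -
  note tc = tangent_chart_in[OF c]
  let ?W = "fst (base_chart c)"
  let ?\<psi> = "snd (base_chart c)"
  have "(?W, ?\<psi>) \<in> submanifold_atlas T1 image_\<xi>"
  proof (rule T1.submanifold_atlasI[where T="unit_tangent_bundle A g \<inter> fst (tchart c)"])
    show "openin (atlas_topology T1) (unit_tangent_bundle A g \<inter> fst (tchart c))"
      by (rule T1_openin[OF TM.chart_openin[OF tc]])
    show "?W = image_\<xi> \<inter> (unit_tangent_bundle A g \<inter> fst (tchart c))"
      using image_\<xi>_subset image_\<xi>_tchart by (auto simp: fst_base_chart fst_tangent_chart)
    show "inj_on ?\<psi> ?W" by (rule base_chart_inj)
    show "open (?\<psi> ` ?W)" unfolding base_chart_image by (rule SS.open_W)
    fix Q assume Q: "Q \<in> ?W"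
    then have "Q \<in> atlas_carrier T1" using image_\<xi>_subset T1_carrier by (auto simp: fst_base_chart)
    then obtain e where e: "e \<in> T1" "Q \<in> fst e" by (auto simp: atlas_carrier_def)
    obtain T where T: "openin (atlas_topology (tangent_atlas A)) T" "fst e = unit_tangent_bundle A g \<inter> T"
      using TM.submanifold_chartD(1)[OF T1_submanifold_chart[OF e(1)]] by blast
    have We: "?W \<inter> fst e = ?W \<inter> T" using T(2) image_\<xi>_subset by (auto simp: fst_base_chart)
    have o: "open (?\<psi> ` (?W \<inter> fst e))" unfolding We by (rule base_chart_preimage[OF T(1)])
    have inv: "chart_inv (?W, ?\<psi>) (?\<psi> R) = R" if "R \<in> ?W" for R
      using that base_chart_inj by (simp add: chart_inv_def inv_into_f_f)
    have sm: "smooth_on (?\<psi> ` (?W \<inter> fst e)) (T1.par (?W, ?\<psi>) e)"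
    proof (rule smooth_on_local)
      fix x assume "x \<in> ?\<psi> ` (?W \<inter> fst e)"
      then obtain R where R: "R \<in> ?W" "R \<in> fst e" "x = ?\<psi> R" by blast
      have RC: "R \<in> fst (tchart c)" using R(1) image_\<xi>_tchart by (auto simp: fst_base_chart)
      obtain S k where S: "open S" "snd (tchart c) R \<in> S" "smooth_on S k"
        "\<forall>q\<in>fst e \<inter> fst (tchart c). snd (tchart c) q \<in> S \<longrightarrow> k (snd (tchart c) q) = snd e q"
        using TM.submanifold_chartD(8)[OF T1_submanifold_chart[OF e(1)] tc R(2) RC] by blast
      define Z where "Z = ?\<psi> ` (?W \<inter> fst e) \<inter> (base_dom \<inter> SS.graph -` S)"
      have oZ: "open Z" unfolding Z_def by (intro open_Int o open_preimage_Int SS.graph_smooth SS.open_W S(1))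
      have "smooth_on Z (\<lambda>x. k (SS.graph x))"
        by (rule smooth_on_compose[OF oZ S(3) smooth_on_subset[OF SS.graph_smooth]]) (auto simp: Z_def)
      then have "smooth_on Z (T1.par (?W, ?\<psi>) e)"
      proof (rule smooth_on_eqI[OF _ oZ])
        fix z assume z: "z \<in> Z"
        then obtain q where q: "q \<in> ?W" "q \<in> fst e" "z = ?\<psi> q" unfolding Z_def by blast
        have qC: "q \<in> fst (tchart c)" using q(1) image_\<xi>_tchart by (auto simp: fst_base_chart)
        have gq: "SS.graph z = snd (tchart c) q" using graph_chart[OF q(1)] q(3) by (simp add: snd_base_chart)
        have "snd (tchart c) q \<in> S" using z gq unfolding Z_def by auto
        then have "k (snd (tchart c) q) = snd e q" using S(4) q(2) qC by blast
        then show "T1.par (?W, ?\<psi>) e z = k (SS.graph z)" using inv[OF q(1)] unfolding gq by (simp add: T1.par_def q(3))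
      qed
      moreover have "x \<in> Z"
      proof -
        have "SS.graph x = snd (tchart c) R" using graph_chart[OF R(1)] R(3) by (simp add: snd_base_chart)
        moreover have "x \<in> base_dom" unfolding base_chart_image[symmetric] using R by blast
        ultimately show ?thesis using R S(2) by (auto simp: Z_def)
      qed
      ultimately show "\<exists>T. open T \<and> x \<in> T \<and> smooth_on T (T1.par (?W, ?\<psi>) e)" using oZ by blast
    qed
    have "smooth_on (incl_dom c e) (\<lambda>y. fst (incl c e y))"
      by (rule smooth_on_fst[OF incl_dom_open[OF c e(1)] incl_smooth[OF c e(1)]])
    moreover have "snd e Q \<in> incl_dom c e"
      using e(2) Q image_\<xi>_tchart by (auto simp: fst_base_chart)
    moreover have "fst (incl c e (snd e q)) = ?\<psi> q" if "q \<in> ?W \<inter> fst e" for q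
      using incl_chart[OF c e(1), of q] that by (simp add: snd_base_chart)
    ultimately have "\<exists>S k. open S \<and> snd e Q \<in> S \<and> smooth_on S k \<and> (\<forall>q\<in>?W \<inter> fst e. snd e q \<in> S \<longrightarrow> k (snd e q) = ?\<psi> q)"
      using incl_dom_open[OF c e(1)] by blast
    then show "\<exists>e\<in>T1. Q \<in> fst e \<and> open (?\<psi> ` (?W \<inter> fst e)) \<and> smooth_on (?\<psi> ` (?W \<inter> fst e)) (T1.par (?W, ?\<psi>) e) \<and>
      (\<exists>S k. open S \<and> snd e Q \<in> S \<and> smooth_on S k \<and> (\<forall>q\<in>?W \<inter> fst e. snd e q \<in> S \<longrightarrow> k (snd e q) = ?\<psi> q))"
      using e o sm by blast
  qed
  then show ?thesis by simp
qed

lemma incl_base_par: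
  assumes d: "d \<in> T1" and Q: "Q \<in> fst (base_chart c)" "Q \<in> fst d"
  shows "incl c d (T1.par (base_chart c) d (snd c (fst Q))) = SS.graph (snd c (fst Q))"
    and "T1.par (base_chart c) d (snd c (fst Q)) \<in> incl_dom c d"
proof -
  have "T1.par (base_chart c) d (snd c (fst Q)) = snd d Q"
    using T1.par_chart[OF base_chart_mem Q(1), of d] by (simp add: snd_base_chart)
  moreover have "Q \<in> fst (tchart c)" using Q(1) image_\<xi>_tchart by (auto simp: fst_base_chart)
  ultimately show "incl c d (T1.par (base_chart c) d (snd c (fst Q))) = SS.graph (snd c (fst Q))"
    "T1.par (base_chart c) d (snd c (fst Q)) \<in> incl_dom c d"
    using incl_chart[OF c d Q(2)] graph_chart[OF Q(1)] Q(2) by (auto simp: snd_tangent_chart)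
qed

lemma base_par_smooth:
  assumes d: "d \<in> T1"
  shows "open (snd (base_chart c) ` (fst (base_chart c) \<inter> fst d))"
    "smooth_on (snd (base_chart c) ` (fst (base_chart c) \<inter> fst d)) (T1.par (base_chart c) d)"
  using T1.submanifold_chartD(6,7)[OF base_chart_mem d] by auto

lemma der_incl_base_par:
  assumes d: "d \<in> T1" and Q: "Q \<in> fst (base_chart c)" "Q \<in> fst d"
  shows "der (incl c d) (snd d Q) (der (T1.par (base_chart c) d) (snd c (fst Q)) v) = der SS.graph (snd c (fst Q)) v"
proof -
  let ?B = "snd (base_chart c) ` (fst (base_chart c) \<inter> fst d)"
  let ?x = "snd c (fst Q)"
  have x: "?x \<in> ?B" using Q by (auto simp: snd_base_chart)
  have px: "T1.par (base_chart c) d ?x = snd d Q"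
    using T1.par_chart[OF base_chart_mem Q(1), of d] by (simp add: snd_base_chart)
  have "der (\<lambda>x. incl c d (T1.par (base_chart c) d x)) ?x = der SS.graph ?x"
    by (rule der_cong[OF base_par_smooth(1)[OF d] x])
      (use incl_base_par(1)[OF d] in \<open>auto simp: snd_base_chart\<close>)
  moreover have "der (\<lambda>x. incl c d (T1.par (base_chart c) d x)) ?x v
      = der (incl c d) (T1.par (base_chart c) d ?x) (der (T1.par (base_chart c) d) ?x v)"
    by (rule der_compose[OF smooth_on_differentiable[OF base_par_smooth(2)[OF d] x]
          smooth_on_differentiable[OF incl_smooth[OF c d] incl_base_par(2)[OF d Q]]])
  ultimately show ?thesis unfolding px by simp
qed

lemma tangent_image_\<xi>:
  assumes "Q \<in> fst (base_chart c)"
  shows "submanifold_tangent TYPE('e) T1 image_\<xi> Q = range (T1.push (base_chart c) Q)"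
  by (rule T1.submanifold_tangent_eq[OF base_chart_mem assms])

lemma push_base_chart:
  "d \<in> T1 \<Longrightarrow> Q \<in> fst d \<Longrightarrow> T1.push (base_chart c) Q v d = der (T1.par (base_chart c) d) (snd c (fst Q)) v"
  by (simp add: T1.push_def snd_base_chart)

text \<open>In each chart \<open>d\<close> the derivative is computed after inclusion into TM. There
  it is \<open>V\<close>: the derivative along the section, minus its normal component, plus a
  tangent vector coming from the variation of the components of \<open>Y\<close>. The last one does
  not affect tangency, which leaves \<open>tangent_part_iff\<close>.\<close>

lemma second_fundamental_form_iff:
  assumes Q: "Q \<in> fst (base_chart c)" "Q \<in> S" and S: "openin (atlas_topology T1) S"
    and Y: "smooth_vector_field T1 S Y"
    and tan: "\<And>R. R \<in> image_\<xi> \<inter> S \<Longrightarrow> Y R \<in> submanifold_tangent TYPE('e) T1 image_\<xi> R"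
    and XQ: "X Q = T1.push (base_chart c) Q a" and YQ: "Y Q = T1.push (base_chart c) Q b"
  shows "nabla T1 induced X Y Q \<in> submanifold_tangent TYPE('e) T1 image_\<xi> Q
    \<longleftrightarrow> SS.tg_defect (snd c (fst Q)) a b = 0"
proof -
  let ?x = "snd c (fst Q)"
  let ?bc = "base_chart c"
  have xW: "?x \<in> base_dom" using Q by (auto simp: fst_base_chart image_\<xi>_iff)
  have xO: "?x \<in> snd c ` fst c" using xW by auto
  have Qt: "Q \<in> fst (tchart c)" using Q(1) image_\<xi>_tchart by (auto simp: fst_base_chart)
  \<comment> \<open>\<beta> lists the components of \<open>Y\<close> along the image in
    \<open>base_chart c\<close>. They are chosen pointwise; their smoothness is recovered below by
    reading them off as first components in TM.\<close>
  define \<beta> where "\<beta> x = (SOME v. Y (chart_inv ?bc x) = T1.push ?bc (chart_inv ?bc x) v)" for x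
  have \<beta>: "Y R = T1.push ?bc R (\<beta> (snd c (fst R)))" if "R \<in> fst ?bc" "R \<in> S" for R
  proof -
    have "\<exists>v. Y R = T1.push ?bc R v"
      using tan[of R] tangent_image_\<xi>[OF that(1)] that by (auto simp: fst_base_chart)
    moreover have "chart_inv ?bc (snd c (fst R)) = R"
      using T1.submanifold_chart_inv[OF base_chart_mem that(1)] by (simp add: snd_base_chart)
    ultimately show ?thesis unfolding \<beta>_def by (metis (mono_tags, lifting) someI_ex)
  qed
  \<comment> \<open>The Sasaki product of \<open>second\<close> with the vertical vector over \<xi>,
    which is the unit normal of the unit tangent bundle: its first component is 0 and
    \<open>conn\<close> sends it to \<xi>.\<close>
  define \<mu> where "\<mu> = M1 ?x (SS.conn ?x (rep c \<xi> ?x) (SS.second ?x a b)) (rep c \<xi> ?x)"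
  define V where "V = SS.second ?x a b - \<mu> *\<^sub>R (0, rep c \<xi> ?x) + der SS.graph ?x (der \<beta> ?x a)"
  have key: "der (incl c d) (snd d Q) (nabla T1 induced X Y Q d) = V" if d: "d \<in> T1" "Q \<in> fst d" for d
  proof -
    let ?F = "incl c d"
    let ?P = "incl_dom c d"
    let ?y = "snd d Q"
    let ?\<sigma> = "T1.par ?bc d"
    let ?B = "snd ?bc ` (fst ?bc \<inter> (fst d \<inter> S))"
    let ?u = "rep c \<xi> ?x"
    have Fy: "?F ?y = (?x, ?u)"
      using incl_chart[OF c d] graph_chart[OF Q(1)] by (simp add: SS.graph_def snd_tangent_chart)
    have yP: "?y \<in> ?P" using d Qt by blast
    have oB: "open ?B"
      by (rule T1.submanifold_chart_open[OF base_chart_mem openin_Int[OF T1.chart_openin[OF d(1)] S]])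
    have xB: "?x \<in> ?B" using Q d by (auto simp: snd_base_chart)
    have Bq: "\<exists>R. R \<in> fst ?bc \<and> R \<in> fst d \<and> R \<in> S \<and> x = snd c (fst R)" if "x \<in> ?B" for x
      using that unfolding image_iff Bex_def snd_base_chart by blast
    have \<sigma>R: "?\<sigma> (snd c (fst R)) = snd d R" if "R \<in> fst ?bc" for R
      using T1.par_chart[OF base_chart_mem that, of d] by (simp add: snd_base_chart)
    have \<sigma>s: "smooth_on ?B ?\<sigma>"
      by (rule smooth_on_subset[OF base_par_smooth(2)[OF d(1)]]) blast
    let ?PS = "?P \<inter> snd d ` (fst d \<inter> S)"
    have oPS: "open ?PS" using incl_dom_open[OF c d(1)] T1.open_image[OF d(1) S] by (rule open_Int)
    have yPS: "?y \<in> ?PS" using yP d Q by blast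
    define k where "k y = der ?F y (T1.rep d Y y)" for y
    have ks: "smooth_on ?PS k"
      unfolding k_def
      by (rule smooth_on_der_apply[OF incl_smooth[OF c d(1)] oPS Int_lower1 smooth_on_subset[OF T1.smooth_rep[OF Y d(1)]]]) blast
    have \<sigma>PS: "?\<sigma> x \<in> ?PS" if x: "x \<in> ?B" for x
    proof -
      obtain R where R: "R \<in> fst ?bc" "R \<in> fst d" "R \<in> S" "x = snd c (fst R)" using Bq[OF x] by blast
      then show ?thesis using incl_base_par(2)[OF d(1) R(1,2)] \<sigma>R[OF R(1)] by auto
    qed
    have k\<sigma>: "k (?\<sigma> x) = der SS.graph x (\<beta> x)" if x: "x \<in> ?B" for x
    proof -
      obtain R where R: "R \<in> fst ?bc" "R \<in> fst d" "R \<in> S" "x = snd c (fst R)" using Bq[OF x] by blast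
      have "T1.rep d Y (snd d R) = der ?\<sigma> x (\<beta> x)"
        using \<beta>[OF R(1,3)] push_base_chart[OF d(1) R(2)] by (simp add: T1.rep_chart[OF d(1) R(2)] R(4))
      then show ?thesis
        using der_incl_base_par[OF d(1) R(1,2), of "\<beta> x"] unfolding k_def by (simp add: R(4) \<sigma>R[OF R(1)])
    qed
    have BW: "?B \<subseteq> base_dom" unfolding base_chart_image[symmetric] by blast
    have k\<sigma>s: "smooth_on ?B (\<lambda>x. k (?\<sigma> x))"
      by (rule smooth_on_compose[OF oB ks \<sigma>s]) (use \<sigma>PS in blast)
    have \<beta>s: "smooth_on ?B \<beta>"
    proof (rule smooth_on_eqI[OF smooth_on_fst[OF oB k\<sigma>s] oB])
      fix x assume x: "x \<in> ?B"
      then have "x \<in> base_dom" using BW by blast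
      then show "\<beta> x = fst (k (?\<sigma> x))" by (simp add: k\<sigma>[OF x] SS.der_graph)
    qed
    have "\<beta> ?x = b"
    proof -
      have "der SS.graph ?x (\<beta> ?x) = der SS.graph ?x b"
        using \<beta>[OF Q] YQ push_base_chart[OF d, of "\<beta> ?x"] push_base_chart[OF d, of b]
          der_incl_base_par[OF d(1) Q(1) d(2)] by metis
      then show ?thesis by (simp add: SS.der_graph[OF xW])
    qed
    have FX: "der ?F ?y (X Q d) = der SS.graph ?x a" and FY: "der ?F ?y (Y Q d) = der SS.graph ?x b"
      using der_incl_base_par[OF d(1) Q(1) d(2)] by (simp_all add: XQ YQ push_base_chart[OF d])
    \<comment> \<open>\<open>k\<close> is \<open>Y\<close> seen in TM. Since \<open>X Q\<close> is
      tangent to the image, the derivative in that direction depends on the values of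
      \<open>k\<close> along the section alone, where they are known.\<close>
    have "der k ?y (X Q d) = der (\<lambda>x. k (?\<sigma> x)) ?x a"
      using der_compose[OF smooth_on_differentiable[OF \<sigma>s xB], of k a]
        smooth_on_differentiable[OF ks yPS] by (simp add: \<sigma>R[OF Q(1)] XQ push_base_chart[OF d])
    also have "der (\<lambda>x. k (?\<sigma> x)) ?x = der (\<lambda>x. der SS.graph x (\<beta> x)) ?x"
      by (rule der_cong[OF oB xB k\<sigma>])
    also have "der (\<lambda>x. der SS.graph x (\<beta> x)) ?x a = der (\<lambda>x. der SS.graph x b) ?x a + der SS.graph ?x (der \<beta> ?x a)"
      using der_der_apply[OF SS.open_W SS.graph_smooth oB BW xB \<beta>s, of a] \<open>\<beta> ?x = b\<close> by simp
    finally have dk: "der k ?y (X Q d) = der (\<lambda>x. der SS.graph x b) ?x a + der SS.graph ?x (der \<beta> ?x a)" .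
    have nab: "M2 (?x, ?u) (der ?F ?y (nabla T1 induced X Y Q d)) (der ?F ?y z)
      = M2 (?x, ?u) (V + \<mu> *\<^sub>R (0, ?u)) (der ?F ?y z)" for z
    proof -
      have "der k ?y (X Q d) + levi_civita M2 (?x, ?u) (der SS.graph ?x a) (der SS.graph ?x b) = V + \<mu> *\<^sub>R (0, ?u)"
        unfolding dk V_def SS.second_def by (simp add: SS.graph_def)
      then show ?thesis
        using nabla_pullback[OF c d(1) d(2) Qt S Q(2) Y, of X z] by (simp add: Fy FX FY k_def[symmetric, abs_def])
    qed
    have range: "range (der ?F ?y) = {w. M1 ?x (SS.conn ?x ?u w) ?u = 0}"
      using range_der_incl[OF c d(1) yP] by (simp add: Fy)
    have cu: "SS.conn ?x ?u (0, ?u) = ?u" by (simp add: SS.conn_def SS.levi_civita_arith[OF xO])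
    \<comment> \<open>\<open>V\<close> has no normal component: that of \<open>second\<close> is
      removed by \<mu>, and the remaining term is orthogonal to \<xi> since \<xi> has constant
      length.\<close>
    have "M1 ?x (SS.conn ?x ?u V) ?u = \<mu> - \<mu> * M1 ?x ?u ?u + M1 ?x (SS.cov1 ?x (der \<beta> ?x a)) ?u"
      unfolding V_def SS.conn_arith[OF xO] SS.M_arith[OF xO] cu SS.conn_graph[OF xW] \<mu>_def ..
    also have "\<dots> = 0" by (simp add: SS.\<xi>_unit[OF xW] SS.cov1_orthogonal[OF xW])
    finally have "V \<in> range (der ?F ?y)" unfolding range by simp
    then obtain t where t: "V = der ?F ?y t" by blast
    have zu: "M2 (?x, ?u) (0, ?u) (der ?F ?y z) = 0" for z
    proof -
      have "der ?F ?y z \<in> {w. M1 ?x (SS.conn ?x ?u w) ?u = 0}" unfolding range[symmetric] by blast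
      then show ?thesis
        by (simp add: SS.M2_conn[OF xO] cu SS.M_arith[OF xO] SS.M_sym[OF xO, of ?u])
    qed
    have xu: "(?x, ?u) \<in> snd c ` fst c \<times> UNIV" using xO by simp
    \<comment> \<open>The included derivative and \<open>V\<close> are both tangent to the unit
      tangent bundle and have equal products with all tangent vectors. The differential maps
      \<open>n\<close> to their difference, which is tangent, hence orthogonal to itself, and
      vanishes.\<close>
    define n where "n = nabla T1 induced X Y Q d - t"
    have dn: "der ?F ?y n = der ?F ?y (nabla T1 induced X Y Q d) - V"
      unfolding n_def linear_diff[OF linear_der_incl[OF c d(1) yP]] t ..
    have "M2 (?x, ?u) (der ?F ?y n) (der ?F ?y n)
        = M2 (?x, ?u) (der ?F ?y (nabla T1 induced X Y Q d)) (der ?F ?y n) - M2 (?x, ?u) V (der ?F ?y n)"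
      by (subst (1) dn) (rule SS.S.M_arith(3)[OF xu])
    also have "\<dots> = 0"
      unfolding nab SS.S.M_arith(1,7)[OF xu] zu by simp
    finally have "M2 (?x, ?u) (der ?F ?y n) (der ?F ?y n) = 0" .
    then have "der ?F ?y n = 0" using SS.S.M_pos[OF xu, of "der ?F ?y n"] by force
    then show ?thesis using dn by simp
  qed
  have "Q \<in> atlas_carrier T1" using image_\<xi>_subset T1_carrier Q(1) by (auto simp: fst_base_chart)
  then obtain d0 where d0: "d0 \<in> T1" "Q \<in> fst d0" by (auto simp: atlas_carrier_def)
  have "nabla T1 induced X Y Q \<in> submanifold_tangent TYPE('e) T1 image_\<xi> Q
    \<longleftrightarrow> (\<exists>v. nabla T1 induced X Y Q = T1.push ?bc Q v)"
    unfolding tangent_image_\<xi>[OF Q(1)] by blast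
  also have "\<dots> \<longleftrightarrow> (\<exists>v. V = der SS.graph ?x v)"
  proof (intro iffI; elim exE)
    fix v assume v: "nabla T1 induced X Y Q = T1.push ?bc Q v"
    have "V = der SS.graph ?x v"
      unfolding key[OF d0, symmetric] v push_base_chart[OF d0] by (rule der_incl_base_par[OF d0(1) Q(1) d0(2)])
    then show "\<exists>v. V = der SS.graph ?x v" ..
  next
    fix v assume v: "V = der SS.graph ?x v"
    \<comment> \<open>Vectors are equal when all their components are, so \<open>key\<close> is
      needed here for every chart \<open>d\<close>, while one chart suffices in the other
      direction.\<close>
    have "nabla T1 induced X Y Q d = T1.push ?bc Q v d" for d
    proof (cases "d \<in> T1 \<and> Q \<in> fst d")
      case True
      then have d: "d \<in> T1" "Q \<in> fst d" by auto
      have "snd d Q \<in> incl_dom c d" using d Qt by blast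
      moreover have "der (incl c d) (snd d Q) (nabla T1 induced X Y Q d) = der (incl c d) (snd d Q) (T1.push ?bc Q v d)"
        unfolding key[OF d] v push_base_chart[OF d] by (rule der_incl_base_par[OF d(1) Q(1) d(2), symmetric])
      ultimately show ?thesis by (rule der_incl_inj[OF c d(1)])
    next
      case False
      then show ?thesis by (auto simp: nabla_def T1.push_def)
    qed
    then show "\<exists>v. nabla T1 induced X Y Q = T1.push ?bc Q v" by blast
  qed
  also have "\<dots> \<longleftrightarrow> (\<exists>v. SS.second ?x a b - \<mu> *\<^sub>R (0, rep c \<xi> ?x) = der SS.graph ?x v)"
  proof (intro iffI; elim exE)
    note l = smooth_on_linear_der[OF SS.graph_smooth xW]
    fix v assume "V = der SS.graph ?x v"
    then have "SS.second ?x a b - \<mu> *\<^sub>R (0, rep c \<xi> ?x) = der SS.graph ?x (v - der \<beta> ?x a)"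
      unfolding linear_diff[OF l] V_def by (simp add: algebra_simps)
    then show "\<exists>v. SS.second ?x a b - \<mu> *\<^sub>R (0, rep c \<xi> ?x) = der SS.graph ?x v" ..
  next
    note l = smooth_on_linear_der[OF SS.graph_smooth xW]
    fix v assume "SS.second ?x a b - \<mu> *\<^sub>R (0, rep c \<xi> ?x) = der SS.graph ?x v"
    then have "V = der SS.graph ?x (v + der \<beta> ?x a)"
      unfolding linear_add[OF l] V_def by simp
    then show "\<exists>v. V = der SS.graph ?x v" ..
  qed
  also have "\<dots> \<longleftrightarrow> SS.tg_defect ?x a b = 0"
    unfolding \<mu>_def by (rule SS.tangent_part_iff[OF xW])
  finally show ?thesis .
qed

text \<open>Fields of the unit tangent bundle that extend the constant fields of the image of \<open>\<xi>\<close>: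
  at \<open>(x, u)\<close> the vertical part is \<open>\<nabla>\<^sub>a \<xi>\<close> projected to the orthogonal complement of \<open>u\<close>.\<close>

definition ext :: "'e \<Rightarrow> 'e \<times> 'e \<Rightarrow> 'e \<times> 'e"
  where "ext a z = (a, SS.cov1 (fst z) a - M1 (fst z) (SS.cov1 (fst z) a) (snd z) *\<^sub>R snd z - SS.\<Gamma> (fst z) a (snd z))"

definition ext_dom :: "('a \<times> ('a, 'e) tvec) set"
  where "ext_dom = unit_tangent_bundle A g \<inter> {Q \<in> fst (tchart c). snd (tchart c) Q \<in> base_dom \<times> UNIV}"

definition ext_field :: "'e \<Rightarrow> ('a \<times> ('a, 'e) tvec, 'f) vfield"
  where "ext_field a = (\<lambda>Q d. if d \<in> T1 \<and> Q \<in> fst d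
    then THE v. der (incl c d) (snd d Q) v = ext a (incl c d (snd d Q)) else 0)"

lemma open_base_times: "open (base_dom \<times> (UNIV :: 'e set))"
  by (intro open_Times SS.open_W open_UNIV)

lemma ext_smooth: "smooth_on (base_dom \<times> UNIV) (ext a)"
proof -
  let ?D = "base_dom \<times> (UNIV :: 'e set)"
  note oD = open_base_times
  note f = smooth_on_projections[OF oD]
  have "smooth_on ?D (\<lambda>z. SS.cov1 (fst z) a)"
    by (rule smooth_on_compose[OF oD SS.smooth_cov1[OF smooth_on_const SS.open_W order_refl] f(1)]) auto
  then show ?thesis
    unfolding ext_def
    by (intro smooth_on_Pair smooth_on_diff smooth_on_scaleR SS.M_smooth_on SS.levi_civita_smooth_on
        smooth_on_const oD f) auto
qed

lemma ext_dom_openin: "openin (atlas_topology T1) ext_dom"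
  unfolding ext_dom_def
  by (rule T1_openin[OF TM.openin_chart_preimage[OF tangent_chart_in[OF c] open_base_times]])

lemma ext_domD:
  assumes "Q \<in> ext_dom" shows "Q \<in> fst (tchart c)" "snd c (fst Q) \<in> base_dom"
  using assms by (auto simp: ext_dom_def snd_tangent_chart)

text \<open>Subtracting the component along the unit vector \<open>u\<close> makes the vertical part
  of \<open>ext\<close> orthogonal to \<open>u\<close>. By \<open>range_der_incl\<close> the value
  then is tangent to the bundle, and injectivity of the differential gives the unique
  preimage.\<close>

lemma ext_field_eq:
  assumes Q: "Q \<in> ext_dom" and d: "d \<in> T1" "Q \<in> fst d"
  shows "der (incl c d) (snd d Q) (ext_field a Q d) = ext a (incl c d (snd d Q))"
proof -
  let ?z = "incl c d (snd d Q)"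
  have y: "snd d Q \<in> incl_dom c d" using ext_domD(1)[OF Q] d by blast
  have xW: "fst ?z \<in> base_dom" using ext_domD(2)[OF Q] incl_chart[OF c d] by simp
  then have xO: "fst ?z \<in> snd c ` fst c" by auto
  have "SS.conn (fst ?z) (snd ?z) (ext a ?z)
      = SS.cov1 (fst ?z) a - M1 (fst ?z) (SS.cov1 (fst ?z) a) (snd ?z) *\<^sub>R snd ?z"
    by (simp add: SS.conn_def ext_def)
  then have "M1 (fst ?z) (SS.conn (fst ?z) (snd ?z) (ext a ?z)) (snd ?z) = 0"
    by (simp add: SS.M_arith[OF xO] incl_unit[OF c d(1) y])
  then have "ext a ?z \<in> range (der (incl c d) (snd d Q))"
    unfolding range_der_incl[OF c d(1) y] by simp
  then obtain v where v: "der (incl c d) (snd d Q) v = ext a ?z" by (metis imageE)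
  have "(THE v. der (incl c d) (snd d Q) v = ext a ?z) = v"
    by (rule the_equality, rule v, rule der_incl_inj[OF c d(1) y]) (simp add: v)
  then show ?thesis using v d by (simp add: ext_field_def)
qed

text \<open>The transformation law is tested after inclusion into TM, where both sides become the
  same value of \<open>ext\<close> and the differential of the inclusion is injective.\<close>

lemma ext_field_tangent:
  assumes Q: "Q \<in> ext_dom" shows "ext_field a Q \<in> tangent_space T1 Q"
proof -
  have "ext_field a Q d' = der (transition d d') (snd d Q) (ext_field a Q d)"
    if d: "d \<in> T1" "Q \<in> fst d" and d': "d' \<in> T1" "Q \<in> fst d'" for d d'
  proof (rule der_incl_inj[OF c d'(1)])
    note Qt = ext_domD(1)[OF Q]
    show "snd d' Q \<in> incl_dom c d'" using Qt d' by blast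
    have "der (incl c d') (snd d' Q) (der (transition d d') (snd d Q) (ext_field a Q d))
        = der (incl c d) (snd d Q) (ext_field a Q d)"
      by (rule TM.der_par_change[OF T1_submanifold_chart[OF d(1)] T1_submanifold_chart[OF d'(1)]
            tangent_chart_in[OF c] d(2) d'(2) Qt, symmetric])
    then show "der (incl c d') (snd d' Q) (ext_field a Q d')
      = der (incl c d') (snd d' Q) (der (transition d d') (snd d Q) (ext_field a Q d))"
      unfolding ext_field_eq[OF Q d] ext_field_eq[OF Q d'] incl_chart[OF c d] incl_chart[OF c d'] by simp
  qed
  moreover have "ext_field a Q d = 0" if "\<not> (d \<in> T1 \<and> Q \<in> fst d)" for d
    unfolding ext_field_def using that by (simp only: if_False)
  ultimately show ?thesis unfolding tangent_space_def by blast
qed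

text \<open>The differential of the inclusion is not invertible, but the inclusion has a smooth
  local left inverse \<open>k\<close>, and the components are \<open>der k\<close> applied to
  \<open>ext\<close>.\<close>

lemma ext_field_smooth: "smooth_vector_field T1 ext_dom (ext_field a)"
  unfolding smooth_vector_field_def
proof (intro conjI ballI)
  show "ext_field a Q \<in> tangent_space T1 Q" if "Q \<in> ext_dom" for Q by (rule ext_field_tangent[OF that])
  fix d assume d: "d \<in> T1"
  note tc = tangent_chart_in[OF c] and ds = T1_submanifold_chart[OF d]
  let ?B = "snd d ` (fst d \<inter> ext_dom)"
  have oB: "open ?B" by (rule T1.open_image[OF d ext_dom_openin])
  show "smooth_on ?B (\<lambda>y. ext_field a (chart_inv d y) d)"
  proof (rule smooth_on_local)
    fix y assume "y \<in> ?B"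
    then obtain Q where Q: "Q \<in> fst d" "Q \<in> ext_dom" "y = snd d Q" by blast
    obtain S k Z where S: "open S" "snd (tchart c) Q \<in> S" "smooth_on S k"
      and Z: "open Z" "snd d Q \<in> Z" "Z \<subseteq> incl_dom c d"
      and ZS: "\<And>y. y \<in> Z \<Longrightarrow> incl c d y \<in> S" and k: "\<And>y. y \<in> Z \<Longrightarrow> k (incl c d y) = y"
      and dk: "\<And>y v. y \<in> Z \<Longrightarrow> der k (incl c d y) (der (incl c d) y v) = v"
      by (rule TM.der_par_left_inverse[OF ds tc Q(1) ext_domD(1)[OF Q(2)]]) blast
    let ?Z = "Z \<inter> ?B"
    have oZ: "open ?Z" using Z(1) oB by (rule open_Int)
    have iD: "incl c d y \<in> base_dom \<times> UNIV" if y: "y \<in> ?B" for y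
    proof -
      obtain R where R: "R \<in> fst d" "R \<in> ext_dom" "y = snd d R" using y by blast
      then show ?thesis using incl_chart[OF c d R(1)] ext_domD(2)[OF R(2)] by simp
    qed
    let ?D = "S \<inter> base_dom \<times> (UNIV :: 'e set)"
    have oD: "open ?D" using S(1) open_base_times by (rule open_Int)
    have "smooth_on ?D (\<lambda>z. der k z (ext a z))"
      by (rule smooth_on_der_apply[OF S(3) oD Int_lower1 smooth_on_subset[OF ext_smooth Int_lower2]])
    then have "smooth_on ?Z (\<lambda>y. der k (incl c d y) (ext a (incl c d y)))"
      by (rule smooth_on_compose[OF oZ _ smooth_on_subset[OF incl_smooth[OF c d]]])
        (use Z(3) ZS iD in blast)+
    then have "smooth_on ?Z (\<lambda>y. ext_field a (chart_inv d y) d)"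
    proof (rule smooth_on_eqI[OF _ oZ])
      fix y assume y: "y \<in> ?Z"
      then obtain R where R: "R \<in> fst d" "R \<in> ext_dom" "y = snd d R" by blast
      show "ext_field a (chart_inv d y) d = der k (incl c d y) (ext a (incl c d y))"
        using dk[of y "ext_field a R d"] y ext_field_eq[OF R(2) d R(1), of a] T1.chart_inv_chart[OF d R(1)] R(3)
        by simp
    qed
    then show "\<exists>T. open T \<and> y \<in> T \<and> smooth_on T (\<lambda>y. ext_field a (chart_inv d y) d)"
      using oZ Z(2) Q by blast
  qed
qed

text \<open>On the image the fibre vector is \<xi>, to which \<open>cov1\<close> is orthogonal, so
  the projection subtracts nothing and \<open>ext\<close> becomes the derivative of
  \<open>graph\<close> in the direction \<open>a\<close>.\<close>

lemma ext_field_image: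
  assumes Q: "Q \<in> image_\<xi>" "Q \<in> ext_dom"
  shows "ext_field a Q = T1.push (base_chart c) Q a"
proof
  fix d
  have Qt: "Q \<in> fst (tchart c)" by (rule ext_domD(1)[OF Q(2)])
  then have Qb: "Q \<in> fst (base_chart c)" using Q(1) by (simp add: fst_base_chart fst_tangent_chart)
  show "ext_field a Q d = T1.push (base_chart c) Q a d"
  proof (cases "d \<in> T1 \<and> Q \<in> fst d")
    case True
    then have d: "d \<in> T1" "Q \<in> fst d" by auto
    have xW: "snd c (fst Q) \<in> base_dom" by (rule ext_domD(2)[OF Q(2)])
    have z: "incl c d (snd d Q) = (snd c (fst Q), rep c \<xi> (snd c (fst Q)))"
      using incl_chart[OF c d] graph_chart[OF Qb] by (simp add: SS.graph_def snd_tangent_chart)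
    have "ext a (incl c d (snd d Q)) = der SS.graph (snd c (fst Q)) a"
      unfolding z by (simp add: ext_def SS.der_graph[OF xW] SS.cov1_orthogonal[OF xW]) (simp add: SS.cov1_def)
    then have "der (incl c d) (snd d Q) (ext_field a Q d) = der (incl c d) (snd d Q) (T1.push (base_chart c) Q a d)"
      unfolding ext_field_eq[OF Q(2) d] push_base_chart[OF d] der_incl_base_par[OF d(1) Qb d(2)] .
    moreover have "snd d Q \<in> incl_dom c d" using d Qt by blast
    ultimately show ?thesis by (intro der_incl_inj[OF c d(1)])
  next
    case False
    then show ?thesis unfolding ext_field_def T1.push_def by (simp only: if_False)
  qed
qed

lemma totally_geodesic_imp_defect:
  assumes tg: "totally_geodesic_submanifold TYPE('e) T1 induced image_\<xi>" and p: "p \<in> fst c" "p \<in> U"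
  shows "SS.tg_defect (snd c p) a b = 0"
proof -
  define Q where "Q = (p, \<xi> p)"
  have Qi: "Q \<in> image_\<xi>" using p by (simp add: Q_def image_\<xi>_iff)
  have Qb: "Q \<in> fst (base_chart c)" using p Qi by (simp add: Q_def fst_base_chart)
  have Qe: "Q \<in> ext_dom"
    using Qi image_\<xi>_subset image_\<xi>_tchart[OF Qi, of c] p by (auto simp: ext_dom_def snd_tangent_chart Q_def)
  have tan: "ext_field v R \<in> submanifold_tangent TYPE('e) T1 image_\<xi> R" if R: "R \<in> image_\<xi> \<inter> ext_dom" for v R
  proof -
    have "R \<in> fst (base_chart c)" using R ext_domD(1)[of R] by (simp add: fst_base_chart fst_tangent_chart)
    then show ?thesis using ext_field_image[of R v] R tangent_image_\<xi> by auto
  qed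
  have "nabla T1 induced (ext_field a) (ext_field b) Q \<in> submanifold_tangent TYPE('e) T1 image_\<xi> Q"
    using tg tan ext_field_smooth ext_dom_openin Qi Qe unfolding totally_geodesic_submanifold_def by blast
  then have "SS.tg_defect (snd c (fst Q)) a b = 0"
    using second_fundamental_form_iff[OF Qb Qe ext_dom_openin ext_field_smooth tan, of "ext_field a" a b]
      ext_field_image[OF Qi Qe] by blast
  then show ?thesis by (simp add: Q_def)
qed

end

section \<open>The two sides of the equivalence as statements about all charts\<close>

lemma image_\<xi>_embedded: "embedded_submanifold TYPE('e) T1 image_\<xi>"
  unfolding embedded_submanifold_def
proof
  show "image_\<xi> \<subseteq> atlas_carrier T1" using image_\<xi>_subset T1_carrier by simp
  show "atlas_carrier (submanifold_atlas T1 image_\<xi> :: ('a \<times> ('a, 'e) tvec, 'e) chart set) = image_\<xi>"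
  proof
    show "atlas_carrier (submanifold_atlas T1 image_\<xi> :: ('a \<times> ('a, 'e) tvec, 'e) chart set) \<subseteq> image_\<xi>"
      unfolding atlas_carrier_def using T1.submanifold_chartD(2) by blast
    show "image_\<xi> \<subseteq> atlas_carrier (submanifold_atlas T1 image_\<xi> :: ('a \<times> ('a, 'e) tvec, 'e) chart set)"
    proof
      fix Q assume Q: "Q \<in> image_\<xi>"
      then obtain c where c: "c \<in> A" "fst Q \<in> fst c"
        using U_carrier by (auto simp: image_\<xi>_iff atlas_carrier_def)
      then have "Q \<in> fst (base_chart c)" using Q by (simp add: fst_base_chart)
      then show "Q \<in> atlas_carrier (submanifold_atlas T1 image_\<xi> :: ('a \<times> ('a, 'e) tvec, 'e) chart set)"
        unfolding atlas_carrier_def using base_chart_mem[OF c(1)] by blast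
    qed
  qed
qed

text \<open>From left to right the fields \<open>ext_field\<close> probe all pairs of coordinate
  vectors; from right to left only the components of the given fields at the point in question enter
  the defect.\<close>

lemma totally_geodesic_iff:
  "totally_geodesic_submanifold TYPE('e) T1 induced image_\<xi> \<longleftrightarrow>
    (\<forall>c\<in>A. \<forall>p\<in>fst c \<inter> U. \<forall>a b. unit_field_coord.tg_defect (metric_coord A g c) (rep c \<xi>) (snd c p) a b = 0)"
    (is "?L \<longleftrightarrow> ?R")
proof
  assume ?L then show ?R using totally_geodesic_imp_defect by blast
next
  assume R: ?R
  show ?L
    unfolding totally_geodesic_submanifold_def
  proof (intro conjI image_\<xi>_embedded allI impI ballI)
    fix S X Y Q
    assume h: "openin (atlas_topology T1) S \<and> smooth_vector_field T1 S X \<and> smooth_vector_field T1 S Y \<and>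
      (\<forall>p\<in>image_\<xi> \<inter> S. X p \<in> submanifold_tangent TYPE('e) T1 image_\<xi> p \<and> Y p \<in> submanifold_tangent TYPE('e) T1 image_\<xi> p)"
      and Q: "Q \<in> image_\<xi> \<inter> S"
    obtain c where c: "c \<in> A" "fst Q \<in> fst c"
      using Q U_carrier by (auto simp: image_\<xi>_iff atlas_carrier_def)
    have Qb: "Q \<in> fst (base_chart c)" using Q c by (simp add: fst_base_chart)
    obtain a b where ab: "X Q = T1.push (base_chart c) Q a" "Y Q = T1.push (base_chart c) Q b"
      using h Q tangent_image_\<xi>[OF c(1) Qb] by blast
    have QS: "Q \<in> S" and S: "openin (atlas_topology T1) S" and Y: "smooth_vector_field T1 S Y"
      and tan: "\<And>R. R \<in> image_\<xi> \<inter> S \<Longrightarrow> Y R \<in> submanifold_tangent TYPE('e) T1 image_\<xi> R"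
      using h Q by blast+
    have "fst Q \<in> U" using Q by (simp add: image_\<xi>_iff)
    then show "nabla T1 induced X Y Q \<in> submanifold_tangent TYPE('e) T1 image_\<xi> Q"
      using second_fundamental_form_iff[where X=X and Y=Y and a=a and b=b, OF c(1) Qb QS S Y tan ab] R c by blast
  qed
qed

lemma defect_field_iff:
  "(\<forall>V X Y. openin (atlas_topology A) V \<and> V \<subseteq> U \<and> smooth_vector_field A V X \<and> smooth_vector_field A V Y \<longrightarrow>
      (\<forall>p\<in>V. Hess A g \<xi> X Y p + A_op A g \<xi> (Hm A g \<xi> X Y) p
         - g p (A_op A g \<xi> X p) (A_op A g \<xi> Y p) *\<^sub>R \<xi> p = 0)) \<longleftrightarrow>
    (\<forall>c\<in>A. \<forall>p\<in>fst c \<inter> U. \<forall>a b. unit_field_coord.tg_defect (metric_coord A g c) (rep c \<xi>) (snd c p) a b = 0)"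
    (is "?L \<longleftrightarrow> ?R")
proof
  assume L: ?L
  show ?R
  proof (intro ballI allI)
    fix c p a b assume c: "c \<in> A" and p: "p \<in> fst c \<inter> U"
    let ?V = "fst c \<inter> U"
    have V: "openin (atlas_topology A) ?V" by (rule openin_Int[OF chart_openin[OF c] open_U])
    define X where "X a = (\<lambda>p. coord_vector A c p a)" for a
    have X: "smooth_vector_field A ?V (X a)" for a
      unfolding X_def by (rule constant_field[OF c V Int_lower1])
    have pc: "p \<in> fst c" using p by simp
    have "Hess A g \<xi> (X a) (X b) p + A_op A g \<xi> (Hm A g \<xi> (X a) (X b)) p
         - g p (A_op A g \<xi> (X a) p) (A_op A g \<xi> (X b) p) *\<^sub>R \<xi> p = 0"
      using L V X p by blast
    then show "unit_field_coord.tg_defect (metric_coord A g c) (rep c \<xi>) (snd c p) a b = 0"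
      using defect_chart[OF c V Int_lower2 X X p pc, of a b] c pc by (simp add: X_def)
  qed
next
  assume R: ?R
  show ?L
  proof (intro allI impI ballI ext)
    fix V X Y p c
    assume h: "openin (atlas_topology A) V \<and> V \<subseteq> U \<and> smooth_vector_field A V X \<and> smooth_vector_field A V Y"
      and p: "p \<in> V"
    show "(Hess A g \<xi> X Y p + A_op A g \<xi> (Hm A g \<xi> X Y) p
         - g p (A_op A g \<xi> X p) (A_op A g \<xi> Y p) *\<^sub>R \<xi> p) c = 0 c"
    proof (cases "c \<in> A \<and> p \<in> fst c")
      case True
      then have c: "c \<in> A" "p \<in> fst c" by auto
      have V: "openin (atlas_topology A) V" "V \<subseteq> U" and X: "smooth_vector_field A V X" and Y: "smooth_vector_field A V Y"
        using h by blast+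
      have "p \<in> fst c \<inter> U" using c(2) p V(2) by blast
      then show ?thesis
        unfolding defect_chart[OF c(1) V X Y p c(2)] using R c(1) by simp
    next
      case False
      have "p \<in> U" using h p by blast
      from defect_outside[OF this False] show ?thesis by simp
    qed
  qed
qed

end

theorem lemma2p2:
  fixes A :: "('a, 'e::euclidean_space) chart set"
    and g :: "('a, 'e) metric"
    and G :: "('a \<times> ('a, 'e) tvec, 'e \<times> 'e) metric"
    and T1 :: "('a \<times> ('a, 'e) tvec, 'f::euclidean_space) chart set"
    and \<xi> :: "('a, 'e) vfield"
    and U :: "'a set"
  assumes "smooth_manifold A" and "riemannian_metric A g"
    and "sasaki_metric A g G"
    and "DIM('f) + 1 = 2 * DIM('e)"
    and "T1 = unit_tangent_atlas A g"
    and "openin (atlas_topology A) U" and "unit_vector_field A g U \<xi>"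
  shows "totally_geodesic_submanifold TYPE('e) T1 (induced_metric (tangent_atlas A) G T1)
           ((\<lambda>q. (q, \<xi> q)) ` U) \<longleftrightarrow>
    (\<forall>V X Y. openin (atlas_topology A) V \<and> V \<subseteq> U \<and>
        smooth_vector_field A V X \<and> smooth_vector_field A V Y \<longrightarrow>
      (\<forall>p\<in>V. Hess A g \<xi> X Y p + A_op A g \<xi> (Hm A g \<xi> X Y) p
         - g p (A_op A g \<xi> X p) (A_op A g \<xi> Y p) *\<^sub>R \<xi> p = 0))"
proof -
  have "smooth_atlas A"
    using assms(1) unfolding smooth_manifold_def smooth_atlas_def by blast
  then interpret unit_section A g G T1 U \<xi>
    using assms inj_on_tangent_chart[OF assms(1)]
    by (simp add: unit_section_def unit_bundle_def sasaki_def riemannian_atlas_def riemannian_atlas_axioms_def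
        sasaki_axioms_def unit_bundle_axioms_def unit_field_def unit_field_axioms_def)
  show ?thesis
    using totally_geodesic_iff defect_field_iff unfolding image_\<xi>_def by simp
qed

end
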